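(* Consider the autoregressive stochastic-volatility model described in the context, in the nearly stationary regime $\rho_n = 1-\frac{c}{k_n}$, under the rate separation condition that $r_n^q=o(k_n)$ and $k_n r_n^q=o(n)$ for every fixed $q>0$, and with initial value satisfying $\mathbb{E}[y_0^4]=o(k_n^2)$. Let $\widehat\rho_n=\sum_{t=1}^n y_{t-1}y_t\big/\sum_{t=1}^n y_{t-1}^2$, let the local deviation rate $\gamma_n$ be defined by $\rho_n=1-n^{-\gamma_n}$, and let $$\widehat\gamma_n:=-\frac{\log|\widehat\rho_n-1|}{\log n}.$$ Let $\lambda\in(0,1)$ and $z_\lambda:=\Phi^{-1}\!\left(\frac{1+\lambda}{2}\right)$, where $\Phi^{-1}$ is the standard normal quantile function. Then, if $\widehat\rho_n<1$, the interval $$\widehat\rho_n\;\pm\; z_\lambda\,\frac{\sqrt{2}}{n^{(1+\widehat\gamma_n)/2}}$$ is an asymptotic $100\lambda\%$ confidence interval for $\rho_n$, and the interval $$\widehat\gamma_n\;\pm\; z_\lambda\,\frac{\sqrt{2}}{n^{(1-\widehat\gamma_n)/2}\log n}$$ is an asymptotic $100\lambda\%$ confidence interval for $\gamma_n$. That is, conditionally on the event $\{\widehat\rho_n<1\}$, the probability that the first interval contains $\rho_n$ and the probability that the second interval contains $\gamma_n$ each converge to $\lambda$ as $n\to\infty$.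
   Context: Model. Fixed constants: $c>0$, $d>0$, $\alpha>0$. Deterministic sequences: $k_n>0$ with $k_n\to\infty$ and $k_n=o(n)$; $r_n>1$, where either $r_n\to\infty$ or $r_n$ is constant. The volatility persistence parameter is $\phi_n=1-\frac{d}{\log r_n}$, and $|\phi_n|<1$. For each $n$ (triangular array; dependence on $n$ is suppressed in the notation) and $1\le t\le n$, $$y_t=\rho_n y_{t-1}+u_t,\qquad u_t=\sigma_t\varepsilon_t,\qquad \log\sigma_t^2=\phi_n\log\sigma_{t-1}^2+\eta_t .$$ Here $(\varepsilon_t)_{t\ge1}$ are i.i.d. with $\mathbb{E}[\varepsilon_t]=0$, $\mathbb{E}[\varepsilon_t^2]=1$, $\mathbb{E}[\varepsilon_t^4]<\infty$; $(\eta_t)_{t\ge1}$ are i.i.d. $N(0,\alpha^2)$; the sequences $(\varepsilon_t)$ and $(\eta_t)$ are independent of each other. The initial volatility is $\sigma_0=1$, and the initial value $y_0$ (possibly depending on $n$) is independent of $\{(\varepsilon_t,\eta_t):t\ge1\}$. The estimator $\widehat\rho_n$ is the least-squares estimator (defined when its denominator is nonzero). Since $n^{-\gamma_n}=c/k_n$, one has $0<\gamma_n<1$ for all large $n$. The notation $a\pm b$ denotes the interval $[a-b,a+b]$. *)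

theory Defs
  imports "HOL-Probability.Probability" "HOL-Library.Landau_Symbols"
begin

text \<open>
  The model is a triangular array: row \<open>n\<close> lives on its own probability space \<open>M n\<close>. The rows may
  share a space and the innovations \<open>\<epsilon>\<close>, \<open>\<eta>\<close>, but need not. No relation between different rows is
  assumed, except that the law of \<open>\<epsilon>\<close> is the same in all of them, so that its moments do not depend
  on \<open>n\<close>. The \<open>\<sigma> n t\<close> are volatilities, hence positive; the equation for \<open>ln (\<sigma>\<^sup>2)\<close> alone would
  determine them only up to sign. The
  independence of \<open>y n 0\<close> from the innovations is stated for the generated \<open>\<sigma>\<close>-algebras, because
  \<^const>\<open>prob_space.indep_var\<close> requires both variables to take values in the same type.
\<close>

locale sv_ar_model =
  fixes c d \<alpha> :: real
    and k r \<phi> \<rho> :: "nat \<Rightarrow> real"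
    and M :: "nat \<Rightarrow> 'a measure"
    and \<epsilon> \<eta> \<sigma> u y :: "nat \<Rightarrow> nat \<Rightarrow> 'a \<Rightarrow> real"
  assumes c_pos: "c > 0" and d_pos: "d > 0" and \<alpha>_pos: "\<alpha> > 0"
    and k_pos: "\<And>n. k n > 0"
    and k_at_top: "filterlim k at_top sequentially"
    and k_smallo: "k \<in> o(\<lambda>n. real n)"
    and r_gt_1: "\<And>n. r n > 1"
    and r_at_top_or_const: "filterlim r at_top sequentially \<or> (\<exists>r0. \<forall>n. r n = r0)"
    and \<phi>_eq: "\<And>n. \<phi> n = 1 - d / ln (r n)"
    and \<phi>_abs: "\<And>n. \<bar>\<phi> n\<bar> < 1"
    and prob_space_M: "\<And>n. prob_space (M n)"
    and \<epsilon>_indep: "\<And>n. prob_space.indep_vars (M n) (\<lambda>_. borel) (\<epsilon> n) {1..}"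
    and \<epsilon>_distr: "\<And>m n s t. s \<ge> 1 \<Longrightarrow> t \<ge> 1 \<Longrightarrow> distr (M m) borel (\<epsilon> m s) = distr (M n) borel (\<epsilon> n t)"
    and \<epsilon>_fourth: "\<And>n t. t \<ge> 1 \<Longrightarrow> integrable (M n) (\<lambda>\<omega>. \<epsilon> n t \<omega> ^ 4)"
    and \<epsilon>_mean: "\<And>n t. t \<ge> 1 \<Longrightarrow> prob_space.expectation (M n) (\<epsilon> n t) = 0"
    and \<epsilon>_square: "\<And>n t. t \<ge> 1 \<Longrightarrow> prob_space.expectation (M n) (\<lambda>\<omega>. (\<epsilon> n t \<omega>)\<^sup>2) = 1"
    and \<eta>_indep: "\<And>n. prob_space.indep_vars (M n) (\<lambda>_. borel) (\<eta> n) {1..}"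
    and \<eta>_normal: "\<And>n t. t \<ge> 1 \<Longrightarrow> distributed (M n) lborel (\<eta> n t) (normal_density 0 \<alpha>)"
    and \<epsilon>_\<eta>_indep: "\<And>n. prob_space.indep_var (M n)
          (PiM {1..} (\<lambda>_. borel)) (\<lambda>\<omega>. \<lambda>t\<in>{1..}. \<epsilon> n t \<omega>)
          (PiM {1..} (\<lambda>_. borel)) (\<lambda>\<omega>. \<lambda>t\<in>{1..}. \<eta> n t \<omega>)"
    and y0_measurable: "\<And>n. y n 0 \<in> borel_measurable (M n)"
    and y0_indep: "\<And>n. prob_space.indep_set (M n)
          (sets (vimage_algebra (space (M n)) (y n 0) borel))
          (sets (vimage_algebra (space (M n)) (\<lambda>\<omega>. \<lambda>t\<in>{1..}. (\<epsilon> n t \<omega>, \<eta> n t \<omega>))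
            (PiM {1..} (\<lambda>_. borel \<Otimes>\<^sub>M borel))))"
    and \<sigma>_0: "\<And>n \<omega>. \<omega> \<in> space (M n) \<Longrightarrow> \<sigma> n 0 \<omega> = 1"
    and \<sigma>_pos: "\<And>n t \<omega>. \<omega> \<in> space (M n) \<Longrightarrow> t \<in> {1..n} \<Longrightarrow> \<sigma> n t \<omega> > 0"
    and \<sigma>_rec: "\<And>n t \<omega>. \<omega> \<in> space (M n) \<Longrightarrow> t \<in> {1..n} \<Longrightarrow>
          ln ((\<sigma> n t \<omega>)\<^sup>2) = \<phi> n * ln ((\<sigma> n (t - 1) \<omega>)\<^sup>2) + \<eta> n t \<omega>"
    and u_eq: "\<And>n t \<omega>. \<omega> \<in> space (M n) \<Longrightarrow> t \<in> {1..n} \<Longrightarrow> u n t \<omega> = \<sigma> n t \<omega> * \<epsilon> n t \<omega>"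
    and y_rec: "\<And>n t \<omega>. \<omega> \<in> space (M n) \<Longrightarrow> t \<in> {1..n} \<Longrightarrow>
          y n t \<omega> = \<rho> n * y n (t - 1) \<omega> + u n t \<omega>"

text \<open>The least-squares estimator is a function of an observed path \<open>x 0, \<dots>, x n\<close>.\<close>

definition ls_denom :: "nat \<Rightarrow> (nat \<Rightarrow> real) \<Rightarrow> real" where
  "ls_denom n x = (\<Sum>t=1..n. (x (t - 1))\<^sup>2)"

definition ls_estimator :: "nat \<Rightarrow> (nat \<Rightarrow> real) \<Rightarrow> real" where
  "ls_estimator n x = (\<Sum>t=1..n. x (t - 1) * x t) / ls_denom n x"

text \<open>
  Where \<open>ls_denom n x = 0\<close> the estimator is undefined mathematically but has the value \<open>0\<close> here, so
  that events concerning it need the additional conjunct \<open>ls_denom n x \<noteq> 0\<close>.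
\<close>

definition plus_minus :: "real \<Rightarrow> real \<Rightarrow> real set" (infix "\<plusminus>" 60) where
  "a \<plusminus> b = {a - b..a + b}"

text \<open>The standard normal distribution function is a bijection from the reals onto \<open>(0, 1)\<close>.\<close>

definition std_normal_quantile :: "real \<Rightarrow> real" where
  "std_normal_quantile p = (THE z. cdf std_normal_distribution z = p)"

end

(*
Squaring the recursion and summing gives
  (1 - rho^2) * sum y(t-1)^2 = sum u(t)^2 + 2 rho * sum y(t-1) u(t) + y(0)^2 - y(n)^2,
so the law of large numbers for the denominator of the least-squares estimator reduces to one for
sum u(t)^2, which holds because the log-volatility is a Gaussian autoregression with moments and
mixing time bounded by powers of r. The numerator sum y(t-1) u(t) is a martingale; its conditional
variance is handled by freezing y(t)^2 on blocks of length about k^(1/4), and its characteristic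
function is compared with the Gaussian one through McLeish's product prod (1 + i theta X(t)),
stopped when the quadratic variation exceeds 2. Hence rho_hat - rho is asymptotically normal with
variance 2c/(k n). Since n^(-gamma) = c/k and 1 - rho_hat = (c/k)(1 + o(1)), both intervals amount
to |W| <= z (1 + o(1)) for the same asymptotically standard normal W.
*)
theory Submission
  imports Defs
begin

section \<open>Square-integrable random variables\<close>

text \<open>The obstacle is that the volatility law is not fixed: when \<open>r\<close> diverges,
  the moments of \<open>vol\<close> and its mixing time may grow. Every estimate is therefore
  explicit and non-asymptotic, for one row with frozen parameters, and polynomial in
  \<open>R = exp V\<close>. The rate conditions enter only at the end, since \<open>R\<close> is
  below a power of \<open>r\<close> and every power of \<open>r\<close> is negligible against
  \<open>k\<close> and against \<open>n / k\<close>. A second obstacle is dependence: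
  \<open>Y\<close> is built from the same volatility path that multiplies it in the conditional
  variance, so the expectation of \<open>Y^2 * dev\<close> does not factorise. Revealing the whole
  volatility path before the innovations keeps the numerator a martingale, and weights depending on
  that path are carried through the moment recursion; averaging of the volatility is recovered by
  the blocks. Over \<open>b\<close> steps \<open>Y^2\<close>, of order \<open>k\<close>, moves by at
  most about \<open>b * sqrt k\<close> up to powers of \<open>R\<close>, while averaging gains a
  factor \<open>1 / sqrt b\<close>. Any block length well above the powers of \<open>R\<close> and
  well below \<open>sqrt k\<close> balances the two, and \<open>k^(1/4)\<close> is such a
  length.\<close>

context prob_space begin

definition sq_integrable :: "('a \<Rightarrow> real) \<Rightarrow> bool" where
  "sq_integrable f \<longleftrightarrow> f \<in> borel_measurable M \<and> integrable M (\<lambda>x. (f x)\<^sup>2)"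

lemma sq_integrable_square: "sq_integrable f \<Longrightarrow> integrable M (\<lambda>x. (f x)\<^sup>2)"
  by (simp add: sq_integrable_def)

lemma sq_integrable_mult:
  assumes "sq_integrable f" "sq_integrable g"
  shows "integrable M (\<lambda>x. f x * g x)"
proof (rule Bochner_Integration.integrable_bound[of M "\<lambda>x. (f x)\<^sup>2 + (g x)\<^sup>2"])
  have "\<bar>f x * g x\<bar> \<le> (f x)\<^sup>2 + (g x)\<^sup>2" for x
  proof -
    have "2 * \<bar>f x * g x\<bar> \<le> (f x)\<^sup>2 + (g x)\<^sup>2"
      using sum_squares_bound[of "\<bar>f x\<bar>" "\<bar>g x\<bar>"] by (simp add: abs_mult)
    moreover have "0 \<le> \<bar>f x * g x\<bar>" by simp
    ultimately show ?thesis by linarith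
  qed
  then show "AE x in M. norm (f x * g x) \<le> norm ((f x)\<^sup>2 + (g x)\<^sup>2)" by auto
qed (use assms in \<open>auto simp: sq_integrable_def\<close>)

lemma sq_integrable_const: "sq_integrable (\<lambda>_. a)"
  by (simp add: sq_integrable_def)

lemma sq_integrable_integrable: "sq_integrable f \<Longrightarrow> integrable M f"
  using sq_integrable_mult[OF _ sq_integrable_const[of 1]] by simp

lemma sq_integrable_add:
  assumes "sq_integrable f" "sq_integrable g"
  shows "sq_integrable (\<lambda>x. f x + g x)"
  using assms sq_integrable_mult[OF assms]
  by (auto simp: sq_integrable_def power2_sum mult.assoc)

lemma sq_integrable_cmult: "sq_integrable f \<Longrightarrow> sq_integrable (\<lambda>x. a * f x)"
  by (auto simp: sq_integrable_def power_mult_distrib)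

lemma sq_integrable_diff:
  assumes "sq_integrable f" "sq_integrable g"
  shows "sq_integrable (\<lambda>x. f x - g x)"
  using sq_integrable_add[OF assms(1) sq_integrable_cmult[OF assms(2), of "-1"]] by simp

lemma sq_integrable_sum:
  "(\<And>i. i \<in> I \<Longrightarrow> sq_integrable (f i)) \<Longrightarrow> sq_integrable (\<lambda>x. \<Sum>i\<in>I. f i x)"
  by (induction I rule: infinite_finite_induct) (auto intro: sq_integrable_add sq_integrable_const)

text \<open>Integrate \<open>2 s |f g| \<le> f^2 + s^2 g^2\<close> and choose the best
  \<open>s\<close>. The absolute value stays inside the expectation because the error terms are
  measured in L1.\<close>

lemma Cauchy_Schwarz:
  assumes f: "sq_integrable f" and g: "sq_integrable g"
  shows "expectation (\<lambda>x. \<bar>f x * g x\<bar>) \<le> sqrt (expectation (\<lambda>x. (f x)\<^sup>2) * expectation (\<lambda>x. (g x)\<^sup>2))"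
proof -
  define A B C where "A = expectation (\<lambda>x. (f x)\<^sup>2)" and "B = expectation (\<lambda>x. (g x)\<^sup>2)"
    and "C = expectation (\<lambda>x. \<bar>f x * g x\<bar>)"
  have AB: "A \<ge> 0" "B \<ge> 0" "C \<ge> 0" unfolding A_def B_def C_def by (auto intro: integral_nonneg)
  have int: "integrable M (\<lambda>x. \<bar>f x * g x\<bar>)" using sq_integrable_mult[OF f g] by simp
  have quad: "2 * s * C \<le> A + s\<^sup>2 * B" for s
  proof -
    have "2 * s * C = expectation (\<lambda>x. 2 * s * \<bar>f x * g x\<bar>)" by (simp add: C_def)
    also have "\<dots> \<le> expectation (\<lambda>x. (f x)\<^sup>2 + s\<^sup>2 * (g x)\<^sup>2)"
    proof (rule integral_mono)
      show "2 * s * \<bar>f x * g x\<bar> \<le> (f x)\<^sup>2 + s\<^sup>2 * (g x)\<^sup>2" for x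
        using sum_squares_bound[of "\<bar>f x\<bar>" "s * \<bar>g x\<bar>"]
        by (simp add: abs_mult power_mult_distrib algebra_simps)
    qed (use int f g in \<open>auto simp: sq_integrable_def\<close>)
    also have "\<dots> = A + s\<^sup>2 * B"
      using f g by (simp add: A_def B_def sq_integrable_def)
    finally show ?thesis .
  qed
  have "C\<^sup>2 \<le> A * B"
  proof (cases "B = 0")
    case True
    show ?thesis
    proof (cases "C = 0")
      case False
      then have "C > 0" using AB by simp
      \<comment> \<open>With \<open>B = 0\<close> the bound \<open>2 s C \<le> A\<close> holds for
        every \<open>s\<close>; this \<open>s\<close> would give
        \<open>2 (A + 1) \<le> A\<close>.\<close>
      from quad[of "(A + 1) / C"] True this show ?thesis by (simp add: AB)
        (use AB in linarith)
    qed (use AB in auto)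
  next
    case False
    then have "B > 0" using AB by simp
    with quad[of "C / B"] show ?thesis
      by (simp add: field_simps power2_eq_square)
  qed
  then show ?thesis using AB real_le_rsqrt unfolding A_def B_def C_def by blast
qed

lemma expectation_square_le:
  assumes "sq_integrable f"
  shows "expectation (\<lambda>x. \<bar>f x\<bar>) \<le> sqrt (expectation (\<lambda>x. (f x)\<^sup>2))"
  using Cauchy_Schwarz[OF assms sq_integrable_const[of 1]] by (simp add: prob_space)

lemma markov_abs:
  assumes "integrable M X" "e > 0"
  shows "prob {\<omega> \<in> space M. \<bar>X \<omega>\<bar> > e} \<le> expectation (\<lambda>\<omega>. \<bar>X \<omega>\<bar>) / e"
proof -
  have "prob {\<omega> \<in> space M. \<bar>X \<omega>\<bar> > e} \<le> prob {\<omega> \<in> space M. \<bar>X \<omega>\<bar> \<ge> e}"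
    using assms by (intro finite_measure_mono) auto
  also have "\<dots> \<le> expectation (\<lambda>\<omega>. \<bar>X \<omega>\<bar>) / e"
    using assms integral_Markov_inequality_measure[of M "\<lambda>\<omega>. \<bar>X \<omega>\<bar>" "{}" e] by auto
  finally show ?thesis .
qed

end

section \<open>Comparison of exp(ix) with the factor of McLeish's product\<close>

lemma norm_one_plus_i_times_exp_le:
  "cmod ((1 + \<i> * complex_of_real x) * complex_of_real (exp (- x\<^sup>2 / 2))) \<le> 1"
proof -
  have "(cmod ((1 + \<i> * x) * complex_of_real (exp (- x\<^sup>2 / 2))))\<^sup>2 = (1 + x\<^sup>2) * exp (- x\<^sup>2)"
    by (simp add: norm_mult power_mult_distrib cmod_power2 exp_double[symmetric])
  also have "\<dots> \<le> 1"
    using exp_ge_add_one_self[of "x\<^sup>2"] by (simp add: exp_minus field_simps)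
  finally show ?thesis
    by (simp add: power_le_one_iff)
qed

text \<open>The product \<open>(1 + ix) exp (- x^2 / 2)\<close> agrees with exp(ix) up to second
  order, which leaves a cubic error for small \<open>x\<close>. For \<open>|x| > 1\<close> both
  terms lie in the unit disc and the trivial bound 2 applies; that case fixes the constant, the
  Taylor case giving only 11/12.\<close>

lemma iexp_third_order:
  "cmod (iexp x - (1 + \<i> * complex_of_real x) * complex_of_real (exp (- x\<^sup>2 / 2))) \<le> 2 * \<bar>x\<bar> ^ 3"
proof (cases "\<bar>x\<bar> \<le> 1")
  case True
  define y where "y = x\<^sup>2 / 2"
  define r where "r = exp (- y) - (1 - y)"
  have y: "y \<ge> 0" by (simp add: y_def)
  have r: "\<bar>r\<bar> \<le> y\<^sup>2 / 2"
  proof -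
    have "r \<ge> 0" unfolding r_def using exp_ge_add_one_self[of "-y"] by simp
    moreover have "exp (- y) \<le> 1 - y + y\<^sup>2 / 2"
    proof -
      have "(\<lambda>t::real. 1 - t + t\<^sup>2 / 2 - exp (- t)) 0 \<le> (\<lambda>t. 1 - t + t\<^sup>2 / 2 - exp (- t)) y"
      proof (rule DERIV_nonneg_imp_nondecreasing[OF y])
        fix t :: real assume "0 \<le> t" "t \<le> y"
        have "((\<lambda>t. 1 - t + t\<^sup>2 / 2 - exp (- t)) has_real_derivative (- 1 + t + exp (- t))) (at t)"
          by (auto intro!: derivative_eq_intros)
        then show "\<exists>d. ((\<lambda>t. 1 - t + t\<^sup>2 / 2 - exp (- t)) has_real_derivative d) (at t) \<and> d \<ge> 0"
          using exp_ge_add_one_self[of "-t"] by (intro exI[of _ "- 1 + t + exp (- t)"]) auto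
      qed
      then show ?thesis by simp
    qed
    ultimately show ?thesis by (simp add: r_def)
  qed
  have 1: "cmod (iexp x - (1 + \<i> * x - x\<^sup>2 / 2)) \<le> \<bar>x\<bar> ^ 3 / 6"
    using iexp_approx1[of x 2] by (simp add: eval_nat_numeral algebra_simps)
  have 2: "(1 + \<i> * complex_of_real x) * complex_of_real (exp (- x\<^sup>2 / 2))
      = (1 + \<i> * x - x\<^sup>2 / 2) - \<i> * x ^ 3 / 2 + (1 + \<i> * x) * complex_of_real r"
  proof -
    have e: "exp (- x\<^sup>2 / 2) = 1 - x\<^sup>2 / 2 + r" by (simp add: r_def y_def)
    show ?thesis unfolding e by (simp add: algebra_simps power2_eq_square power3_eq_cube)
  qed
  have 3: "cmod ((1 + \<i> * x) * complex_of_real r) \<le> 2 * (x^4 / 8)"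
  proof -
    have "cmod (1 + \<i> * x) \<le> 2"
      using norm_triangle_ineq[of 1 "\<i> * complex_of_real x"] True by (simp add: norm_mult)
    moreover have "\<bar>r\<bar> \<le> x ^ 4 / 8" using r by (simp add: y_def power_divide)
    ultimately show ?thesis unfolding norm_mult norm_of_real by (intro mult_mono) auto
  qed
  have 4: "x ^ 4 \<le> \<bar>x\<bar> ^ 3"
  proof -
    have "x ^ 4 = \<bar>x\<bar> ^ 3 * \<bar>x\<bar>" by (simp flip: power_Suc2)
    also have "\<dots> \<le> \<bar>x\<bar> ^ 3 * 1" by (intro mult_left_mono True) simp
    finally show ?thesis by simp
  qed
  have split: "iexp x - (1 + \<i> * complex_of_real x) * complex_of_real (exp (- x\<^sup>2 / 2))
     = (iexp x - (1 + \<i> * x - x\<^sup>2 / 2)) + \<i> * x ^ 3 / 2 - (1 + \<i> * x) * complex_of_real r"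
    unfolding 2 by simp
  have "cmod (iexp x - (1 + \<i> * complex_of_real x) * complex_of_real (exp (- x\<^sup>2 / 2)))
     \<le> cmod (iexp x - (1 + \<i> * x - x\<^sup>2 / 2)) + cmod (\<i> * x ^ 3 / 2) + cmod ((1 + \<i> * x) * complex_of_real r)"
    unfolding split by (rule order_trans[OF norm_triangle_ineq4 add_right_mono[OF norm_triangle_ineq]])
  also have "\<dots> \<le> \<bar>x\<bar> ^ 3 / 6 + \<bar>x\<bar> ^ 3 / 2 + 2 * (x^4 / 8)"
    by (rule add_mono[OF add_mono[OF 1] 3]) (simp add: norm_mult norm_power norm_divide)
  also have "\<dots> \<le> 2 * \<bar>x\<bar> ^ 3"
  proof -
    have "0 \<le> \<bar>x\<bar> ^ 3" by simp
    with 4 show ?thesis by linarith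
  qed
  finally show ?thesis .
next
  case False
  have "cmod (iexp x - (1 + \<i> * x) * complex_of_real (exp (- x\<^sup>2 / 2))) \<le> 2"
    using norm_one_plus_i_times_exp_le[of x] by (intro order_trans[OF norm_triangle_ineq4]) simp
  also have "2 \<le> 2 * \<bar>x\<bar> ^ 3" using False by simp
  finally show ?thesis by simp
qed

section \<open>A quantitative martingale central limit theorem\<close>

text \<open>Keep only the constant and linear terms of the expanded product. It turns a bound on the
  stopped product into one on the stopped sum of squares.\<close>

lemma one_plus_sum_le_prod:
  fixes a :: "nat \<Rightarrow> real"
  assumes "\<And>i. a i \<ge> 0"
  shows "1 + (\<Sum>i<m. a i) \<le> (\<Prod>i<m. 1 + a i)"
proof (induction m)
  case (Suc m)
  have "0 \<le> (\<Sum>i<m. a i)" by (intro sum_nonneg) (simp add: assms)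
  then have "1 + (\<Sum>i<Suc m. a i) \<le> (1 + (\<Sum>i<m. a i)) * (1 + a m)"
    using assms[of m] by (simp add: algebra_simps)
  also have "\<dots> \<le> (\<Prod>i<m. 1 + a i) * (1 + a m)"
    using assms[of m] by (intro mult_right_mono Suc.IH) auto
  finally show ?case by simp
qed simp

text \<open>Only earlier terms are tested, so the decision at time \<open>t\<close> is known before
  \<open>x t\<close>; the price is that the last retained term may overshoot. The threshold 2
  exceeds the limit 1 of the sum of squares by 1: whenever stopping acts, the full sum is at
  distance more than 1 from its limit.\<close>

definition stopped :: "(nat \<Rightarrow> real) \<Rightarrow> nat \<Rightarrow> real" where
  "stopped x t = (if (\<Sum>s<t. (x s)\<^sup>2) \<le> 2 then x t else 0)"

lemma stopped_eq:
  assumes "(\<Sum>s<n. (x s)\<^sup>2) \<le> 2" "t < n"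
  shows "stopped x t = x t"
proof -
  have "(\<Sum>s<t. (x s)\<^sup>2) \<le> (\<Sum>s<n. (x s)\<^sup>2)"
    using assms(2) by (intro sum_mono2) auto
  then show ?thesis using assms by (simp add: stopped_def)
qed

text \<open>Only the last factor before stopping is not controlled by the threshold.\<close>

lemma prod_stopped_le:
  assumes g: "g \<ge> 0"
  shows "(\<Prod>t<m. 1 + g * (stopped x t)\<^sup>2) \<le> exp (2 * g) * (1 + g * (1 + (\<Sum>t<m. x t ^ 4)))"
proof -
  have pos: "0 \<le> (\<Prod>t<m. 1 + g * (stopped x t)\<^sup>2)" for m
    using g by (intro prod_nonneg) auto
  have before: "(\<Prod>t<m. 1 + g * (stopped x t)\<^sup>2) \<le> exp (2 * g)" if "(\<Sum>s<m. (x s)\<^sup>2) \<le> 2" for m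
  proof -
    have "(\<Prod>t<m. 1 + g * (stopped x t)\<^sup>2) \<le> (\<Prod>t<m. exp (g * (x t)\<^sup>2))"
      using g stopped_eq[OF that] by (intro prod_mono) (auto intro!: add_nonneg_nonneg)
    also have "\<dots> = exp (g * (\<Sum>t<m. (x t)\<^sup>2))"
      by (simp add: exp_sum sum_distrib_left)
    also have "\<dots> \<le> exp (2 * g)" using that g by (simp add: mult.commute mult_left_mono)
    finally show ?thesis .
  qed
  have nn: "0 \<le> (\<Sum>t<m. x t ^ 4)" for m by (intro sum_nonneg) simp
  show ?thesis
  proof (induction m)
    case 0
    show ?case using g by (simp add: add_increasing2 mult_ge1_I)
  next
    case (Suc m)
    show ?case
    proof (cases "(\<Sum>s<m. (x s)\<^sup>2) \<le> 2")
      case True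
      have "(\<Prod>t<Suc m. 1 + g * (stopped x t)\<^sup>2) \<le> exp (2 * g) * (1 + g * (x m)\<^sup>2)"
        using before[OF True] True g by (simp add: stopped_def mult_right_mono)
      also have "(x m)\<^sup>2 \<le> 1 + x m ^ 4"
      proof -
        have "0 \<le> ((x m)\<^sup>2 - 1)\<^sup>2 + (x m)\<^sup>2" by simp
        then show ?thesis by (simp add: power2_diff flip: power_mult)
      qed
      also have "1 + x m ^ 4 \<le> 1 + (\<Sum>t<Suc m. x t ^ 4)" using nn[of m] by simp
      finally show ?thesis using g by (simp add: mult_left_mono)
    next
      case False
      then have "(\<Prod>t<Suc m. 1 + g * (stopped x t)\<^sup>2) = (\<Prod>t<m. 1 + g * (stopped x t)\<^sup>2)"
        by (simp add: stopped_def)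
      also note Suc.IH
      also have "exp (2 * g) * (1 + g * (1 + (\<Sum>t<m. x t ^ 4))) \<le> exp (2 * g) * (1 + g * (1 + (\<Sum>t<Suc m. x t ^ 4)))"
        using g by (intro mult_left_mono add_left_mono) auto
      finally show ?thesis .
    qed
  qed
qed

text \<open>Multiply \<open>|w| \<le> a + w^2 / a\<close> by \<open>w^2\<close>. Third moments are
  traded for second and fourth ones; with \<open>a = \<delta>\<close> and fourth moments of order
  \<open>\<delta>^2\<close>, both terms are of order \<open>\<delta>\<close>.\<close>

lemma cube_le_weighted:
  fixes a w :: real
  assumes "a > 0"
  shows "\<bar>w\<bar> ^ 3 \<le> a * w\<^sup>2 + w ^ 4 / a"
proof -
  have "\<bar>w\<bar> \<le> a + w\<^sup>2 / a"
  proof (cases "\<bar>w\<bar> \<le> a")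
    case False
    then have "\<bar>w\<bar> * a \<le> w\<^sup>2"
      using mult_left_mono[of a "\<bar>w\<bar>" "\<bar>w\<bar>"] by (simp add: power2_eq_square abs_mult_self_eq)
    then have "\<bar>w\<bar> \<le> w\<^sup>2 / a" using assms by (simp add: field_simps)
    then show ?thesis using assms by linarith
  qed (use assms in \<open>simp add: add_increasing2\<close>)
  then have "\<bar>w\<bar> * w\<^sup>2 \<le> (a + w\<^sup>2 / a) * w\<^sup>2" by (intro mult_right_mono) auto
  then show ?thesis by (simp add: algebra_simps power_numeral_reduce power2_eq_square abs_mult_self_eq)
qed

context prob_space begin

text \<open>The product \<open>T n\<close> has mean exactly 1, because every increment is orthogonal
  to the past, and the exponential of the sum is close to
  \<open>T n * exp (- \<theta>^2 V / 2)\<close> with \<open>V\<close> near 1. Orthogonality is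
  demanded against all square-integrable \<open>G\<close>, not just bounded ones, since stopping
  controls \<open>T m\<close> only in L2, by means of the fourth moments.\<close>

lemma martingale_char_bound:
  fixes F :: "nat \<Rightarrow> 'a measure" and X :: "nat \<Rightarrow> 'a \<Rightarrow> real"
  assumes sub: "\<And>t. subalgebra M (F t)" and mono: "\<And>t. subalgebra (F (Suc t)) (F t)"
    and X[measurable]: "\<And>t. t < n \<Longrightarrow> X t \<in> borel_measurable (F (Suc t))"
    and X4: "\<And>t. t < n \<Longrightarrow> integrable M (\<lambda>\<omega>. X t \<omega> ^ 4)"
    and mart: "\<And>t G. t < n \<Longrightarrow> G \<in> borel_measurable (F t) \<Longrightarrow> integrable M (\<lambda>\<omega>. (cmod (G \<omega>))\<^sup>2)
       \<Longrightarrow> expectation (\<lambda>\<omega>. G \<omega> * complex_of_real (X t \<omega>)) = 0"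
    and \<delta>: "0 < \<delta>" "\<delta> \<le> 1"
    and Q: "expectation (\<lambda>\<omega>. \<bar>(\<Sum>t<n. (X t \<omega>)\<^sup>2) - 1\<bar>) \<le> \<delta>\<^sup>2"
    and L: "expectation (\<lambda>\<omega>. \<Sum>t<n. X t \<omega> ^ 4) \<le> \<delta>\<^sup>2"
  shows "cmod (expectation (\<lambda>\<omega>. iexp (\<theta> * (\<Sum>t<n. X t \<omega>))) - complex_of_real (exp (- \<theta>\<^sup>2 / 2)))
    \<le> \<delta> * (2 + 2 * \<bar>\<theta>\<bar>^3 * (3 * exp 2 + 1) + exp (2 * \<theta>\<^sup>2) * (1 + 2 * \<theta>\<^sup>2) + \<theta>\<^sup>2 + 1)"
proof -
  define W where "W t \<omega> = stopped (\<lambda>s. X s \<omega>) t" for t \<omega>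
  define T where "T m \<omega> = (\<Prod>t<m. 1 + \<i> * complex_of_real (\<theta> * W t \<omega>))" for m \<omega>
  \<comment> \<open>A single integrable majorant of \<open>(cmod (T m))^2\<close> for all
    \<open>m \<le> n\<close>.\<close>
  define B where "B \<omega> = exp (2 * \<theta>\<^sup>2) * (1 + \<theta>\<^sup>2 * (1 + (\<Sum>t<n. X t \<omega> ^ 4)))" for \<omega>
  have mono': "subalgebra (F t) (F s)" if "s \<le> t" for s t
    using that
  proof (induction t rule: dec_induct)
    case (step t)
    with mono[of t] show ?case by (auto simp: subalgebra_def)
  qed (simp add: subalgebra_def)
  have XF: "X s \<in> borel_measurable (F t)" if "s < n" "s < t" for s t
    using measurable_from_subalg[OF mono'[of "Suc s" t] X] that by simp
  have XM[measurable]: "t < n \<Longrightarrow> X t \<in> borel_measurable M" for t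
    using measurable_from_subalg[OF sub X] by simp
  have WF: "W s \<in> borel_measurable (F t)" if "s < n" "s < t" for s t
  proof -
    have [measurable]: "X j \<in> borel_measurable (F t)" if "j \<le> s" for j
      using XF[of j t] that \<open>s < n\<close> \<open>s < t\<close> by simp
    show ?thesis unfolding W_def stopped_def by measurable
  qed
  have TF: "T m \<in> borel_measurable (F m)" if "m \<le> n" for m
  proof -
    have [measurable]: "W j \<in> borel_measurable (F m)" if "j < m" for j
      using WF[of j m] that \<open>m \<le> n\<close> by simp
    show ?thesis unfolding T_def by measurable
  qed
  have TM: "T m \<in> borel_measurable M" if "m \<le> n" for m
    using measurable_from_subalg[OF sub TF[OF that]] .
  have WM[measurable]: "t < n \<Longrightarrow> W t \<in> borel_measurable M" for t
    using measurable_from_subalg[OF sub WF[of t "Suc t"]] by simp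
  have normT: "(cmod (T m \<omega>))\<^sup>2 = (\<Prod>t<m. 1 + \<theta>\<^sup>2 * (W t \<omega>)\<^sup>2)" for m \<omega>
    unfolding T_def prod_norm[symmetric] prod_power_distrib
    by (intro prod.cong refl) (simp add: cmod_power2 power_mult_distrib)
  have TB: "(cmod (T m \<omega>))\<^sup>2 \<le> B \<omega>" if "m \<le> n" for m \<omega>
  proof -
    have "(cmod (T m \<omega>))\<^sup>2 \<le> exp (2 * \<theta>\<^sup>2) * (1 + \<theta>\<^sup>2 * (1 + (\<Sum>t<m. X t \<omega> ^ 4)))"
      unfolding normT W_def by (rule prod_stopped_le) simp
    also have "(\<Sum>t<m. X t \<omega> ^ 4) \<le> (\<Sum>t<n. X t \<omega> ^ 4)"
      using that by (intro sum_mono2) auto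
    finally show ?thesis by (simp add: B_def mult_left_mono)
  qed
  have intB: "integrable M B"
    unfolding B_def
    by (intro integrable_mult_right Bochner_Integration.integrable_add Bochner_Integration.integrable_sum X4) auto
  have T2: "integrable M (\<lambda>\<omega>. (cmod (T m \<omega>))\<^sup>2)" if "m \<le> n" for m
    by (rule Bochner_Integration.integrable_bound[OF intB])
       (use TM[OF that] TB[OF that] in \<open>auto intro!: AE_I2 order_trans[OF TB[OF that]]\<close>)
  have sqT: "sq_integrable (\<lambda>\<omega>. cmod (T m \<omega>))" if "m \<le> n" for m
    using T2[OF that] TM[OF that] by (simp add: sq_integrable_def)
  have intT: "integrable M (T m)" if "m \<le> n" for m
    using sq_integrable_integrable[OF sqT[OF that]] TM[OF that] by (simp add: integrable_norm_iff)
  have ET: "expectation (T m) = 1" if "m \<le> n" for m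
    using that
  proof (induction m)
    case 0
    then show ?case by (simp add: T_def prob_space)
  next
    case (Suc m)
    then have m: "m < n" "m \<le> n" by auto
    \<comment> \<open>The stopping indicator is moved from \<open>X m\<close> to \<open>T m\<close>:
      the increment of \<open>T\<close> becomes a factor known at time \<open>m\<close> times the
      unstopped \<open>X m\<close>, to which \<open>mart\<close> applies.\<close>
    define G where "G \<omega> = (if (\<Sum>s<m. (X s \<omega>)\<^sup>2) \<le> 2 then T m \<omega> else 0)" for \<omega>
    have [measurable]: "X j \<in> borel_measurable (F m)" if "j < m" for j
      using XF[of j m] that m by simp
    have [measurable]: "T m \<in> borel_measurable (F m)" by (rule TF[OF m(2)])
    have G: "G \<in> borel_measurable (F m)" unfolding G_def by measurable
    have "integrable M (\<lambda>\<omega>. (cmod (G \<omega>))\<^sup>2)"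
    proof (rule Bochner_Integration.integrable_bound[OF T2[OF m(2)]])
      have [measurable]: "G \<in> borel_measurable M" by (rule measurable_from_subalg[OF sub G])
      show "(\<lambda>\<omega>. (cmod (G \<omega>))\<^sup>2) \<in> borel_measurable M" by measurable
    qed (auto simp: G_def)
    note E0 = mart[OF m(1) G this]
    have eq: "T (Suc m) \<omega> = T m \<omega> + \<i> * \<theta> * (G \<omega> * complex_of_real (X m \<omega>))" for \<omega>
      by (simp add: T_def G_def W_def stopped_def algebra_simps)
    have "integrable M (\<lambda>\<omega>. T (Suc m) \<omega> - T m \<omega>)" using intT Suc.prems by auto
    then have int: "integrable M (\<lambda>\<omega>. \<i> * \<theta> * (G \<omega> * complex_of_real (X m \<omega>)))"
      by (simp add: eq)
    have "expectation (T (Suc m)) = expectation (T m) + expectation (\<lambda>\<omega>. \<i> * \<theta> * (G \<omega> * complex_of_real (X m \<omega>)))"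
      unfolding eq using intT[OF m(2)] int by (rule Bochner_Integration.integral_add)
    then show ?case using Suc.IH[OF m(2)] E0 by simp
  qed
  define V where "V \<omega> = (\<Sum>t<n. (W t \<omega>)\<^sup>2)" for \<omega>
  define q where "q \<omega> = \<bar>(\<Sum>t<n. (X t \<omega>)\<^sup>2) - 1\<bar>" for \<omega>
  define l where "l \<omega> = (\<Sum>t<n. X t \<omega> ^ 4)" for \<omega>
  have meas[measurable]: "V \<in> borel_measurable M" "q \<in> borel_measurable M" "l \<in> borel_measurable M"
     "T n \<in> borel_measurable M"
    unfolding V_def q_def l_def using TM by auto
  have int_l: "integrable M l" unfolding l_def by (auto intro!: X4)
  have X2: "integrable M (\<lambda>\<omega>. (X t \<omega>)\<^sup>2)" if "t < n" for t
  proof -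
    have "sq_integrable (\<lambda>\<omega>. (X t \<omega>)\<^sup>2)"
      using that X4 by (simp add: sq_integrable_def flip: power_mult)
    then show ?thesis by (rule sq_integrable_integrable)
  qed
  have int_q: "integrable M q" unfolding q_def
    using X2 by (intro integrable_abs Bochner_Integration.integrable_diff Bochner_Integration.integrable_sum) auto
  define C1 C2 where "C1 = 2 * \<bar>\<theta>\<bar> ^ 3" and "C2 = exp (2 * \<theta>\<^sup>2)"
  \<comment> \<open>Three replacements: \<open>X\<close> by its stopped version (\<open>a1\<close>),
    the exponentials by the product (\<open>a2\<close>), \<open>V\<close> by 1 (\<open>a3\<close>).
    Weights \<open>\<delta>\<close> and \<open>1 / \<delta>\<close> are distributed so that whatever
    is divided by \<open>\<delta>\<close> has mean of order \<open>\<delta>^2\<close>.\<close>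
  have pw: "cmod (iexp (\<theta> * (\<Sum>t<n. X t \<omega>)) - T n \<omega> * complex_of_real (exp (- \<theta>\<^sup>2 / 2)))
     \<le> 2 * q \<omega> + C1 * (\<delta> * (exp 2 * (2 + l \<omega>)) + l \<omega> / \<delta>)
       + (\<delta> * B \<omega> + (\<theta>\<^sup>2 + 1) * q \<omega> / \<delta>)" (is "?lhs \<le> _") for \<omega>
  proof -
    have far: "1 \<le> q \<omega>" if "\<not> (\<Sum>t<n. (X t \<omega>)\<^sup>2) \<le> 2"
      using that unfolding q_def by linarith
    have near: "W t \<omega> = X t \<omega>" if "(\<Sum>t<n. (X t \<omega>)\<^sup>2) \<le> 2" "t < n" for t
      using stopped_eq[OF that] by (simp add: W_def)
    have a1: "cmod (iexp (\<theta> * (\<Sum>t<n. X t \<omega>)) - iexp (\<theta> * (\<Sum>t<n. W t \<omega>))) \<le> 2 * q \<omega>"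
    proof (cases "(\<Sum>t<n. (X t \<omega>)\<^sup>2) \<le> 2")
      case True
      then have "(\<Sum>t<n. X t \<omega>) = (\<Sum>t<n. W t \<omega>)" by (intro sum.cong) (auto simp: near)
      then show ?thesis by (simp add: q_def)
    next
      case False
      then show ?thesis using far
        by (intro order_trans[OF norm_triangle_ineq4]) simp
    qed
    have prods: "iexp (\<theta> * (\<Sum>t<n. W t \<omega>)) = (\<Prod>t<n. iexp (\<theta> * W t \<omega>))"
      by (simp add: sum_distrib_left exp_sum)
    have prodT: "T n \<omega> * complex_of_real (exp (- \<theta>\<^sup>2 * V \<omega> / 2)) =
        (\<Prod>t<n. (1 + \<i> * complex_of_real (\<theta> * W t \<omega>)) * complex_of_real (exp (- (\<theta> * W t \<omega>)\<^sup>2 / 2)))"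
      unfolding T_def V_def prod.distrib of_real_prod[symmetric] exp_sum[OF finite_lessThan, symmetric]
      by (simp add: sum_distrib_left sum_divide_distrib power_mult_distrib sum_negf)
    have W4: "(\<Sum>t<n. W t \<omega> ^ 4) \<le> l \<omega>"
      unfolding l_def by (intro sum_mono) (auto simp: W_def stopped_def)
    \<comment> \<open>The stopped product with coefficient 1 in place of \<open>\<theta>^2\<close>;
      its bound accounts for the overshoot as well.\<close>
    have V_le: "V \<omega> \<le> exp 2 * (2 + l \<omega>)"
      using one_plus_sum_le_prod[of "\<lambda>t. (W t \<omega>)\<^sup>2" n] prod_stopped_le[of 1 "\<lambda>s. X s \<omega>" n]
      by (simp add: V_def W_def l_def)
    have "cmod (iexp (\<theta> * (\<Sum>t<n. W t \<omega>)) - T n \<omega> * complex_of_real (exp (- \<theta>\<^sup>2 * V \<omega> / 2)))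
       \<le> (\<Sum>t<n. cmod (iexp (\<theta> * W t \<omega>) - (1 + \<i> * complex_of_real (\<theta> * W t \<omega>)) * complex_of_real (exp (- (\<theta> * W t \<omega>)\<^sup>2 / 2))))"
      unfolding prods prodT
      by (intro norm_prod_diff norm_one_plus_i_times_exp_le) simp
    also have "\<dots> \<le> (\<Sum>t<n. 2 * \<bar>\<theta> * W t \<omega>\<bar> ^ 3)"
      by (intro sum_mono iexp_third_order)
    also have "\<dots> = C1 * (\<Sum>t<n. \<bar>W t \<omega>\<bar> ^ 3)"
      by (simp add: C1_def sum_distrib_left abs_mult power_mult_distrib mult.assoc)
    also have "(\<Sum>t<n. \<bar>W t \<omega>\<bar> ^ 3) \<le> (\<Sum>t<n. \<delta> * (W t \<omega>)\<^sup>2 + W t \<omega> ^ 4 / \<delta>)"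
      by (intro sum_mono cube_le_weighted \<delta>)
    also have "\<dots> = \<delta> * V \<omega> + (\<Sum>t<n. W t \<omega> ^ 4) / \<delta>"
      by (simp add: V_def sum.distrib sum_distrib_left sum_divide_distrib)
    also have "\<dots> \<le> \<delta> * (exp 2 * (2 + l \<omega>)) + l \<omega> / \<delta>"
      using \<delta> W4 V_le by (intro add_mono mult_left_mono divide_right_mono) auto
    finally have a2: "cmod (iexp (\<theta> * (\<Sum>t<n. W t \<omega>)) - T n \<omega> * complex_of_real (exp (- \<theta>\<^sup>2 * V \<omega> / 2)))
       \<le> C1 * (\<delta> * (exp 2 * (2 + l \<omega>)) + l \<omega> / \<delta>)" by (simp add: C1_def mult_left_mono)
    define g where "g = \<bar>exp (- \<theta>\<^sup>2 * V \<omega> / 2) - exp (- \<theta>\<^sup>2 / 2)\<bar>"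
    have V0: "V \<omega> \<ge> 0" unfolding V_def by (intro sum_nonneg) auto
    have g1: "g \<le> 1"
    proof -
      have "exp (- \<theta>\<^sup>2 * V \<omega> / 2) \<le> 1" "exp (- \<theta>\<^sup>2 / 2) \<le> 1" using V0 by auto
      moreover have "exp (- \<theta>\<^sup>2 * V \<omega> / 2) > 0" "exp (- \<theta>\<^sup>2 / 2) > 0" by auto
      ultimately show ?thesis unfolding g_def by linarith
    qed
    have g2: "g \<le> (\<theta>\<^sup>2 + 1) * q \<omega>"
    proof (cases "(\<Sum>t<n. (X t \<omega>)\<^sup>2) \<le> 2")
      case True
      then have V: "V \<omega> = (\<Sum>t<n. (X t \<omega>)\<^sup>2)" unfolding V_def by (intro sum.cong) (auto simp: near)
      have lip: "\<bar>exp (- a) - exp (- b)\<bar> \<le> \<bar>a - b\<bar>" if "a \<ge> 0" "b \<ge> 0" for a b :: real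
      proof -
        have *: "exp (- a) - exp (- b) \<le> b - a" if "a \<le> b" "a \<ge> 0" for a b :: real
        proof -
          have "exp (- a) - exp (- b) = exp (- a) * (1 - exp (- (b - a)))"
            by (simp add: algebra_simps flip: exp_add)
          also have "\<dots> \<le> 1 * (b - a)"
          proof (rule mult_mono)
            show "1 - exp (- (b - a)) \<le> b - a"
              using exp_ge_add_one_self[of "- (b - a)"] by linarith
          qed (use that in auto)
          finally show ?thesis by simp
        qed
        show ?thesis
        proof (cases "a \<le> b")
          case True
          then have "exp (- b) \<le> exp (- a)" by simp
          with *[OF True that(1)] show ?thesis by linarith
        next
          case False
          then have "exp (- a) \<le> exp (- b)" by simp
          with *[of b a] False that(2) show ?thesis by linarith
        qed
      qed
      have *: "\<theta>\<^sup>2 * V \<omega> / 2 - \<theta>\<^sup>2 / 2 = \<theta>\<^sup>2 / 2 * (V \<omega> - 1)" by (simp add: field_simps)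
      have "g \<le> \<bar>\<theta>\<^sup>2 * V \<omega> / 2 - \<theta>\<^sup>2 / 2\<bar>"
        unfolding g_def using lip[of "\<theta>\<^sup>2 * V \<omega> / 2" "\<theta>\<^sup>2 / 2"] V0 by simp
      also have "\<dots> = \<bar>\<theta>\<^sup>2 / 2 * (V \<omega> - 1)\<bar>" unfolding * ..
      also have "\<dots> = \<theta>\<^sup>2 / 2 * q \<omega>" by (simp add: q_def V abs_mult)
      also have "\<dots> \<le> (\<theta>\<^sup>2 + 1) * q \<omega>" by (intro mult_right_mono) (auto simp: q_def)
      finally show ?thesis .
    next
      case False
      have "g \<le> 1 * 1" using g1 by simp
      also have "\<dots> \<le> (\<theta>\<^sup>2 + 1) * q \<omega>" using far[OF False] by (intro mult_mono) auto
      finally show ?thesis .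
    qed
    have g0: "g \<ge> 0" by (simp add: g_def)
    \<comment> \<open>As \<open>g \<le> 1\<close>, its square is again bounded linearly in
      \<open>q\<close>, so a first moment of \<open>q\<close> is enough for the term divided by
      \<open>\<delta>\<close>.\<close>
    have gq: "g\<^sup>2 \<le> (\<theta>\<^sup>2 + 1) * q \<omega>"
      using g2 mult_left_mono[OF g1 g0] by (simp add: power2_eq_square)
    have a3: "cmod (T n \<omega> * complex_of_real (exp (- \<theta>\<^sup>2 * V \<omega> / 2)) - T n \<omega> * complex_of_real (exp (- \<theta>\<^sup>2 / 2)))
        \<le> \<delta> * B \<omega> + (\<theta>\<^sup>2 + 1) * q \<omega> / \<delta>"
    proof -
      have "cmod (T n \<omega> * complex_of_real (exp (- \<theta>\<^sup>2 * V \<omega> / 2)) - T n \<omega> * complex_of_real (exp (- \<theta>\<^sup>2 / 2)))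
         = cmod (T n \<omega>) * g"
        unfolding g_def right_diff_distrib[symmetric] of_real_diff[symmetric] norm_mult norm_of_real ..
      also have "\<dots> \<le> \<delta> * (cmod (T n \<omega>))\<^sup>2 + g\<^sup>2 / \<delta>"
      proof -
        have "2 * (cmod (T n \<omega>) * g * \<delta>) \<le> \<delta>\<^sup>2 * (cmod (T n \<omega>))\<^sup>2 + g\<^sup>2"
          using sum_squares_bound[of "\<delta> * cmod (T n \<omega>)" g] by (simp add: power_mult_distrib algebra_simps)
        moreover have "0 \<le> cmod (T n \<omega>) * g * \<delta>" using g0 \<delta> by simp
        ultimately have "cmod (T n \<omega>) * g * \<delta> \<le> \<delta>\<^sup>2 * (cmod (T n \<omega>))\<^sup>2 + g\<^sup>2" by linarith
        then show ?thesis using \<delta> by (simp add: field_simps power2_eq_square)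
      qed
      also have "\<dots> \<le> \<delta> * B \<omega> + (\<theta>\<^sup>2 + 1) * q \<omega> / \<delta>"
        using \<delta> gq TB[of n \<omega>] by (intro add_mono mult_left_mono divide_right_mono) auto
      finally show ?thesis .
    qed
    have "?lhs \<le> cmod (iexp (\<theta> * (\<Sum>t<n. X t \<omega>)) - iexp (\<theta> * (\<Sum>t<n. W t \<omega>)))
       + cmod (iexp (\<theta> * (\<Sum>t<n. W t \<omega>)) - T n \<omega> * complex_of_real (exp (- \<theta>\<^sup>2 * V \<omega> / 2)))
       + cmod (T n \<omega> * complex_of_real (exp (- \<theta>\<^sup>2 * V \<omega> / 2)) - T n \<omega> * complex_of_real (exp (- \<theta>\<^sup>2 / 2)))"
    proof -
      have "cmod (a - d) \<le> cmod (a - b) + cmod (b - c) + cmod (c - d)" for a b c d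
        using norm_triangle_ineq[of "a - b" "b - c"] norm_triangle_ineq[of "a - c" "c - d"] by simp
      then show ?thesis .
    qed
    then show ?thesis using a1 a2 a3 by linarith
  qed
  let ?rhs = "\<lambda>\<omega>. 2 * q \<omega> + C1 * (\<delta> * (exp 2 * (2 + l \<omega>)) + l \<omega> / \<delta>)
       + (\<delta> * B \<omega> + (\<theta>\<^sup>2 + 1) * q \<omega> / \<delta>)"
  have int_iexp: "integrable M (\<lambda>\<omega>. iexp (\<theta> * (\<Sum>t<n. X t \<omega>)))"
    by (rule integrable_const_bound[where B=1]) auto
  have int_Tn: "integrable M (\<lambda>\<omega>. T n \<omega> * complex_of_real (exp (- \<theta>\<^sup>2 / 2)))"
    using intT[of n] by simp
  have int_rhs: "integrable M ?rhs" using int_q int_l intB by simp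
  have "cmod (expectation (\<lambda>\<omega>. iexp (\<theta> * (\<Sum>t<n. X t \<omega>))) - complex_of_real (exp (- \<theta>\<^sup>2 / 2)))
     = cmod (expectation (\<lambda>\<omega>. iexp (\<theta> * (\<Sum>t<n. X t \<omega>)) - T n \<omega> * complex_of_real (exp (- \<theta>\<^sup>2 / 2))))"
    using int_iexp int_Tn ET[of n] by simp
  also have "\<dots> \<le> expectation (\<lambda>\<omega>. cmod (iexp (\<theta> * (\<Sum>t<n. X t \<omega>)) - T n \<omega> * complex_of_real (exp (- \<theta>\<^sup>2 / 2))))"
    by (rule integral_norm_bound)
  also have "\<dots> \<le> expectation ?rhs"
    by (rule integral_mono) (use int_iexp int_Tn int_rhs pw in auto)
  also have "\<dots> = 2 * expectation q + C1 * (\<delta> * (exp 2 * (2 + expectation l)) + expectation l / \<delta>)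
       + (\<delta> * expectation B + (\<theta>\<^sup>2 + 1) * expectation q / \<delta>)"
    using int_q int_l intB by (simp add: prob_space)
  also have "expectation B = C2 * (1 + \<theta>\<^sup>2 * (1 + expectation l))"
    using int_l unfolding B_def C2_def l_def[symmetric] by (simp add: prob_space)
  also have "2 * expectation q + C1 * (\<delta> * (exp 2 * (2 + expectation l)) + expectation l / \<delta>)
       + (\<delta> * (C2 * (1 + \<theta>\<^sup>2 * (1 + expectation l))) + (\<theta>\<^sup>2 + 1) * expectation q / \<delta>)
     \<le> 2 * \<delta> + C1 * (\<delta> * (exp 2 * 3) + \<delta>) + (\<delta> * (C2 * (1 + \<theta>\<^sup>2 * 2)) + (\<theta>\<^sup>2 + 1) * \<delta>)"
  proof -
    have d2: "\<delta>\<^sup>2 \<le> \<delta>" using \<delta> by (simp add: power2_eq_square mult_left_le)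
    have q1: "expectation q \<le> \<delta>" "expectation l \<le> 1" using Q L d2 \<delta> unfolding q_def l_def by auto
    have q2: "expectation l / \<delta> \<le> \<delta>" "expectation q / \<delta> \<le> \<delta>"
      using Q L \<delta> unfolding q_def l_def by (auto simp: field_simps power2_eq_square)
    have C: "C1 \<ge> 0" "C2 \<ge> 0" by (auto simp: C1_def C2_def)
    have "(\<theta>\<^sup>2 + 1) * expectation q / \<delta> \<le> (\<theta>\<^sup>2 + 1) * \<delta>"
      using mult_left_mono[OF q2(2), of "\<theta>\<^sup>2 + 1"] by simp
    then show ?thesis
      using C q1 q2 \<delta> by (intro add_mono mult_left_mono) auto
  qed
  also have "\<dots> = \<delta> * (2 + 2 * \<bar>\<theta>\<bar>^3 * (3 * exp 2 + 1) + exp (2 * \<theta>\<^sup>2) * (1 + 2 * \<theta>\<^sup>2) + \<theta>\<^sup>2 + 1)"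
    by (simp add: C1_def C2_def algebra_simps)
  finally show ?thesis .
qed

end

section \<open>Normal limits and conditional coverage\<close>

lemma std_normal_measure_singleton: "measure std_normal_distribution {x} = 0"
proof -
  have "emeasure std_normal_distribution {x} = 0"
    by (subst emeasure_density) (auto intro!: nn_integral_null_set countable_imp_null_set_lborel)
  then show ?thesis by (simp add: measure_def)
qed

lemma std_normal_isCont_cdf: "isCont (cdf std_normal_distribution) x"
proof -
  interpret real_distribution std_normal_distribution by (rule real_dist_normal_dist)
  show ?thesis by (simp add: isCont_cdf std_normal_measure_singleton)
qed

text \<open>The density is positive everywhere, so an interval that is null for the normal law would
  be Lebesgue null. This yields uniqueness of quantiles.\<close>

lemma std_normal_cdf_strict_mono:
  assumes "x < y"
  shows "cdf std_normal_distribution x < cdf std_normal_distribution y"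
proof -
  interpret real_distribution std_normal_distribution by (rule real_dist_normal_dist)
  have "measure std_normal_distribution {x<..y} \<noteq> 0"
  proof
    assume "measure std_normal_distribution {x<..y} = 0"
    then have "emeasure std_normal_distribution {x<..y} = 0" by (simp add: emeasure_eq_measure)
    then have "(\<integral>\<^sup>+t. ennreal (std_normal_density t) * indicator {x<..y} t \<partial>lborel) = 0"
      by (subst (asm) emeasure_density) auto
    then have "AE t in lborel. ennreal (std_normal_density t) * indicator {x<..y} t = 0"
      by (subst (asm) nn_integral_0_iff_AE) auto
    then have "AE t in lborel. t \<notin> {x<..y}"
    proof eventually_elim
      case (elim t)
      then show ?case
        using normal_density_pos[of 1 0 t] by (auto simp: indicator_def ennreal_eq_0_iff split: if_splits)
    qed
    then have "{x<..y} \<in> null_sets lborel" by (subst AE_iff_null_sets) auto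
    then show False using assms by (auto simp: null_sets_def)
  qed
  then show ?thesis using cdf_diff_eq[OF assms] measure_nonneg[of std_normal_distribution "{x<..y}"] by linarith
qed

lemma std_normal_cdf_symmetric: "cdf std_normal_distribution (- x) = 1 - cdf std_normal_distribution x"
proof -
  interpret real_distribution std_normal_distribution by (rule real_dist_normal_dist)
  have "emeasure std_normal_distribution {..- x} = (\<integral>\<^sup>+t. ennreal (std_normal_density t) * indicator {..- x} t \<partial>lborel)"
    by (subst emeasure_density) auto
  also have "\<dots> = (\<integral>\<^sup>+t. ennreal (std_normal_density (- t)) * indicator {..- x} (- t) \<partial>lborel)"
    by (subst nn_integral_real_affine[where c="-1" and t=0]) auto
  also have "\<dots> = (\<integral>\<^sup>+t. ennreal (std_normal_density t) * indicator {x..} t \<partial>lborel)"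
    by (intro nn_integral_cong) (auto simp: normal_density_def indicator_def)
  also have "\<dots> = emeasure std_normal_distribution {x..}"
    by (subst emeasure_density) auto
  finally have "cdf std_normal_distribution (- x) = measure std_normal_distribution {x..}"
    by (simp add: cdf_def measure_def)
  also have "\<dots> = measure std_normal_distribution ({x<..} \<union> {x})"
    by (intro arg_cong[where f="measure _"]) auto
  also have "\<dots> = measure std_normal_distribution {x<..}"
    by (rule measure_zero_union) (auto simp: std_normal_measure_singleton)
  also have "{x<..} = space std_normal_distribution - {..x}" by auto
  also have "measure std_normal_distribution \<dots> = 1 - cdf std_normal_distribution x"
    unfolding cdf_def by (rule prob_compl) auto
  finally show ?thesis .
qed

text \<open>Continuity and the limits 0 and 1 give a solution by the intermediate value theorem, and
  strict monotonicity makes it unique, so the definite description denotes it.\<close>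

lemma std_normal_quantile_cdf:
  assumes "0 < p" "p < 1"
  shows "cdf std_normal_distribution (std_normal_quantile p) = p"
proof -
  interpret real_distribution std_normal_distribution by (rule real_dist_normal_dist)
  obtain a where a: "cdf std_normal_distribution a < p"
    using order_tendstoD(2)[OF cdf_lim_at_bot assms(1)] by (auto simp: eventually_at_bot_linorder)
  obtain b where b: "cdf std_normal_distribution b > p"
    using order_tendstoD(1)[OF cdf_lim_at_top_prob assms(2)] by (auto simp: eventually_at_top_linorder)
  have "a \<le> b"
    using a b cdf_nondecreasing[of b a] by (cases "a \<le> b") auto
  then obtain x where x: "cdf std_normal_distribution x = p"
    using IVT[of "cdf std_normal_distribution" a p b] a b std_normal_isCont_cdf by (auto intro: less_imp_le)
  have "\<exists>!z. cdf std_normal_distribution z = p"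
    using x std_normal_cdf_strict_mono by (metis linorder_neqE_linordered_idom less_irrefl)
  then show ?thesis
    unfolding std_normal_quantile_def by (rule theI')
qed

lemma std_normal_quantile_pos:
  assumes "1 / 2 < p" "p < 1"
  shows "0 < std_normal_quantile p"
proof (rule ccontr)
  assume "\<not> 0 < std_normal_quantile p"
  then have "cdf std_normal_distribution (std_normal_quantile p) \<le> cdf std_normal_distribution 0"
    using std_normal_cdf_strict_mono[of "std_normal_quantile p" 0] by (cases "std_normal_quantile p = 0") auto
  moreover have "cdf std_normal_distribution 0 = 1 / 2"
    using std_normal_cdf_symmetric[of 0] by simp
  ultimately show False using std_normal_quantile_cdf[of p] assms by simp
qed

text \<open>Levy's continuity theorem for the image laws, followed by convergence on the continuity
  set \<open>{- x..x}\<close>, whose two boundary points have normal measure 0.\<close>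

lemma char_conv_imp_abs_le_conv:
  fixes M :: "nat \<Rightarrow> 'a measure" and W :: "nat \<Rightarrow> 'a \<Rightarrow> real"
  assumes prob: "\<And>n. prob_space (M n)"
    and W: "\<forall>\<^sub>F n in sequentially. W n \<in> borel_measurable (M n)"
    and conv: "\<And>\<theta>. (\<lambda>n. \<integral>\<omega>. iexp (\<theta> * W n \<omega>) \<partial>M n) \<longlonglongrightarrow> complex_of_real (exp (- \<theta>\<^sup>2 / 2))"
    and x: "0 < x"
  shows "(\<lambda>n. measure (M n) {\<omega> \<in> space (M n). \<bar>W n \<omega>\<bar> \<le> x}) \<longlonglongrightarrow> 2 * cdf std_normal_distribution x - 1"
proof -
  interpret N: real_distribution std_normal_distribution by (rule real_dist_normal_dist)
  \<comment> \<open>\<open>W n\<close> is measurable only eventually, whereas the continuity theorem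
    asks for a distribution at every index; the other rows are filled with the normal law.\<close>
  define \<mu> where "\<mu> n = (if W n \<in> borel_measurable (M n) then distr (M n) borel (W n) else std_normal_distribution)" for n
  have real: "real_distribution (\<mu> n)" for n
    using prob_space.real_distribution_distr[OF prob] by (auto simp: \<mu>_def real_dist_normal_dist)
  have "(\<lambda>n. char (\<mu> n) \<theta>) \<longlonglongrightarrow> char std_normal_distribution \<theta>" for \<theta>
  proof -
    have "\<forall>\<^sub>F n in sequentially. (\<integral>\<omega>. iexp (\<theta> * W n \<omega>) \<partial>M n) = char (\<mu> n) \<theta>"
      using W by eventually_elim (simp add: \<mu>_def char_def integral_distr)
    then show ?thesis
      using conv[of \<theta>] by (simp add: char_std_normal_distribution tendsto_cong)
  qed
  then have weak: "weak_conv_m \<mu> std_normal_distribution"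
    by (intro levy_continuity real real_dist_normal_dist)
  have "frontier {- x..x} = {- x, x}"
    using x by (simp add: frontier_cbox[where 'a=real, unfolded cbox_interval] box_real set_eq_iff)
  moreover have "emeasure std_normal_distribution {- x, x} = 0"
  proof -
    have "measure std_normal_distribution {- x, x} \<le> measure std_normal_distribution {- x} + measure std_normal_distribution {x}"
      using measure_Un_le[of "{- x}" std_normal_distribution "{x}"] by (simp add: insert_commute)
    then have "measure std_normal_distribution {- x, x} = 0"
      using std_normal_measure_singleton measure_nonneg[of std_normal_distribution "{- x, x}"] by simp
    then show ?thesis by (simp add: N.emeasure_eq_measure)
  qed
  ultimately have "(\<lambda>n. measure (\<mu> n) {- x..x}) \<longlonglongrightarrow> measure std_normal_distribution {- x..x}"
    by (intro weak_conv_imp_continuity_set_conv[OF real real_dist_normal_dist weak]) (auto simp: N.emeasure_eq_measure)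
  also have "measure std_normal_distribution {- x..x} = 2 * cdf std_normal_distribution x - 1"
  proof -
    have "measure std_normal_distribution {- x..x} = measure std_normal_distribution ({- x<..x} \<union> {- x})"
      using x by (intro arg_cong[where f="measure _"]) auto
    also have "\<dots> = measure std_normal_distribution {- x<..x}"
      by (rule N.measure_zero_union) (auto simp: std_normal_measure_singleton)
    also have "\<dots> = cdf std_normal_distribution x - cdf std_normal_distribution (- x)"
      using N.cdf_diff_eq[of "- x" x] x by simp
    finally show ?thesis by (simp add: std_normal_cdf_symmetric)
  qed
  finally have "(\<lambda>n. measure (\<mu> n) {- x..x}) \<longlonglongrightarrow> 2 * cdf std_normal_distribution x - 1" .
  moreover have "\<forall>\<^sub>F n in sequentially. measure (\<mu> n) {- x..x} = measure (M n) {\<omega> \<in> space (M n). \<bar>W n \<omega>\<bar> \<le> x}"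
    using W
  proof eventually_elim
    case (elim n)
    have "W n -` {- x..x} \<inter> space (M n) = {\<omega> \<in> space (M n). \<bar>W n \<omega>\<bar> \<le> x}" by auto
    then show ?case using elim by (simp add: \<mu>_def measure_distr)
  qed
  ultimately show ?thesis by (rule Lim_transform_eventually)
qed

text \<open>Off the good events \<open>G n\<close>, whose probability tends to 1, nothing is assumed; on them
  coverage is squeezed between two events concerning the normalised statistic.\<close>

lemma conditional_coverage_limit:
  fixes M :: "nat \<Rightarrow> 'a measure" and W :: "nat \<Rightarrow> 'a \<Rightarrow> real" and A B :: "nat \<Rightarrow> 'a \<Rightarrow> bool"
  assumes prob: "\<And>n. prob_space (M n)"
    and W: "\<forall>\<^sub>F n in sequentially. W n \<in> borel_measurable (M n)"
    and A: "\<forall>\<^sub>F n in sequentially. {\<omega> \<in> space (M n). A n \<omega>} \<in> sets (M n)"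
    and B: "\<forall>\<^sub>F n in sequentially. {\<omega> \<in> space (M n). B n \<omega>} \<in> sets (M n)"
    and conv: "\<And>x. 0 < x \<Longrightarrow> (\<lambda>n. measure (M n) {\<omega> \<in> space (M n). \<bar>W n \<omega>\<bar> \<le> x}) \<longlonglongrightarrow> F x"
    and z: "0 < z" and cont: "isCont F z"
    and good: "\<And>e::real. 0 < e \<Longrightarrow> e < 1 \<Longrightarrow> \<exists>G. (\<forall>\<^sub>F n in sequentially. G n \<in> sets (M n)) \<and> (\<lambda>n. measure (M n) (G n)) \<longlonglongrightarrow> 1 \<and>
       (\<forall>\<^sub>F n in sequentially. \<forall>\<omega>\<in>G n. B n \<omega> \<and> (\<bar>W n \<omega>\<bar> \<le> z * (1 - e) \<longrightarrow> A n \<omega>) \<and> (A n \<omega> \<longrightarrow> \<bar>W n \<omega>\<bar> \<le> z * (1 + e)))"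
  shows "(\<lambda>n. \<P>(\<omega> in M n. A n \<omega> \<bar> B n \<omega>)) \<longlonglongrightarrow> F z"
proof -
  let ?P = "\<lambda>n Q. measure (M n) {\<omega> \<in> space (M n). Q n \<omega>}"
  have lim_B: "(\<lambda>n. ?P n B) \<longlonglongrightarrow> 1"
  proof -
    obtain G where G: "\<forall>\<^sub>F n in sequentially. G n \<in> sets (M n)" "(\<lambda>n. measure (M n) (G n)) \<longlonglongrightarrow> 1"
      "\<forall>\<^sub>F n in sequentially. \<forall>\<omega>\<in>G n. B n \<omega> \<and> (\<bar>W n \<omega>\<bar> \<le> z * (1 - 1/2) \<longrightarrow> A n \<omega>) \<and> (A n \<omega> \<longrightarrow> \<bar>W n \<omega>\<bar> \<le> z * (1 + 1/2))"
      using good[of "1/2"] by auto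
    show ?thesis
    proof (rule tendsto_sandwich[OF _ _ G(2) tendsto_const])
      show "\<forall>\<^sub>F n in sequentially. measure (M n) (G n) \<le> ?P n B"
        using G(1,3) B
      proof eventually_elim
        case (elim n)
        interpret prob_space "M n" by (rule prob)
        show ?case using elim sets.sets_into_space[of "G n" "M n"] by (intro finite_measure_mono) auto
      qed
      show "\<forall>\<^sub>F n in sequentially. ?P n B \<le> 1"
        using prob_space.prob_le_1[OF prob] by auto
    qed
  qed
  have lim_AB: "(\<lambda>n. ?P n (\<lambda>n \<omega>. A n \<omega> \<and> B n \<omega>)) \<longlonglongrightarrow> F z"
  proof (rule tendstoI)
    fix r :: real assume r: "r > 0"
    have "((\<lambda>x. F x) \<longlongrightarrow> F z) (nhds z)" using cont by (simp add: isCont_def tendsto_nhds_iff)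
    then have "\<forall>\<^sub>F x in nhds z. dist (F x) (F z) < r / 3" using r by (intro tendstoD) auto
    then obtain d where d: "d > 0" "\<And>x. dist x z < d \<Longrightarrow> dist (F x) (F z) < r / 3"
      by (auto simp: eventually_nhds_metric)
    \<comment> \<open>Small enough that \<open>z * (1 - e)\<close> and \<open>z * (1 + e)\<close>
      stay within \<open>d\<close> of \<open>z\<close>, and below 1 so that both are positive. The
      error \<open>r\<close> is shared in thirds between continuity of \<open>F\<close>, convergence
      at these two points, and the complement of \<open>G n\<close>.\<close>
    define e where "e = min (1 / 2) (d / (2 * z))"
    have e: "0 < e" "e < 1" using d z by (auto simp: e_def)
    have "z * e \<le> z * (d / (2 * z))" using z by (intro mult_left_mono) (auto simp: e_def)
    then have ze: "z * e < d" using d z by simp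
    have near: "dist (F (z * (1 - e))) (F z) < r / 3" "dist (F (z * (1 + e))) (F z) < r / 3"
    proof -
      have "z * (1 - e) - z = - (z * e)" "z * (1 + e) - z = z * e" by (auto simp: algebra_simps)
      moreover have "\<bar>z * e\<bar> < d" using ze z e by simp
      ultimately have "dist (z * (1 - e)) z < d" "dist (z * (1 + e)) z < d"
        by (auto simp only: dist_real_def abs_minus_cancel)
      then show "dist (F (z * (1 - e))) (F z) < r / 3" "dist (F (z * (1 + e))) (F z) < r / 3"
        by - (rule d(2); assumption)+
    qed
    obtain G where G: "\<forall>\<^sub>F n in sequentially. G n \<in> sets (M n)" "(\<lambda>n. measure (M n) (G n)) \<longlonglongrightarrow> 1"
      "\<forall>\<^sub>F n in sequentially. \<forall>\<omega>\<in>G n. B n \<omega> \<and> (\<bar>W n \<omega>\<bar> \<le> z * (1 - e) \<longrightarrow> A n \<omega>) \<and> (A n \<omega> \<longrightarrow> \<bar>W n \<omega>\<bar> \<le> z * (1 + e))"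
      using good[OF e] by auto
    have pos: "0 < z * (1 - e)" "0 < z * (1 + e)" using z e by auto
    have ev1: "\<forall>\<^sub>F n in sequentially. dist (?P n (\<lambda>n \<omega>. \<bar>W n \<omega>\<bar> \<le> z * (1 - e))) (F (z * (1 - e))) < r / 3"
      using r by (intro tendstoD[OF conv[OF pos(1)]]) auto
    have ev2: "\<forall>\<^sub>F n in sequentially. dist (?P n (\<lambda>n \<omega>. \<bar>W n \<omega>\<bar> \<le> z * (1 + e))) (F (z * (1 + e))) < r / 3"
      using r by (intro tendstoD[OF conv[OF pos(2)]]) auto
    have ev3: "\<forall>\<^sub>F n in sequentially. dist (measure (M n) (G n)) 1 < r / 3"
      using r by (intro tendstoD[OF G(2)]) auto
    show "\<forall>\<^sub>F n in sequentially. dist (?P n (\<lambda>n \<omega>. A n \<omega> \<and> B n \<omega>)) (F z) < r"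
      using ev1 ev2 ev3 G(1,3) W A B
    proof eventually_elim
      case (elim n)
      interpret prob_space "M n" by (rule prob)
      note [measurable] = elim(6) elim(4)
      let ?c = "space (M n) - G n" and ?AB = "{\<omega> \<in> space (M n). A n \<omega> \<and> B n \<omega>}"
      let ?lo = "{\<omega> \<in> space (M n). \<bar>W n \<omega>\<bar> \<le> z * (1 - e)}" and ?hi = "{\<omega> \<in> space (M n). \<bar>W n \<omega>\<bar> \<le> z * (1 + e)}"
      have AB: "?AB \<in> sets (M n)"
      proof -
        have "?AB = {\<omega> \<in> space (M n). A n \<omega>} \<inter> {\<omega> \<in> space (M n). B n \<omega>}" by auto
        then show ?thesis using elim(7,8) by simp
      qed
      have c: "measure (M n) ?c = 1 - measure (M n) (G n)" by (rule prob_compl[OF elim(4)])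
      have c_le: "measure (M n) ?c < r / 3" using elim(3) c by (simp add: dist_real_def abs_if split: if_splits)
      have sets: "?lo \<in> sets (M n)" "?hi \<in> sets (M n)" "?c \<in> sets (M n)" by measurable
      have "measure (M n) ?lo \<le> measure (M n) (?AB \<union> ?c)"
        using elim(5) sets AB by (intro finite_measure_mono) auto
      also have "\<dots> \<le> measure (M n) ?AB + measure (M n) ?c"
        using sets AB by (intro measure_Un_le) auto
      finally have lo: "measure (M n) ?lo \<le> measure (M n) ?AB + measure (M n) ?c" .
      have "measure (M n) ?AB \<le> measure (M n) (?hi \<union> ?c)"
        using elim(5) sets AB by (intro finite_measure_mono) auto
      also have "\<dots> \<le> measure (M n) ?hi + measure (M n) ?c"
        using sets by (intro measure_Un_le) auto
      finally have hi: "measure (M n) ?AB \<le> measure (M n) ?hi + measure (M n) ?c" .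
      show ?case
        using lo hi c_le elim(1,2) near unfolding dist_real_def by linarith
    qed
  qed
  have "(\<lambda>n. ?P n (\<lambda>n \<omega>. A n \<omega> \<and> B n \<omega>) / ?P n B) \<longlonglongrightarrow> F z / 1"
    by (intro tendsto_divide lim_AB lim_B) simp
  then show ?thesis by (simp add: cond_prob_def)
qed

section \<open>Deterministic comparison of the intervals with the normalised error\<close>

lemma abs_ln_one_minus:
  fixes \<delta> :: real
  assumes "\<bar>\<delta>\<bar> \<le> h" "h \<le> 1 / 2"
  shows "\<exists>m. 1 - 2 * h \<le> m \<and> m \<le> 1 + 2 * h \<and> \<bar>ln (1 - \<delta>)\<bar> = m * \<bar>\<delta>\<bar>"
proof (cases "\<delta> = 0")
  case True
  then show ?thesis using assms by (intro exI[of _ 1]) auto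
next
  case False
  have "\<bar>ln (1 + (- \<delta>)) - (- \<delta>)\<bar> \<le> 2 * (- \<delta>)\<^sup>2"
    using assms by (intro abs_ln_one_plus_x_minus_x_bound) auto
  also have "2 * (- \<delta>)\<^sup>2 = 2 * \<bar>\<delta>\<bar> * \<bar>\<delta>\<bar>" by (simp add: power2_eq_square)
  also have "\<dots> \<le> 2 * h * \<bar>\<delta>\<bar>" using assms by (intro mult_right_mono) auto
  finally have b: "\<bar>ln (1 - \<delta>) + \<delta>\<bar> \<le> 2 * h * \<bar>\<delta>\<bar>" by simp
  have "\<bar>ln (1 - \<delta>)\<bar> \<le> (1 + 2 * h) * \<bar>\<delta>\<bar>" "(1 - 2 * h) * \<bar>\<delta>\<bar> \<le> \<bar>ln (1 - \<delta>)\<bar>"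
    using b by (auto simp: algebra_simps)
  \<comment> \<open>The witness is the ratio itself; the case \<open>\<delta> = 0\<close>, where the
    ratio is 0/0, was served by 1.\<close>
  then show ?thesis using False
    by (intro exI[of _ "\<bar>ln (1 - \<delta>)\<bar> / \<bar>\<delta>\<bar>"]) (auto simp: pos_le_divide_eq pos_divide_le_eq)
qed

text \<open>These are the factors that multiply \<open>z\<close> once the two coverage conditions
  are solved for \<open>|W|\<close>: the first for the interval about the estimate of
  \<open>\<rho>\<close>, the second for the one about the estimate of \<open>\<gamma>\<close>. All
  ingredients are within \<open>h\<close> of 1, or \<open>2 * h\<close> in the case of
  \<open>m\<close>. The constant 16 is generous, and \<open>h \<le> 1 / 16\<close> lets squares of
  \<open>h\<close> be absorbed.\<close>

lemma ratio_bounds: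
  fixes h :: real
  assumes h: "0 < h" "h \<le> 1 / 16" and E: "\<bar>E - 1\<bar> \<le> h" and \<delta>: "\<bar>\<delta>\<bar> \<le> h" and w: "\<bar>w - 1\<bar> \<le> h"
    and m: "1 - 2 * h \<le> m" "m \<le> 1 + 2 * h"
  shows "E * sqrt ((1 - \<delta>) / w) \<le> 1 + 16 * h" "1 - 16 * h \<le> E * sqrt ((1 - \<delta>) / w)"
    "E / (m * sqrt (w * (1 - \<delta>))) \<le> 1 + 16 * h" "1 - 16 * h \<le> E / (m * sqrt (w * (1 - \<delta>)))"
proof -
  have b: "1 - h \<le> 1 - \<delta>" "1 - \<delta> \<le> 1 + h" "1 - h \<le> w" "w \<le> 1 + h" "1 - h \<le> E" "E \<le> 1 + h" "0 < 1 - h"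
    using \<delta> w E h by auto
  have hh: "h * h \<le> h * (1 / 16)" using h by (intro mult_left_mono) auto
  have hhh: "0 \<le> h * h" by simp
  have q: "1 \<le> (1 + h) / (1 - h)" using h by simp
  \<comment> \<open>Roots are eliminated here and in \<open>s_lo\<close>: a ratio at least 1 is
    below its square, a ratio at most 1 above it.\<close>
  have s_up: "sqrt ((1 - \<delta>) / w) \<le> (1 + h) / (1 - h)"
  proof -
    have "(1 - \<delta>) / w \<le> (1 + h) / (1 - h)" using b by (intro frac_le) auto
    also have "\<dots> \<le> ((1 + h) / (1 - h))\<^sup>2" using mult_left_mono[OF q, of "(1 + h) / (1 - h)"] q
      by (simp add: power2_eq_square)
    finally show ?thesis using q by (intro real_le_lsqrt) auto
  qed
  have s_lo: "(1 - h) / (1 + h) \<le> sqrt ((1 - \<delta>) / w)"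
  proof (rule real_le_rsqrt)
    have "((1 - h) / (1 + h))\<^sup>2 \<le> (1 - h) / (1 + h)"
      unfolding power2_eq_square using h by (intro mult_left_le) auto
    also have "\<dots> \<le> (1 - \<delta>) / w" using b by (intro frac_le) auto
    finally show "((1 - h) / (1 + h))\<^sup>2 \<le> (1 - \<delta>) / w" .
  qed
  have "E * sqrt ((1 - \<delta>) / w) \<le> (1 + h) * ((1 + h) / (1 - h))"
    using b s_up by (intro mult_mono) auto
  also have "\<dots> \<le> 1 + 16 * h" using h hh by (simp add: pos_divide_le_eq algebra_simps)
  finally show "E * sqrt ((1 - \<delta>) / w) \<le> 1 + 16 * h" .
  have "1 - 16 * h \<le> (1 - h) * ((1 - h) / (1 + h))"
  proof -
    have "(1 - h) * (1 - h) - (1 - 16 * h) * (1 + h) = 13 * h + 17 * (h * h)" by (simp add: algebra_simps)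
    then have "(1 - 16 * h) * (1 + h) \<le> (1 - h) * (1 - h)" using h hhh by linarith
    then show ?thesis unfolding times_divide_eq_right by (subst pos_le_divide_eq) (use h in auto)
  qed
  also have "\<dots> \<le> E * sqrt ((1 - \<delta>) / w)" using b s_lo h by (intro mult_mono) auto
  finally show "1 - 16 * h \<le> E * sqrt ((1 - \<delta>) / w)" .
  have r_lo: "1 - h \<le> sqrt (w * (1 - \<delta>))"
    using b by (intro real_le_rsqrt) (auto simp: power2_eq_square intro!: mult_mono)
  have r_up: "sqrt (w * (1 - \<delta>)) \<le> 1 + h"
    using b h by (intro real_le_lsqrt) (auto simp: power2_eq_square intro!: mult_mono)
  have d_lo: "(1 - 2 * h) * (1 - h) \<le> m * sqrt (w * (1 - \<delta>))"
    using m r_lo h b by (intro mult_mono) auto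
  have d_up: "m * sqrt (w * (1 - \<delta>)) \<le> (1 + 2 * h) * (1 + h)"
    using m r_up h b by (intro mult_mono) auto
  have dpos: "0 < (1 - 2 * h) * (1 - h)" using h by simp
  have "E / (m * sqrt (w * (1 - \<delta>))) \<le> (1 + h) / ((1 - 2 * h) * (1 - h))"
    using b d_lo dpos by (intro frac_le) auto
  also have "\<dots> \<le> 1 + 16 * h"
  proof -
    have "(1 + 16 * h) * ((1 - 2 * h) * (1 - h)) - (1 + h) = 12 * h - 46 * (h * h) + 32 * (h * (h * h))"
      by (simp add: algebra_simps)
    moreover have "h * (h * h) \<ge> 0" using h by simp
    ultimately have "1 + h \<le> (1 + 16 * h) * ((1 - 2 * h) * (1 - h))" using h hh by linarith
    then show ?thesis using dpos by (simp add: pos_divide_le_eq)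
  qed
  finally show "E / (m * sqrt (w * (1 - \<delta>))) \<le> 1 + 16 * h" .
  have "1 - 16 * h \<le> (1 - h) / ((1 + 2 * h) * (1 + h))"
  proof -
    have "h * (h * h) \<ge> 0" using h by simp
    then have "(1 - 16 * h) * ((1 + 2 * h) * (1 + h)) \<le> 1 - h" using h hh hhh by (simp add: algebra_simps)
    then show ?thesis using h by (simp add: pos_le_divide_eq)
  qed
  also have "\<dots> \<le> E / (m * sqrt (w * (1 - \<delta>)))"
  proof (rule frac_le)
    show "0 < m * sqrt (w * (1 - \<delta>))" using d_lo dpos by linarith
  qed (use b d_up in auto)
  finally show "1 - 16 * h \<le> E / (m * sqrt (w * (1 - \<delta>)))" .
qed

text \<open>Here \<open>W\<close> is the normalised statistic, \<open>E\<close> the normalised denominator and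
  \<open>\<delta>\<close> the relative error of \<open>1 - \<rho>'\<close>, where \<open>\<rho>'\<close> is the estimate.\<close>

lemma interval_sandwich:
  fixes n k c T D N z h :: real
  defines "\<rho> \<equiv> 1 - c / k"
  defines "w \<equiv> 1 - c / (2 * k)" and "E \<equiv> (1 - \<rho>\<^sup>2) * D / (n * T)" and "\<rho>' \<equiv> \<rho> + N / D"
    and "W \<equiv> N / sqrt (n * T\<^sup>2 / (1 - \<rho>\<^sup>2))"
  defines "\<delta> \<equiv> N / D * (k / c)" and "g \<equiv> - (ln \<bar>\<rho>' - 1\<bar> / ln n)"
  assumes n: "n \<ge> 2" and k: "k > 0" and c: "c > 0" and T: "T > 0" and D: "D > 0" and z: "z > 0"
    and h: "0 < h" "h \<le> 1 / 16" and E: "\<bar>E - 1\<bar> \<le> h" and \<delta>: "\<bar>\<delta>\<bar> \<le> h" and w: "\<bar>w - 1\<bar> \<le> h"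
    and \<gamma>: "\<rho> = 1 - n powr (- \<gamma>)"
  shows "\<rho>' < 1"
    and "\<bar>W\<bar> \<le> z * (1 - 16 * h) \<Longrightarrow> \<rho> \<in> \<rho>' \<plusminus> z * (sqrt 2 / n powr ((1 + g) / 2))"
    and "\<rho> \<in> \<rho>' \<plusminus> z * (sqrt 2 / n powr ((1 + g) / 2)) \<Longrightarrow> \<bar>W\<bar> \<le> z * (1 + 16 * h)"
    and "\<bar>W\<bar> \<le> z * (1 - 16 * h) \<Longrightarrow> \<gamma> \<in> g \<plusminus> z * (sqrt 2 / (n powr ((1 - g) / 2) * ln n))"
    and "\<gamma> \<in> g \<plusminus> z * (sqrt 2 / (n powr ((1 - g) / 2) * ln n)) \<Longrightarrow> \<bar>W\<bar> \<le> z * (1 + 16 * h)"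
proof -
  have pos: "1 - \<delta> > 0" "w > 0" "E > 0" "ln n > 0" using \<delta> w E h n by auto
  have one_minus: "1 - \<rho>' = c / k * (1 - \<delta>)" unfolding \<rho>'_def \<rho>_def \<delta>_def using k c by (simp add: field_simps)
  then have abs_eq: "\<bar>\<rho>' - 1\<bar> = c / k * (1 - \<delta>)" and pos': "c / k * (1 - \<delta>) > 0"
    using pos k c by (auto simp: abs_minus_commute)
  show "\<rho>' < 1" using one_minus pos' by linarith
  \<comment> \<open>Thus \<open>w\<close> measures how far \<open>1 - \<rho>^2\<close> is from its
    leading term \<open>2 * c / k\<close>.\<close>
  have r2: "1 - \<rho>\<^sup>2 = 2 * c / k * w"
    unfolding \<rho>_def w_def using k by (simp add: field_simps power2_eq_square)
  have r2pos: "1 - \<rho>\<^sup>2 > 0" unfolding r2 using c k pos by simp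
  \<comment> \<open>The common scale of the error and of the half-width, that is, the asymptotic
    standard deviation of the estimate; it cancels from both coverage conditions.\<close>
  define s where "s = sqrt (2 * c / (k * n))"
  have s: "s > 0" using c k n by (simp add: s_def)
  have err: "\<bar>\<rho>' - \<rho>\<bar> = \<bar>W\<bar> / E * (s * sqrt w)"
  proof -
    have D_eq: "D = E * (n * T) / (1 - \<rho>\<^sup>2)" using r2pos n T by (simp add: E_def)
    have N_eq: "N = W * sqrt (n * T\<^sup>2 / (1 - \<rho>\<^sup>2))" using r2pos n T by (simp add: W_def)
    have sw: "s * sqrt w = sqrt ((1 - \<rho>\<^sup>2) / n)"
      unfolding s_def real_sqrt_mult[symmetric] r2 by (simp add: field_simps)
    have nn: "sqrt n * sqrt n = n" "sqrt (1 - \<rho>\<^sup>2) * sqrt (1 - \<rho>\<^sup>2) = 1 - \<rho>\<^sup>2" using n r2pos by auto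
    have nz: "sqrt n \<noteq> 0" "sqrt (1 - \<rho>\<^sup>2) \<noteq> 0" using n r2pos by auto
    have "\<rho>' - \<rho> = N / D" by (simp add: \<rho>'_def)
    also have "\<dots> = W / E * (sqrt (n * T\<^sup>2 / (1 - \<rho>\<^sup>2)) * (1 - \<rho>\<^sup>2) / (n * T))"
      unfolding N_eq D_eq using T n r2pos pos by (simp add: field_simps)
    also have "sqrt (n * T\<^sup>2 / (1 - \<rho>\<^sup>2)) * (1 - \<rho>\<^sup>2) / (n * T) = s * sqrt w"
    proof -
      have "sqrt (n * T\<^sup>2 / (1 - \<rho>\<^sup>2)) * (1 - \<rho>\<^sup>2) / (n * T)
        = sqrt n * T / sqrt (1 - \<rho>\<^sup>2) * (sqrt (1 - \<rho>\<^sup>2) * sqrt (1 - \<rho>\<^sup>2)) / ((sqrt n * sqrt n) * T)"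
        unfolding nn using T by (simp add: real_sqrt_mult real_sqrt_divide)
      also have "\<dots> = sqrt (1 - \<rho>\<^sup>2) / sqrt n" using nz T by (simp add: field_simps)
      finally show ?thesis unfolding sw by (simp add: real_sqrt_divide)
    qed
    finally show ?thesis using pos s by (simp add: abs_mult)
  qed
  \<comment> \<open>The estimated rate inverts exactly: \<open>n powr g\<close> is the reciprocal of
    \<open>1 - \<rho>'\<close>. The plug-in width therefore equals \<open>s\<close> up to the factor
    \<open>sqrt (1 - \<delta>)\<close>.\<close>
  have n_g: "n powr g = 1 / (c / k * (1 - \<delta>))"
  proof -
    have "n powr g = exp (- ln (c / k * (1 - \<delta>)))"
      unfolding powr_def g_def abs_eq using n pos by simp
    also have "\<dots> = 1 / (c / k * (1 - \<delta>))" using pos' by (simp add: exp_minus inverse_eq_divide)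
    finally show ?thesis .
  qed
  have half1: "n powr ((1 + g) / 2) = sqrt (n * n powr g)"
  proof -
    have "(n powr ((1 + g) / 2))\<^sup>2 = n powr (1 + g)"
      unfolding power2_eq_square powr_add[symmetric] by simp
    also have "\<dots> = n * n powr g" using n by (simp add: powr_add)
    finally show ?thesis by (intro real_sqrt_unique[symmetric]) auto
  qed
  have half2: "n powr ((1 - g) / 2) = sqrt (n / n powr g)"
  proof -
    have "(n powr ((1 - g) / 2))\<^sup>2 = n powr (1 - g)"
      unfolding power2_eq_square powr_add[symmetric] by simp
    also have "\<dots> = n / n powr g" using n by (simp add: powr_diff)
    finally show ?thesis by (intro real_sqrt_unique[symmetric]) auto
  qed
  have width1: "sqrt 2 / n powr ((1 + g) / 2) = s * sqrt (1 - \<delta>)"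
    unfolding half1 n_g s_def real_sqrt_mult[symmetric] real_sqrt_divide[symmetric]
    using n c k pos by (simp add: field_simps)
  have CI1: "\<rho> \<in> \<rho>' \<plusminus> z * (sqrt 2 / n powr ((1 + g) / 2)) \<longleftrightarrow> \<bar>W\<bar> \<le> z * (E * sqrt ((1 - \<delta>) / w))"
  proof -
    have "\<rho> \<in> \<rho>' \<plusminus> z * (sqrt 2 / n powr ((1 + g) / 2)) \<longleftrightarrow> \<bar>\<rho>' - \<rho>\<bar> \<le> z * (s * sqrt (1 - \<delta>))"
      unfolding plus_minus_def width1 by (auto simp: abs_le_iff)
    also have "\<dots> \<longleftrightarrow> s * (\<bar>W\<bar> / E * sqrt w) \<le> s * (z * sqrt (1 - \<delta>))"
      unfolding err by (simp add: mult_ac)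
    also have "\<dots> \<longleftrightarrow> \<bar>W\<bar> / E * sqrt w \<le> z * sqrt (1 - \<delta>)" by (rule mult_le_cancel_left_pos[OF s])
    also have "\<dots> \<longleftrightarrow> \<bar>W\<bar> \<le> z * (E * sqrt ((1 - \<delta>) / w))"
      using pos by (simp add: real_sqrt_divide field_simps)
    finally show ?thesis .
  qed
  obtain m where m: "1 - 2 * h \<le> m" "m \<le> 1 + 2 * h" "\<bar>ln (1 - \<delta>)\<bar> = m * \<bar>\<delta>\<bar>"
    using abs_ln_one_minus[OF \<delta>] h by auto
  have mpos: "m > 0" using m h by linarith
  \<comment> \<open>The error of the estimated rate is the logarithm of one minus the relative error
    \<open>\<delta>\<close>; the division by \<open>ln n\<close> is matched by the same division in
    the width.\<close>
  have gg: "g - \<gamma> = - ln (1 - \<delta>) / ln n"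
  proof -
    have "n powr (- \<gamma>) = c / k" using \<gamma> by (simp add: \<rho>_def)
    then have "ln (n powr (- \<gamma>)) = ln (c / k)" by simp
    then have 1: "\<gamma> = - ln (c / k) / ln n" using n pos by (simp add: field_simps)
    have 2: "ln (c / k * (1 - \<delta>)) = ln (c / k) + ln (1 - \<delta>)"
      using c k pos by (intro ln_mult_pos) auto
    show ?thesis unfolding 1 g_def abs_eq 2 by (simp add: add_divide_distrib)
  qed
  have del: "\<bar>\<delta>\<bar> = \<bar>W\<bar> / E * (s * sqrt w) * (k / c)"
  proof -
    have "\<delta> = (\<rho>' - \<rho>) * (k / c)" by (simp add: \<delta>_def \<rho>'_def)
    then show ?thesis using err c k by (simp add: abs_mult)
  qed
  have width2: "sqrt 2 / n powr ((1 - g) / 2) = s * (k / c) / sqrt (1 - \<delta>)"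
  proof -
    have "k / c = sqrt ((k / c)\<^sup>2)" using c k by simp
    then have "s * (k / c) / sqrt (1 - \<delta>) = sqrt (2 * c / (k * n) * (k / c)\<^sup>2 / (1 - \<delta>))"
      unfolding s_def by (simp only: real_sqrt_mult real_sqrt_divide)
    also have "2 * c / (k * n) * (k / c)\<^sup>2 / (1 - \<delta>) = 2 / (n / (1 / (c / k * (1 - \<delta>))))"
      using c k n pos by (simp add: field_simps power2_eq_square)
    finally show ?thesis unfolding half2 n_g by (simp only: real_sqrt_divide)
  qed
  have CI2: "\<gamma> \<in> g \<plusminus> z * (sqrt 2 / (n powr ((1 - g) / 2) * ln n)) \<longleftrightarrow> \<bar>W\<bar> \<le> z * (E / (m * sqrt (w * (1 - \<delta>))))"
  proof -
    define S where "S = s * (k / c)"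
    have S: "S > 0" using s c k by (simp add: S_def)
    have width: "z * (sqrt 2 / (n powr ((1 - g) / 2) * ln n)) = z * (S / sqrt (1 - \<delta>)) / ln n"
      unfolding S_def width2[symmetric] by simp
    have "\<gamma> \<in> g \<plusminus> z * (sqrt 2 / (n powr ((1 - g) / 2) * ln n)) \<longleftrightarrow> \<bar>g - \<gamma>\<bar> \<le> z * (S / sqrt (1 - \<delta>)) / ln n"
      unfolding width plus_minus_def by (auto simp: abs_le_iff)
    also have "\<dots> \<longleftrightarrow> \<bar>ln (1 - \<delta>)\<bar> / ln n \<le> z * (S / sqrt (1 - \<delta>)) / ln n"
      unfolding gg using pos by simp
    also have "\<dots> \<longleftrightarrow> \<bar>ln (1 - \<delta>)\<bar> \<le> z * (S / sqrt (1 - \<delta>))"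
      by (subst divide_le_cancel) (use pos in auto)
    also have "\<dots> \<longleftrightarrow> S * (m * (\<bar>W\<bar> / E * sqrt w)) \<le> S * (z / sqrt (1 - \<delta>))"
      unfolding m(3) del S_def by (simp add: mult_ac)
    also have "\<dots> \<longleftrightarrow> m * (\<bar>W\<bar> / E * sqrt w) \<le> z / sqrt (1 - \<delta>)" by (rule mult_le_cancel_left_pos[OF S])
    also have "\<dots> \<longleftrightarrow> \<bar>W\<bar> \<le> z * (E / (m * sqrt (w * (1 - \<delta>))))"
    proof -
      define p q where "p = sqrt w" and "q = sqrt (1 - \<delta>)"
      have "p > 0" "q > 0" using pos by (auto simp: p_def q_def)
      then show ?thesis
        unfolding real_sqrt_mult p_def[symmetric] q_def[symmetric]
        using pos(3) mpos by (simp add: field_simps)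
    qed
    finally show ?thesis .
  qed
  note rb = ratio_bounds[OF h E \<delta> w m(1,2)]
  show "\<bar>W\<bar> \<le> z * (1 - 16 * h) \<Longrightarrow> \<rho> \<in> \<rho>' \<plusminus> z * (sqrt 2 / n powr ((1 + g) / 2))"
    unfolding CI1 by (erule order_trans) (intro mult_left_mono rb less_imp_le[OF z])
  show "\<rho> \<in> \<rho>' \<plusminus> z * (sqrt 2 / n powr ((1 + g) / 2)) \<Longrightarrow> \<bar>W\<bar> \<le> z * (1 + 16 * h)"
    unfolding CI1 by (erule order_trans) (intro mult_left_mono rb less_imp_le[OF z])
  show "\<bar>W\<bar> \<le> z * (1 - 16 * h) \<Longrightarrow> \<gamma> \<in> g \<plusminus> z * (sqrt 2 / (n powr ((1 - g) / 2) * ln n))"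
    unfolding CI2 by (erule order_trans) (intro mult_left_mono rb less_imp_le[OF z])
  show "\<gamma> \<in> g \<plusminus> z * (sqrt 2 / (n powr ((1 - g) / 2) * ln n)) \<Longrightarrow> \<bar>W\<bar> \<le> z * (1 + 16 * h)"
    unfolding CI2 by (erule order_trans) (intro mult_left_mono rb less_imp_le[OF z])
qed

section \<open>Independent sequences and their past\<close>

locale indep_seq = prob_space M for M :: "'a measure" +
  fixes Z :: "int \<Rightarrow> 'a \<Rightarrow> real"
  assumes indep_Z: "indep_vars (\<lambda>_. borel) Z UNIV"
begin

definition past :: "int \<Rightarrow> 'a measure" where
  "past i = vimage_algebra (space M) (\<lambda>\<omega>. \<lambda>j\<in>{..i}. Z j \<omega>) (PiM {..i} (\<lambda>_. borel))"

lemma Z_measurable[measurable]: "Z j \<in> borel_measurable M"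
  using indep_Z by (simp add: indep_vars_def)

lemma space_past[simp]: "space (past i) = space M"
  by (simp add: past_def)

lemma Z_past:
  assumes "j \<le> i"
  shows "Z j \<in> borel_measurable (past i)"
proof -
  have "(\<lambda>\<omega>. \<lambda>j\<in>{..i}. Z j \<omega>) \<in> measurable (past i) (PiM {..i} (\<lambda>_. borel))"
    unfolding past_def by (rule measurable_vimage_algebra1) (auto simp: space_PiM)
  then have "(\<lambda>\<omega>. (\<lambda>j\<in>{..i}. Z j \<omega>) j) \<in> borel_measurable (past i)"
    by (rule measurable_compose) (rule measurable_component_singleton, use assms in simp)
  then show ?thesis using assms by simp
qed

lemma subalgebra_past: "subalgebra M (past i)"
  unfolding subalgebra_def space_past past_def
  by (intro conjI refl sets_image_in_sets measurable_restrict) auto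

lemma past_mono: "i \<le> i' \<Longrightarrow> subalgebra (past i') (past i)"
  unfolding subalgebra_def space_past unfolding past_def[of i]
  by (intro conjI refl sets_image_in_sets measurable_restrict) (auto intro: Z_past)

lemma past_measurable: "f \<in> measurable (past i) N \<Longrightarrow> f \<in> measurable M N"
  by (rule measurable_from_subalg[OF subalgebra_past])

lemma past_measurable_mono: "f \<in> measurable (past i) N \<Longrightarrow> i \<le> i' \<Longrightarrow> f \<in> measurable (past i') N"
  by (rule measurable_from_subalg[OF past_mono])

text \<open>The index sets \<open>{..i}\<close> and \<open>{j}\<close> are disjoint, so the two
  restricted families are independent, and the events of \<open>f\<close> and of
  \<open>g (Z j)\<close> lie in the algebras that they generate.\<close>

lemma indep_past:
  assumes f: "f \<in> measurable (past i) N" and g: "g \<in> measurable borel N'" and ij: "i < j"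
  shows "indep_var N f N' (\<lambda>\<omega>. g (Z j \<omega>))"
proof -
  let ?R = "\<lambda>A \<omega>. \<lambda>j\<in>A. Z j \<omega>" and ?P = "\<lambda>A. PiM A (\<lambda>_. borel :: real measure)"
  have "indep_var (?P {..i}) (?R {..i}) (?P {j}) (?R {j})"
    by (rule indep_var_restrict[OF indep_Z]) (use ij in auto)
  then have ind: "indep_set (sigma_sets (space M) {?R {..i} -` A \<inter> space M | A. A \<in> sets (?P {..i})})
     (sigma_sets (space M) {?R {j} -` A \<inter> space M | A. A \<in> sets (?P {j})})"
    unfolding indep_var_eq by blast
  have gM: "(\<lambda>\<omega>. g (Z j \<omega>)) \<in> measurable M N'" using g by measurable
  have 1: "sigma_sets (space M) {f -` A \<inter> space M | A. A \<in> sets N}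
     \<subseteq> sigma_sets (space M) {?R {..i} -` A \<inter> space M | A. A \<in> sets (?P {..i})}"
  proof (rule sigma_sets_mono, safe)
    fix A assume "A \<in> sets N"
    then have "f -` A \<inter> space M \<in> sets (past i)" using measurable_sets[OF f] by simp
    also have "sets (past i) = {?R {..i} -` A \<inter> space M | A. A \<in> sets (?P {..i})}"
      unfolding past_def by (rule sets_vimage_algebra2) (auto simp: space_PiM)
    finally show "f -` A \<inter> space M \<in> sigma_sets (space M) {?R {..i} -` A \<inter> space M | A. A \<in> sets (?P {..i})}"
      by (rule sigma_sets.Basic)
  qed
  have 2: "sigma_sets (space M) {(\<lambda>\<omega>. g (Z j \<omega>)) -` A \<inter> space M | A. A \<in> sets N'}
     \<subseteq> sigma_sets (space M) {?R {j} -` A \<inter> space M | A. A \<in> sets (?P {j})}"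
  proof (rule sigma_sets_mono, safe)
    fix A assume A: "A \<in> sets N'"
    have "(\<lambda>x. g (x j)) \<in> measurable (?P {j}) N'"
      using measurable_compose[OF measurable_component_singleton[of j "{j}" "\<lambda>_. borel"] g] by simp
    then have "(\<lambda>x. g (x j)) -` A \<inter> space (?P {j}) \<in> sets (?P {j})" using A by (rule measurable_sets)
    moreover have "(\<lambda>\<omega>. g (Z j \<omega>)) -` A \<inter> space M
        = ?R {j} -` ((\<lambda>x. g (x j)) -` A \<inter> space (?P {j})) \<inter> space M"
      by (auto simp: space_PiM)
    ultimately show "(\<lambda>\<omega>. g (Z j \<omega>)) -` A \<inter> space M
        \<in> sigma_sets (space M) {?R {j} -` A \<inter> space M | A. A \<in> sets (?P {j})}"
      by (intro sigma_sets.Basic) blast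
  qed
  show ?thesis
    unfolding indep_var_eq
  proof (intro conjI past_measurable[OF f] gM)
    show "indep_set (sigma_sets (space M) {f -` A \<inter> space M | A. A \<in> sets N})
       (sigma_sets (space M) {(\<lambda>\<omega>. g (Z j \<omega>)) -` A \<inter> space M | A. A \<in> sets N'})"
      unfolding indep_set_def
      by (rule indep_sets_mono_sets[OF ind[unfolded indep_set_def]]) (use 1 2 in \<open>auto split: bool.split\<close>)
  qed
qed

text \<open>Values are taken in a normed field because the test functions of the characteristic
  function bound are complex.\<close>

lemma
  fixes f :: "'a \<Rightarrow> 'b :: {real_normed_field, banach, second_countable_topology}"
  assumes f: "f \<in> borel_measurable (past i)" "integrable M f"
    and g: "g \<in> borel_measurable borel" "integrable M (\<lambda>\<omega>. g (Z j \<omega>))" and ij: "i < j"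
  shows integrable_past_mult: "integrable M (\<lambda>\<omega>. f \<omega> * g (Z j \<omega>))"
    and expectation_past_mult: "expectation (\<lambda>\<omega>. f \<omega> * g (Z j \<omega>)) = expectation f * expectation (\<lambda>\<omega>. g (Z j \<omega>))"
  using indep_var_integrable[OF indep_past[OF f(1) g(1) ij] f(2) g(2)]
    indep_var_lebesgue_integral[OF indep_past[OF f(1) g(1) ij] f(2) g(2)] by auto

lemma sq_integrable_past_mult:
  assumes f: "f \<in> borel_measurable (past i)" "sq_integrable f"
    and g: "g \<in> borel_measurable borel" "sq_integrable (\<lambda>\<omega>. g (Z j \<omega>))" and ij: "i < j"
  shows "sq_integrable (\<lambda>\<omega>. f \<omega> * g (Z j \<omega>))"
    and "expectation (\<lambda>\<omega>. (f \<omega> * g (Z j \<omega>))\<^sup>2) = expectation (\<lambda>\<omega>. (f \<omega>)\<^sup>2) * expectation (\<lambda>\<omega>. (g (Z j \<omega>))\<^sup>2)"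
proof -
  have m: "(\<lambda>\<omega>. (f \<omega>)\<^sup>2) \<in> borel_measurable (past i)" "(\<lambda>x. (g x)\<^sup>2) \<in> borel_measurable borel"
    using f g by auto
  note fg = f(2)[THEN sq_integrable_square] g(2)[THEN sq_integrable_square]
  show "sq_integrable (\<lambda>\<omega>. f \<omega> * g (Z j \<omega>))"
    using integrable_past_mult[OF m(1) fg(1) m(2) fg(2) ij] past_measurable[OF f(1)] g(1)
    by (auto simp: sq_integrable_def power_mult_distrib)
  show "expectation (\<lambda>\<omega>. (f \<omega> * g (Z j \<omega>))\<^sup>2) = expectation (\<lambda>\<omega>. (f \<omega>)\<^sup>2) * expectation (\<lambda>\<omega>. (g (Z j \<omega>))\<^sup>2)"
    using expectation_past_mult[OF m(1) fg(1) m(2) fg(2) ij] by (simp add: power_mult_distrib)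
qed

text \<open>Increments are orthogonal: \<open>S m * b m\<close> is known at time \<open>m\<close>,
  and the next factor \<open>g (Z (int (Suc m)))\<close> is centred and independent of it. The
  function \<open>g\<close> will be the identity, or \<open>x^2 - 1\<close> for the fluctuation of
  the squared innovations.\<close>

lemma martingale_transform_L2:
  fixes b :: "nat \<Rightarrow> 'a \<Rightarrow> real" and g :: "real \<Rightarrow> real"
  assumes b: "\<And>t. t < n \<Longrightarrow> b t \<in> borel_measurable (past (int t))" "\<And>t. t < n \<Longrightarrow> sq_integrable (b t)"
    and g: "g \<in> borel_measurable borel" "\<And>t. t < n \<Longrightarrow> sq_integrable (\<lambda>\<omega>. g (Z (int (Suc t)) \<omega>))"
    and g0: "\<And>t. t < n \<Longrightarrow> expectation (\<lambda>\<omega>. g (Z (int (Suc t)) \<omega>)) = 0"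
    and g2: "\<And>t. t < n \<Longrightarrow> expectation (\<lambda>\<omega>. (g (Z (int (Suc t)) \<omega>))\<^sup>2) = w"
  shows "sq_integrable (\<lambda>\<omega>. \<Sum>t<n. b t \<omega> * g (Z (int (Suc t)) \<omega>))"
    and "expectation (\<lambda>\<omega>. (\<Sum>t<n. b t \<omega> * g (Z (int (Suc t)) \<omega>))\<^sup>2)
      = w * (\<Sum>t<n. expectation (\<lambda>\<omega>. (b t \<omega>)\<^sup>2))"
proof -
  define S where "S m \<omega> = (\<Sum>t<m. b t \<omega> * g (Z (int (Suc t)) \<omega>))" for m \<omega>
  have summand: "sq_integrable (\<lambda>\<omega>. b t \<omega> * g (Z (int (Suc t)) \<omega>))"
     "expectation (\<lambda>\<omega>. (b t \<omega> * g (Z (int (Suc t)) \<omega>))\<^sup>2) = expectation (\<lambda>\<omega>. (b t \<omega>)\<^sup>2) * w" if "t < n" for t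
    using sq_integrable_past_mult[OF b(1)[OF that] b(2)[OF that] g(1) g(2)[OF that]] g2[OF that]
    by (simp_all del: of_nat_Suc)
  have S_sq: "sq_integrable (S m)" if "m \<le> n" for m
    unfolding S_def by (rule sq_integrable_sum) (use that in \<open>auto intro: summand simp del: of_nat_Suc\<close>)
  have S_past: "S m \<in> borel_measurable (past (int m))" if "m \<le> n" for m
  proof -
    have [measurable]: "b t \<in> borel_measurable (past (int m))" "Z (int (Suc t)) \<in> borel_measurable (past (int m))"
      if "t < m" for t
      using past_measurable_mono[OF b(1)[of t], of "int m"] that \<open>m \<le> n\<close> by (auto intro: Z_past)
    note g(1)[measurable]
    show ?thesis unfolding S_def by measurable
  qed
  have "expectation (\<lambda>\<omega>. (S m \<omega>)\<^sup>2) = w * (\<Sum>t<m. expectation (\<lambda>\<omega>. (b t \<omega>)\<^sup>2))" if "m \<le> n" for m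
    using that
  proof (induction m)
    case (Suc m)
    then have m: "m < n" "m \<le> n" by auto
    let ?\<xi> = "\<lambda>\<omega>. g (Z (int (Suc m)) \<omega>)"
    have p: "(\<lambda>\<omega>. S m \<omega> * b m \<omega>) \<in> borel_measurable (past (int m))"
      using S_past[OF m(2)] b(1)[OF m(1)] by measurable
    have i: "integrable M (\<lambda>\<omega>. S m \<omega> * b m \<omega>)"
      by (rule sq_integrable_mult[OF S_sq[OF m(2)] b(2)[OF m(1)]])
    have ig: "integrable M ?\<xi>" by (rule sq_integrable_integrable[OF g(2)[OF m(1)]])
    have cross: "expectation (\<lambda>\<omega>. S m \<omega> * b m \<omega> * ?\<xi> \<omega>) = 0"
      using expectation_past_mult[OF p i g(1) ig] g0[OF m(1)] by simp
    have icross: "integrable M (\<lambda>\<omega>. S m \<omega> * b m \<omega> * ?\<xi> \<omega>)"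
      using integrable_past_mult[OF p i g(1) ig] by simp
    have "(S (Suc m) \<omega>)\<^sup>2 = (S m \<omega>)\<^sup>2 + 2 * (S m \<omega> * b m \<omega> * ?\<xi> \<omega>) + (b m \<omega> * ?\<xi> \<omega>)\<^sup>2" for \<omega>
      by (simp add: S_def power2_eq_square algebra_simps del: of_nat_Suc)
    then have "expectation (\<lambda>\<omega>. (S (Suc m) \<omega>)\<^sup>2)
       = expectation (\<lambda>\<omega>. (S m \<omega>)\<^sup>2) + 2 * expectation (\<lambda>\<omega>. S m \<omega> * b m \<omega> * ?\<xi> \<omega>)
         + expectation (\<lambda>\<omega>. (b m \<omega> * ?\<xi> \<omega>)\<^sup>2)"
      using icross S_sq[OF m(2), THEN sq_integrable_square] summand(1)[OF m(1), THEN sq_integrable_square]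
      by (simp del: of_nat_Suc)
    then show ?case
      using Suc.IH[OF m(2)] cross summand(2)[OF m(1)] by (simp add: algebra_simps del: of_nat_Suc)
  qed (simp add: S_def)
  then show "expectation (\<lambda>\<omega>. (\<Sum>t<n. b t \<omega> * g (Z (int (Suc t)) \<omega>))\<^sup>2)
      = w * (\<Sum>t<n. expectation (\<lambda>\<omega>. (b t \<omega>)\<^sup>2))"
    unfolding S_def by blast
  show "sq_integrable (\<lambda>\<omega>. \<Sum>t<n. b t \<omega> * g (Z (int (Suc t)) \<omega>))"
    using S_sq[of n] unfolding S_def by simp
qed

end

text \<open>Completing the square: multiplying the centred density by \<open>exp (a * x)\<close>
  shifts its mean to \<open>a * \<alpha>^2\<close>.\<close>

lemma (in prob_space) normal_mgf:
  assumes X: "distributed M lborel X (normal_density 0 \<alpha>)" and \<alpha>: "\<alpha> > 0"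
  shows "integrable M (\<lambda>\<omega>. exp (a * X \<omega>))" and "expectation (\<lambda>\<omega>. exp (a * X \<omega>)) = exp (a\<^sup>2 * \<alpha>\<^sup>2 / 2)"
proof -
  have eq: "normal_density 0 \<alpha> x * exp (a * x) = exp (a\<^sup>2 * \<alpha>\<^sup>2 / 2) * normal_density (a * \<alpha>\<^sup>2) \<alpha> x" for x
  proof -
    have "- (x - 0)\<^sup>2 / (2 * \<alpha>\<^sup>2) + a * x = a\<^sup>2 * \<alpha>\<^sup>2 / 2 + - (x - a * \<alpha>\<^sup>2)\<^sup>2 / (2 * \<alpha>\<^sup>2)"
      using \<alpha> by (simp add: field_simps power2_eq_square)
    then show ?thesis
      by (simp add: normal_density_def exp_add[symmetric])
  qed
  have "integrable lborel (\<lambda>x. normal_density 0 \<alpha> x * exp (a * x))"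
    unfolding eq using \<alpha> by simp
  then show "integrable M (\<lambda>\<omega>. exp (a * X \<omega>))"
    by (subst (asm) distributed_integrable[OF X]) auto
  have "expectation (\<lambda>\<omega>. exp (a * X \<omega>)) = (\<integral>x. normal_density 0 \<alpha> x * exp (a * x) \<partial>lborel)"
    by (rule distributed_integral[OF X, symmetric]) auto
  also have "\<dots> = exp (a\<^sup>2 * \<alpha>\<^sup>2 / 2)"
    unfolding eq using \<alpha> by simp
  finally show "expectation (\<lambda>\<omega>. exp (a * X \<omega>)) = exp (a\<^sup>2 * \<alpha>\<^sup>2 / 2)" .
qed

section \<open>The stochastic volatility autoregression\<close>

lemma abs_exp_minus_one_le: "\<bar>exp x - 1\<bar> \<le> \<bar>x\<bar> * exp \<bar>x\<bar>" for x :: real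
proof (cases "x \<ge> 0")
  case True
  have "exp x * (1 - x) \<le> exp x * exp (- x)"
    using exp_ge_add_one_self[of "- x"] by (intro mult_left_mono) auto
  also have "exp x * exp (- x) = 1" by (simp add: exp_minus)
  finally show ?thesis using True by (simp add: right_diff_distrib mult.commute)
next
  case False
  then have "exp x \<le> 1" by simp
  then have "\<bar>exp x - 1\<bar> \<le> \<bar>x\<bar> * 1" using exp_ge_add_one_self[of x] by linarith
  also have "\<dots> \<le> \<bar>x\<bar> * exp \<bar>x\<bar>" by (intro mult_left_mono) auto
  finally show ?thesis .
qed

text \<open>Two geometric series, one on each side of \<open>t\<close>. These are the row sums of a
  geometrically decaying covariance matrix; \<open>J\<close> is an arbitrary finite set because the
  estimate serves the whole sample and single blocks alike.\<close>

lemma sum_power_dist_le: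
  fixes q :: real
  assumes q: "0 \<le> q" "q < 1" and J: "finite J"
  shows "(\<Sum>s\<in>J. q ^ (max s t - min s t)) \<le> 2 / (1 - q)"
proof -
  have geo: "(\<Sum>i\<in>I. q ^ i) \<le> 1 / (1 - q)" if "finite I" for I :: "nat set"
  proof -
    have "(\<Sum>i\<in>I. q ^ i) \<le> (\<Sum>i. q ^ i)"
      by (rule sum_le_suminf) (use q that in \<open>auto intro: summable_geometric\<close>)
    then show ?thesis using q by (simp add: suminf_geometric)
  qed
  let ?A = "{s \<in> J. s \<le> t}" and ?B = "{s \<in> J. \<not> s \<le> t}"
  have "(\<Sum>s\<in>J. q ^ (max s t - min s t)) = (\<Sum>s\<in>?A. q ^ (max s t - min s t)) + (\<Sum>s\<in>?B. q ^ (max s t - min s t))"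
    using J by (subst sum.union_disjoint[symmetric]) (auto intro!: sum.cong)
  also have "(\<Sum>s\<in>?A. q ^ (max s t - min s t)) = (\<Sum>i\<in>(\<lambda>s. t - s) ` ?A. q ^ i)"
    by (subst sum.reindex) (auto simp: inj_on_def max_def min_def intro!: sum.cong)
  also have "(\<Sum>s\<in>?B. q ^ (max s t - min s t)) = (\<Sum>i\<in>(\<lambda>s. s - t) ` ?B. q ^ i)"
    by (subst sum.reindex) (auto simp: inj_on_def max_def min_def intro!: sum.cong)
  also have "(\<Sum>i\<in>(\<lambda>s. t - s) ` ?A. q ^ i) + (\<Sum>i\<in>(\<lambda>s. s - t) ` ?B. q ^ i) \<le> 1 / (1 - q) + 1 / (1 - q)"
    by (intro add_mono geo) (use J in auto)
  finally show ?thesis by simp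
qed

subsection \<open>The process with fixed parameters\<close>

text \<open>The volatility noise sits at the negative indices, the initial value at \<open>0\<close> and the innovations
  at the positive ones, so that \<open>past t\<close> with \<open>t \<ge> 0\<close> contains the whole volatility path.\<close>

locale sv_process = indep_seq M Z for M :: "'a measure" and Z +
  fixes c \<alpha> \<phi> \<kappa> k :: real
  assumes c_pos: "c > 0" and \<alpha>_pos: "\<alpha> > 0" and \<phi>_abs: "\<bar>\<phi>\<bar> < 1" and k_ge: "k \<ge> 1" "k \<ge> c"
    and noise_normal: "\<And>t::nat. t \<ge> 1 \<Longrightarrow> distributed M lborel (Z (- int t)) (normal_density 0 \<alpha>)"
    and innov_fourth: "\<And>t::nat. t \<ge> 1 \<Longrightarrow> integrable M (\<lambda>\<omega>. Z (int t) \<omega> ^ 4)"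
    and innov_mean: "\<And>t::nat. t \<ge> 1 \<Longrightarrow> expectation (Z (int t)) = 0"
    and innov_square: "\<And>t::nat. t \<ge> 1 \<Longrightarrow> expectation (\<lambda>\<omega>. (Z (int t) \<omega>)\<^sup>2) = 1"
    and innov_kurtosis: "\<And>t::nat. t \<ge> 1 \<Longrightarrow> expectation (\<lambda>\<omega>. Z (int t) \<omega> ^ 4) = \<kappa>"
    and init_fourth: "integrable M (\<lambda>\<omega>. Z 0 \<omega> ^ 4)"
    and init_moment: "expectation (\<lambda>\<omega>. Z 0 \<omega> ^ 4) \<le> k\<^sup>2"
begin

abbreviation \<epsilon> :: "nat \<Rightarrow> 'a \<Rightarrow> real" where "\<epsilon> t \<equiv> Z (int t)"

definition \<rho> :: real where "\<rho> = 1 - c / k"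

primrec logvol :: "nat \<Rightarrow> 'a \<Rightarrow> real" where
  "logvol 0 \<omega> = 0"
| "logvol (Suc t) \<omega> = \<phi> * logvol t \<omega> + Z (- int (Suc t)) \<omega>"

definition vol :: "nat \<Rightarrow> 'a \<Rightarrow> real" where
  "vol t \<omega> = exp (logvol t \<omega> / 2)"

primrec Y :: "nat \<Rightarrow> 'a \<Rightarrow> real" where
  "Y 0 \<omega> = Z 0 \<omega>"
| "Y (Suc t) \<omega> = \<rho> * Y t \<omega> + vol (Suc t) \<omega> * \<epsilon> (Suc t) \<omega>"

text \<open>\<open>v t\<close> is the variance of \<open>logvol t\<close>, \<open>V\<close> its stationary limit and \<open>T\<close> the stationary mean of
  the squared volatility; \<open>wt t j\<close> is the coefficient of the \<open>j\<close>-th noise in \<open>logvol t\<close>.\<close>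

definition v :: "nat \<Rightarrow> real" where "v t = \<alpha>\<^sup>2 * (1 - \<phi> ^ (2 * t)) / (1 - \<phi>\<^sup>2)"
definition V :: real where "V = \<alpha>\<^sup>2 / (1 - \<phi>\<^sup>2)"
definition R :: real where "R = exp V"
definition T :: real where "T = exp (V / 2)"
definition wt :: "nat \<Rightarrow> nat \<Rightarrow> real" where "wt t j = (if j \<le> t then \<phi> ^ (t - j) else 0)"

section \<open>Exact Gaussian moments of the volatility\<close>

lemma \<phi>_sq: "\<phi>\<^sup>2 < 1"
  using \<phi>_abs by (simp add: abs_square_less_1)

lemma V_pos: "V > 0"
  using \<phi>_sq \<alpha>_pos by (simp add: V_def)

lemma v_nonneg: "v t \<ge> 0"
proof -
  have "\<phi> ^ (2 * t) \<le> 1" using \<phi>_sq by (simp add: power_mult power_le_one)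
  then show ?thesis using \<phi>_sq by (simp add: v_def)
qed

lemma v_eq: "v t = V - V * \<phi> ^ (2 * t)"
  by (simp add: v_def V_def algebra_simps diff_divide_distrib)

lemma v_le: "v t \<le> V"
  using V_pos by (simp add: v_eq power_mult)

lemma R_ge: "R \<ge> 1" and T_ge: "T \<ge> 1" and V_le_R: "V \<le> R" and T_square: "T\<^sup>2 = R"
proof -
  show "V \<le> R" unfolding R_def using exp_ge_add_one_self[of V] by linarith
qed (use V_pos in \<open>auto simp: R_def T_def exp_double[symmetric]\<close>)

lemma T_le_R: "T \<le> R"
  using T_ge T_square by (metis mult_left_mono mult.right_neutral order_trans zero_le_one power2_eq_square)

lemma v_Suc: "v (Suc t) = \<phi>\<^sup>2 * v t + \<alpha>\<^sup>2"
  using \<phi>_sq by (simp add: v_def field_simps power_mult power2_eq_square)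

lemma wt_sq: "\<alpha>\<^sup>2 * (\<Sum>j=1..t. (wt t j)\<^sup>2) = v t"
proof (induction t)
  case (Suc t)
  have "(\<Sum>j=1..t. (wt (Suc t) j)\<^sup>2) = \<phi>\<^sup>2 * (\<Sum>j=1..t. (wt t j)\<^sup>2)"
    unfolding sum_distrib_left
    by (intro sum.cong refl) (auto simp: wt_def Suc_diff_le power_mult_distrib)
  then have "\<alpha>\<^sup>2 * (\<Sum>j=1..Suc t. (wt (Suc t) j)\<^sup>2) = \<phi>\<^sup>2 * (\<alpha>\<^sup>2 * (\<Sum>j=1..t. (wt t j)\<^sup>2)) + \<alpha>\<^sup>2"
    by (simp add: wt_def algebra_simps)
  then show ?case by (simp only: Suc.IH v_Suc)
qed (simp add: v_def)

text \<open>Only noise up to time \<open>s\<close> is shared, and there the two weights differ by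
  the factor \<open>\<phi> ^ (t - s)\<close>. This is the covariance of \<open>logvol s\<close> and
  \<open>logvol t\<close>.\<close>

lemma wt_prod:
  assumes "s \<le> t"
  shows "\<alpha>\<^sup>2 * (\<Sum>j=1..t. wt s j * wt t j) = \<phi> ^ (t - s) * v s"
proof -
  have "(\<Sum>j=1..t. wt s j * wt t j) = (\<Sum>j=1..s. wt s j * wt t j)"
    by (rule sum.mono_neutral_right) (use assms in \<open>auto simp: wt_def\<close>)
  also have "\<dots> = (\<Sum>j=1..s. \<phi> ^ (t - s) * (wt s j)\<^sup>2)"
  proof (intro sum.cong refl)
    fix j assume "j \<in> {1..s}"
    then have j: "(t - s) + (s - j) = t - j" "j \<le> s" "j \<le> t" using assms by auto
    have "\<phi> ^ (t - j) = \<phi> ^ (t - s) * \<phi> ^ (s - j)" unfolding j(1)[symmetric] power_add ..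
    then show "wt s j * wt t j = \<phi> ^ (t - s) * (wt s j)\<^sup>2"
      using j(2,3) by (simp add: wt_def power2_eq_square)
  qed
  finally show ?thesis using wt_sq[of s] by (simp add: sum_distrib_left[symmetric] algebra_simps)
qed

lemma wt_sq':
  assumes "s \<le> t"
  shows "\<alpha>\<^sup>2 * (\<Sum>j=1..t. (wt s j)\<^sup>2) = v s"
proof -
  have "(\<Sum>j=1..t. (wt s j)\<^sup>2) = (\<Sum>j=1..s. (wt s j)\<^sup>2)"
    by (rule sum.mono_neutral_right) (use assms in \<open>auto simp: wt_def\<close>)
  then show ?thesis using wt_sq[of s] by simp
qed

text \<open>Summing up to a common bound \<open>t\<close>, with weight 0 beyond \<open>s\<close>,
  expresses the log-volatilities at two times through the same noise variables.\<close>

lemma logvol_eq: "s \<le> t \<Longrightarrow> logvol s \<omega> = (\<Sum>j=1..t. wt s j * Z (- int j) \<omega>)"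
proof -
  have "logvol s \<omega> = (\<Sum>j=1..s. wt s j * Z (- int j) \<omega>)"
  proof (induction s)
    case (Suc s)
    have "(\<Sum>j=1..s. wt (Suc s) j * Z (- int j) \<omega>) = \<phi> * (\<Sum>j=1..s. wt s j * Z (- int j) \<omega>)"
      unfolding sum_distrib_left
      by (intro sum.cong refl) (auto simp: wt_def Suc_diff_le)
    then show ?case using Suc by (simp add: wt_def)
  qed simp
  also assume "s \<le> t"
  then have "(\<Sum>j=1..s. wt s j * Z (- int j) \<omega>) = (\<Sum>j=1..t. wt s j * Z (- int j) \<omega>)"
    by (intro sum.mono_neutral_left) (auto simp: wt_def)
  finally show ?thesis .
qed

text \<open>Independence factors the exponential into one-dimensional moment generating functions;
  the reindexing is there because the noise sits at the negative integers.\<close>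

lemma
  fixes a :: "nat \<Rightarrow> real"
  shows integrable_exp_noise: "integrable M (\<lambda>\<omega>. exp (\<Sum>j=1..N. a j * Z (- int j) \<omega>))"
    and expectation_exp_noise: "expectation (\<lambda>\<omega>. exp (\<Sum>j=1..N. a j * Z (- int j) \<omega>)) = exp (\<alpha>\<^sup>2 / 2 * (\<Sum>j=1..N. (a j)\<^sup>2))"
proof -
  define J where "J = (\<lambda>j. - int j) ` {1..N}"
  define X where "X i \<omega> = exp (a (nat (- i)) * Z i \<omega>)" for i \<omega>
  have "indep_vars (\<lambda>_. borel) Z J" by (rule indep_vars_subset[OF indep_Z]) simp
  then have ind: "indep_vars (\<lambda>_. borel) X J"
    unfolding X_def by (rule indep_vars_compose2[where Y="\<lambda>i x. exp (a (nat (- i)) * x)"]) auto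
  have fin: "finite J" by (simp add: J_def)
  have int: "integrable M (X i)" if "i \<in> J" for i
    using that normal_mgf(1)[OF noise_normal \<alpha>_pos] by (auto simp: J_def X_def[abs_def])
  have ex: "expectation (X i) = exp ((a (nat (- i)))\<^sup>2 * \<alpha>\<^sup>2 / 2)" if "i \<in> J" for i
    using that normal_mgf(2)[OF noise_normal \<alpha>_pos] by (auto simp: J_def X_def[abs_def])
  have inj: "inj_on (\<lambda>j. - int j) {1..N}" by (auto simp: inj_on_def)
  have eq: "exp (\<Sum>j=1..N. a j * Z (- int j) \<omega>) = (\<Prod>i\<in>J. X i \<omega>)" for \<omega>
    unfolding J_def by (subst prod.reindex[OF inj]) (simp add: X_def exp_sum)
  show "integrable M (\<lambda>\<omega>. exp (\<Sum>j=1..N. a j * Z (- int j) \<omega>))"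
    unfolding eq by (rule indep_vars_integrable[OF fin ind int])
  have "expectation (\<lambda>\<omega>. exp (\<Sum>j=1..N. a j * Z (- int j) \<omega>)) = (\<Prod>i\<in>J. expectation (X i))"
    unfolding eq by (rule indep_vars_lebesgue_integral[OF fin ind int])
  also have "\<dots> = (\<Prod>i\<in>J. exp ((a (nat (- i)))\<^sup>2 * \<alpha>\<^sup>2 / 2))"
    by (intro prod.cong refl ex)
  also have "\<dots> = exp (\<Sum>j=1..N. (a j)\<^sup>2 * \<alpha>\<^sup>2 / 2)"
    unfolding J_def by (subst prod.reindex[OF inj]) (simp add: exp_sum)
  finally show "expectation (\<lambda>\<omega>. exp (\<Sum>j=1..N. a j * Z (- int j) \<omega>)) = exp (\<alpha>\<^sup>2 / 2 * (\<Sum>j=1..N. (a j)\<^sup>2))"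
    by (simp add: sum_distrib_left mult.commute)
qed

lemma
  assumes st: "s \<le> t"
  shows integrable_exp_logvol: "integrable M (\<lambda>\<omega>. exp (a * logvol s \<omega> + b * logvol t \<omega>))"
    and expectation_exp_logvol: "expectation (\<lambda>\<omega>. exp (a * logvol s \<omega> + b * logvol t \<omega>))
      = exp ((a\<^sup>2 * v s + b\<^sup>2 * v t + 2 * a * b * \<phi> ^ (t - s) * v s) / 2)"
proof -
  have eq: "a * logvol s \<omega> + b * logvol t \<omega> = (\<Sum>j=1..t. (a * wt s j + b * wt t j) * Z (- int j) \<omega>)" for \<omega>
    unfolding logvol_eq[OF st] logvol_eq[OF order_refl, of t]
    by (simp add: sum_distrib_left sum.distrib algebra_simps)
  show "integrable M (\<lambda>\<omega>. exp (a * logvol s \<omega> + b * logvol t \<omega>))"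
    unfolding eq by (rule integrable_exp_noise)
  have "(\<Sum>j=1..t. (a * wt s j + b * wt t j)\<^sup>2)
      = a\<^sup>2 * (\<Sum>j=1..t. (wt s j)\<^sup>2) + b\<^sup>2 * (\<Sum>j=1..t. (wt t j)\<^sup>2) + 2 * a * b * (\<Sum>j=1..t. wt s j * wt t j)"
    by (simp add: sum_distrib_left sum.distrib power2_eq_square algebra_simps)
  then have "\<alpha>\<^sup>2 / 2 * (\<Sum>j=1..t. (a * wt s j + b * wt t j)\<^sup>2)
     = (a\<^sup>2 * (\<alpha>\<^sup>2 * (\<Sum>j=1..t. (wt s j)\<^sup>2)) + b\<^sup>2 * (\<alpha>\<^sup>2 * (\<Sum>j=1..t. (wt t j)\<^sup>2))
        + 2 * a * b * (\<alpha>\<^sup>2 * (\<Sum>j=1..t. wt s j * wt t j))) / 2"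
    by (simp add: algebra_simps)
  also have "\<dots> = (a\<^sup>2 * v s + b\<^sup>2 * v t + 2 * a * b * \<phi> ^ (t - s) * v s) / 2"
    unfolding wt_sq wt_sq'[OF st] wt_prod[OF st] by (simp add: mult.assoc)
  finally show "expectation (\<lambda>\<omega>. exp (a * logvol s \<omega> + b * logvol t \<omega>))
      = exp ((a\<^sup>2 * v s + b\<^sup>2 * v t + 2 * a * b * \<phi> ^ (t - s) * v s) / 2)"
    unfolding eq expectation_exp_noise by simp
qed

lemma vol_power: "vol t \<omega> ^ m = exp (real m / 2 * logvol t \<omega>)"
  by (simp add: vol_def exp_of_nat_mult[symmetric])

text \<open>The bound is \<open>- 1\<close> for every \<open>t\<close>, strictly below the index of
  the initial value, so functions of the volatility path are independent of that value as well as of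
  the innovations.\<close>

lemma logvol_past: "i \<ge> - 1 \<Longrightarrow> logvol t \<in> borel_measurable (past i)"
proof (induction t)
  case (Suc t)
  have [measurable]: "Z (- int (Suc t)) \<in> borel_measurable (past i)"
    using Suc.prems by (intro Z_past) simp
  note Suc.IH[OF Suc.prems, measurable]
  have "(\<lambda>\<omega>. \<phi> * logvol t \<omega> + Z (- int (Suc t)) \<omega>) \<in> borel_measurable (past i)"
    by measurable
  then show ?case by simp
qed (simp add: measurable_cong[where f="logvol 0" and g="\<lambda>_. 0"])

lemma vol_past: "i \<ge> - 1 \<Longrightarrow> vol t \<in> borel_measurable (past i)"
  using logvol_past[of i t] unfolding vol_def by measurable

lemma Y_past: "int t \<le> i \<Longrightarrow> Y t \<in> borel_measurable (past i)"
proof (induction t arbitrary: i)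
  case 0
  then have "Z 0 \<in> borel_measurable (past i)" by (intro Z_past) simp
  moreover have "Y 0 = Z 0" by (simp add: fun_eq_iff)
  ultimately show ?case by simp
next
  case (Suc t)
  have [measurable]: "Y t \<in> borel_measurable (past i)" "vol (Suc t) \<in> borel_measurable (past i)"
    "\<epsilon> (Suc t) \<in> borel_measurable (past i)"
    using Suc.IH[of i] vol_past[of i "Suc t"] Z_past[of "int (Suc t)" i] Suc.prems by auto
  have "(\<lambda>\<omega>. \<rho> * Y t \<omega> + vol (Suc t) \<omega> * \<epsilon> (Suc t) \<omega>) \<in> borel_measurable (past i)"
    by measurable
  then show ?case by simp
qed

lemma vol_measurable[measurable]: "vol t \<in> borel_measurable M"
  by (rule past_measurable[OF vol_past[of 0]]) simp

lemma Y_measurable[measurable]: "Y t \<in> borel_measurable M"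
  by (rule past_measurable[OF Y_past[OF order_refl]])

lemma integrable_vol_power: "integrable M (\<lambda>\<omega>. vol t \<omega> ^ m)"
  using integrable_exp_logvol[of t t "real m / 2" 0] by (simp add: vol_power)

lemma expectation_vol_power: "expectation (\<lambda>\<omega>. vol t \<omega> ^ m) = exp ((real m / 2)\<^sup>2 * v t / 2)"
  using expectation_exp_logvol[of t t "real m / 2" 0] by (simp add: vol_power)

lemma
  assumes "s \<le> t"
  shows integrable_vol_power_mult: "integrable M (\<lambda>\<omega>. vol s \<omega> ^ m * vol t \<omega> ^ l)"
    and expectation_vol_power_mult: "expectation (\<lambda>\<omega>. vol s \<omega> ^ m * vol t \<omega> ^ l)
      = exp (((real m / 2)\<^sup>2 * v s + (real l / 2)\<^sup>2 * v t + 2 * (real m / 2) * (real l / 2) * \<phi> ^ (t - s) * v s) / 2)"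
  using integrable_exp_logvol[OF assms, of "real m / 2" "real l / 2"]
    expectation_exp_logvol[OF assms, of "real m / 2" "real l / 2"]
  by (simp_all add: vol_power exp_add)

lemma \<phi>_power_v: "\<bar>\<phi> ^ m * v s\<bar> \<le> \<bar>\<phi>\<bar> ^ m * V" "\<phi> ^ m * v s \<le> V"
proof -
  show 1: "\<bar>\<phi> ^ m * v s\<bar> \<le> \<bar>\<phi>\<bar> ^ m * V"
    using v_le[of s] v_nonneg[of s] by (simp add: abs_mult power_abs mult_left_mono)
  have "\<bar>\<phi>\<bar> ^ m * V \<le> 1 * V"
    using V_pos \<phi>_abs by (intro mult_right_mono power_le_one) auto
  with 1 show "\<phi> ^ m * v s \<le> V" by linarith
qed

lemma R_power: "R ^ m = exp (real m * V)"
  by (simp add: R_def exp_of_nat_mult)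

lemma expectation_vol4_le: "expectation (\<lambda>\<omega>. vol t \<omega> ^ 4) \<le> R\<^sup>2"
  using v_le[of t] by (simp add: expectation_vol_power R_power)

text \<open>The exponent is at most \<open>(4 * V + 4 * V + 8 * V) / 2\<close>, the last summand
  being the covariance; the eighth power of \<open>R\<close> in the later bounds starts
  here.\<close>

lemma
  shows integrable_vol44: "integrable M (\<lambda>\<omega>. vol s \<omega> ^ 4 * vol t \<omega> ^ 4)"
    and expectation_vol44_le: "expectation (\<lambda>\<omega>. vol s \<omega> ^ 4 * vol t \<omega> ^ 4) \<le> R ^ 8"
proof -
  have *: "integrable M (\<lambda>\<omega>. vol s \<omega> ^ 4 * vol t \<omega> ^ 4) \<and> expectation (\<lambda>\<omega>. vol s \<omega> ^ 4 * vol t \<omega> ^ 4) \<le> R ^ 8"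
    if "s \<le> t" for s t
  proof
    show "integrable M (\<lambda>\<omega>. vol s \<omega> ^ 4 * vol t \<omega> ^ 4)" by (rule integrable_vol_power_mult[OF that])
    show "expectation (\<lambda>\<omega>. vol s \<omega> ^ 4 * vol t \<omega> ^ 4) \<le> R ^ 8"
      using v_le[of s] v_le[of t] \<phi>_power_v(2)[of "t - s" s]
      by (simp add: expectation_vol_power_mult[OF that] R_power power2_eq_square)
  qed
  show "integrable M (\<lambda>\<omega>. vol s \<omega> ^ 4 * vol t \<omega> ^ 4)" "expectation (\<lambda>\<omega>. vol s \<omega> ^ 4 * vol t \<omega> ^ 4) \<le> R ^ 8"
    using *[of s t] *[of t s] by (cases "s \<le> t"; simp add: mult.commute)+
qed

text \<open>Centred at the stationary mean \<open>T\<close>, the same for all \<open>t\<close>, and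
  not at the actual mean; the start at volatility 1 then leaves a bias that decays
  geometrically.\<close>

definition dev :: "nat \<Rightarrow> 'a \<Rightarrow> real" where "dev t \<omega> = (vol t \<omega>)\<^sup>2 - T"

lemma sq_integrable_vol2: "sq_integrable (\<lambda>\<omega>. (vol t \<omega>)\<^sup>2)"
  using integrable_vol_power[of t 4] by (simp add: sq_integrable_def flip: power_mult)

lemma sq_integrable_dev: "sq_integrable (dev t)"
  using sq_integrable_diff[OF sq_integrable_vol2 sq_integrable_const[of T], of t]
  by (simp add: dev_def[abs_def])

text \<open>The bias comes from \<open>V - v t = V * \<phi> ^ (2 * t)\<close>. One factor
  \<open>R\<close> stands for \<open>T\<close> and the other for \<open>V\<close>, so that the bound
  is polynomial in \<open>R\<close> alone.\<close>

lemma mean_dev_le: "\<bar>expectation (dev t)\<bar> \<le> R\<^sup>2 * \<bar>\<phi>\<bar> ^ t"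
proof -
  have int: "integrable M (\<lambda>\<omega>. (vol t \<omega>)\<^sup>2)" by (rule integrable_vol_power)
  have "expectation (dev t) = exp (v t / 2) - T"
    using int unfolding dev_def by (simp add: prob_space expectation_vol_power)
  also have "\<dots> = T * (exp (- ((V - v t) / 2)) - 1)"
  proof -
    have "T * exp (- ((V - v t) / 2)) = exp (v t / 2)"
      unfolding T_def exp_add[symmetric] by (simp add: diff_divide_distrib)
    then show ?thesis by (simp add: right_diff_distrib)
  qed
  finally have "\<bar>expectation (dev t)\<bar> = T * \<bar>exp (- ((V - v t) / 2)) - 1\<bar>"
    using T_ge by (simp add: abs_mult)
  also have "\<bar>exp (- ((V - v t) / 2)) - 1\<bar> \<le> (V - v t) / 2"
  proof -
    have "exp (- ((V - v t) / 2)) \<le> 1" using v_le[of t] by simp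
    then show ?thesis using exp_ge_add_one_self[of "- ((V - v t) / 2)"] by linarith
  qed
  also have "T * ((V - v t) / 2) \<le> R * (R * \<bar>\<phi>\<bar> ^ t)"
  proof (intro mult_mono T_le_R)
    have "(V - v t) / 2 \<le> V * \<phi> ^ (2 * t)" using v_le[of t] by (simp add: v_eq)
    also have "\<phi> ^ (2 * t) = \<bar>\<phi>\<bar> ^ t * \<bar>\<phi>\<bar> ^ t" by (simp add: power_mult power_mult_distrib[symmetric] power2_eq_square)
    also have "V * (\<bar>\<phi>\<bar> ^ t * \<bar>\<phi>\<bar> ^ t) \<le> R * (1 * \<bar>\<phi>\<bar> ^ t)"
      using V_pos V_le_R \<phi>_abs R_ge by (intro mult_mono power_le_one) auto
    finally show "(V - v t) / 2 \<le> R * \<bar>\<phi>\<bar> ^ t" by simp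
  qed (use R_ge v_le[of t] in auto)
  finally show ?thesis using T_ge by (simp add: power2_eq_square mult.assoc mult_left_mono)
qed

text \<open>The covariance of two lognormal variables is explicit: the product of their means times
  \<open>exp x - 1\<close>, where \<open>x\<close> is the covariance of the logarithms and decays
  geometrically. The product of the two biases contributes the second copy of
  \<open>R ^ 4\<close>.\<close>

lemma cov_dev_le:
  assumes st: "s \<le> t"
  shows "\<bar>expectation (\<lambda>\<omega>. dev s \<omega> * dev t \<omega>)\<bar> \<le> 2 * R ^ 4 * \<bar>\<phi>\<bar> ^ (t - s)"
proof -
  let ?A = "expectation (\<lambda>\<omega>. (vol s \<omega>)\<^sup>2 * (vol t \<omega>)\<^sup>2)"
  let ?s = "expectation (\<lambda>\<omega>. (vol s \<omega>)\<^sup>2)" and ?t = "expectation (\<lambda>\<omega>. (vol t \<omega>)\<^sup>2)"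
  have int: "integrable M (\<lambda>\<omega>. (vol t \<omega>)\<^sup>2)" for t by (rule integrable_vol_power)
  have dev: "expectation (dev t) = expectation (\<lambda>\<omega>. (vol t \<omega>)\<^sup>2) - T" for t
    using int[of t] unfolding dev_def by (simp add: prob_space)
  have "expectation (\<lambda>\<omega>. dev s \<omega> * dev t \<omega>)
      = expectation (\<lambda>\<omega>. (vol s \<omega>)\<^sup>2 * (vol t \<omega>)\<^sup>2 - T * (vol s \<omega>)\<^sup>2 - T * (vol t \<omega>)\<^sup>2 + T * T)"
    by (simp add: dev_def algebra_simps)
  also have "\<dots> = ?A - T * ?s - T * ?t + T * T"
    using int[of s] int[of t] integrable_vol_power_mult[OF st, of 2 2] by (simp add: prob_space)
  also have "\<dots> = (?A - ?s * ?t) + expectation (dev s) * expectation (dev t)"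
    unfolding dev by (simp add: algebra_simps)
  finally have split: "expectation (\<lambda>\<omega>. dev s \<omega> * dev t \<omega>)
     = (?A - ?s * ?t) + expectation (dev s) * expectation (dev t)" .
  define x where "x = \<phi> ^ (t - s) * v s"
  have x: "\<bar>x\<bar> \<le> \<bar>\<phi>\<bar> ^ (t - s) * V" unfolding x_def by (rule \<phi>_power_v)
  have xV: "\<bar>x\<bar> \<le> V"
  proof -
    have "\<bar>\<phi>\<bar> ^ (t - s) * V \<le> 1 * V"
      using V_pos \<phi>_abs by (intro mult_right_mono power_le_one) auto
    with x show ?thesis by simp
  qed
  have "?A - ?s * ?t = exp ((v s + v t) / 2) * (exp x - 1)"
  proof -
    have "?A = exp ((v s + v t) / 2 + x)"
      using expectation_vol_power_mult[OF st, of 2 2] by (simp add: x_def add_divide_distrib)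
    moreover have "?s * ?t = exp ((v s + v t) / 2)"
      by (simp add: expectation_vol_power add_divide_distrib exp_add)
    ultimately show ?thesis by (simp add: exp_add right_diff_distrib)
  qed
  then have "\<bar>?A - ?s * ?t\<bar> = exp ((v s + v t) / 2) * \<bar>exp x - 1\<bar>" by (simp add: abs_mult)
  also have "\<dots> \<le> R * (\<bar>\<phi>\<bar> ^ (t - s) * R * R)"
  proof (intro mult_mono)
    show "exp ((v s + v t) / 2) \<le> R" using v_le[of s] v_le[of t] by (simp add: R_def)
    have "\<bar>exp x - 1\<bar> \<le> \<bar>x\<bar> * exp \<bar>x\<bar>" by (rule abs_exp_minus_one_le)
    also have "\<dots> \<le> (\<bar>\<phi>\<bar> ^ (t - s) * R) * R"
    proof (intro mult_mono)
      show "\<bar>x\<bar> \<le> \<bar>\<phi>\<bar> ^ (t - s) * R"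
        using x V_le_R by (meson mult_left_mono order_trans zero_le_power abs_ge_zero)
      show "exp \<bar>x\<bar> \<le> R" using xV by (simp add: R_def)
    qed (use R_ge in auto)
    finally show "\<bar>exp x - 1\<bar> \<le> \<bar>\<phi>\<bar> ^ (t - s) * R * R" .
  qed (use R_ge in auto)
  also have "\<dots> = R ^ 3 * \<bar>\<phi>\<bar> ^ (t - s)" by (simp add: power3_eq_cube algebra_simps)
  also have "\<dots> \<le> R ^ 4 * \<bar>\<phi>\<bar> ^ (t - s)"
    using R_ge by (intro mult_right_mono power_increasing) auto
  finally have 1: "\<bar>?A - ?s * ?t\<bar> \<le> R ^ 4 * \<bar>\<phi>\<bar> ^ (t - s)" .
  have "\<bar>expectation (dev s) * expectation (dev t)\<bar> \<le> (R\<^sup>2 * \<bar>\<phi>\<bar> ^ s) * (R\<^sup>2 * \<bar>\<phi>\<bar> ^ t)"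
    unfolding abs_mult using R_ge by (intro mult_mono mean_dev_le) auto
  also have "\<dots> = R ^ 4 * (\<bar>\<phi>\<bar> ^ s * \<bar>\<phi>\<bar> ^ t)"
    by (simp add: power_numeral_reduce)
  also have "\<bar>\<phi>\<bar> ^ s * \<bar>\<phi>\<bar> ^ t \<le> 1 * \<bar>\<phi>\<bar> ^ (t - s)"
    using \<phi>_abs by (intro mult_mono power_le_one power_decreasing) auto
  finally have 2: "\<bar>expectation (dev s) * expectation (dev t)\<bar> \<le> R ^ 4 * \<bar>\<phi>\<bar> ^ (t - s)"
    using R_ge by (simp add: mult_left_mono)
  show ?thesis unfolding split using 1 2 by linarith
qed

text \<open>Factor \<open>1 - \<phi>^2 = (1 - |\<phi>|) * (1 + |\<phi>|)\<close> and use
  \<open>\<alpha>^2 / (1 - \<phi>^2) = V \<le> R\<close>: the mixing time, too, is controlled by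
  \<open>R\<close>.\<close>

lemma mixing_time_le: "1 / (1 - \<bar>\<phi>\<bar>) \<le> 2 * R / \<alpha>\<^sup>2"
proof -
  have "1 / (1 - \<bar>\<phi>\<bar>) = (1 + \<bar>\<phi>\<bar>) / (1 - \<phi>\<^sup>2)"
  proof -
    have "1 - \<phi>\<^sup>2 = (1 - \<bar>\<phi>\<bar>) * (1 + \<bar>\<phi>\<bar>)"
      by (simp add: algebra_simps power2_eq_square abs_mult_self_eq)
    moreover have "1 + \<bar>\<phi>\<bar> \<noteq> 0" by linarith
    ultimately show ?thesis using \<phi>_abs by simp
  qed
  also have "\<dots> \<le> 2 / (1 - \<phi>\<^sup>2)" using \<phi>_abs \<phi>_sq by (intro divide_right_mono) auto
  also have "\<dots> = 2 * V / \<alpha>\<^sup>2" using \<alpha>_pos by (simp add: V_def)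
  also have "\<dots> \<le> 2 * R / \<alpha>\<^sup>2" using V_le_R by (intro divide_right_mono) auto
  finally show ?thesis .
qed

text \<open>Geometric covariances have bounded row sums, so the second moment of the sum is linear
  in the number of terms. Of \<open>R ^ 5\<close>, four powers come from the covariances and one
  from the mixing time.\<close>

lemma sum_dev_sq_le:
  assumes J: "finite J"
  shows "expectation (\<lambda>\<omega>. (\<Sum>t\<in>J. dev t \<omega>)\<^sup>2) \<le> real (card J) * (8 * R ^ 5 / \<alpha>\<^sup>2)"
proof -
  have cov: "expectation (\<lambda>\<omega>. dev s \<omega> * dev t \<omega>) \<le> 2 * R ^ 4 * \<bar>\<phi>\<bar> ^ (max s t - min s t)" for s t
  proof (cases "s \<le> t")
    case True
    then show ?thesis using cov_dev_le[of s t] by (simp add: max_def min_def)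
  next
    case False
    have "expectation (\<lambda>\<omega>. dev s \<omega> * dev t \<omega>) = expectation (\<lambda>\<omega>. dev t \<omega> * dev s \<omega>)"
      by (simp only: mult.commute)
    then show ?thesis using False cov_dev_le[of t s] by (simp add: max_def min_def)
  qed
  have "expectation (\<lambda>\<omega>. (\<Sum>t\<in>J. dev t \<omega>)\<^sup>2) = expectation (\<lambda>\<omega>. \<Sum>t\<in>J. \<Sum>s\<in>J. dev s \<omega> * dev t \<omega>)"
    by (simp add: power2_eq_square sum_product) (simp add: mult.commute)
  also have "\<dots> = (\<Sum>t\<in>J. \<Sum>s\<in>J. expectation (\<lambda>\<omega>. dev s \<omega> * dev t \<omega>))"
    by (simp add: Bochner_Integration.integral_sum sq_integrable_mult sq_integrable_dev)
  also have "\<dots> \<le> (\<Sum>t\<in>J. \<Sum>s\<in>J. 2 * R ^ 4 * \<bar>\<phi>\<bar> ^ (max s t - min s t))"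
    by (intro sum_mono cov)
  also have "\<dots> \<le> (\<Sum>t\<in>J. 2 * R ^ 4 * (2 / (1 - \<bar>\<phi>\<bar>)))"
    unfolding sum_distrib_left[symmetric]
    using R_ge by (intro sum_mono mult_left_mono sum_power_dist_le J \<phi>_abs) auto
  also have "\<dots> = real (card J) * (4 * R ^ 4 * (1 / (1 - \<bar>\<phi>\<bar>)))" by simp
  also have "\<dots> \<le> real (card J) * (4 * R ^ 4 * (2 * R / \<alpha>\<^sup>2))"
    using R_ge by (intro mult_left_mono mixing_time_le) auto
  finally show ?thesis by (simp add: power_numeral_reduce algebra_simps)
qed

subsection \<open>Moments of the autoregression\<close>

lemma \<rho>_bounds: "0 \<le> \<rho>" "\<rho> < 1"
  using c_pos k_ge by (auto simp: \<rho>_def field_simps)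

lemma one_minus_\<rho>_sq: "0 < 1 - \<rho>\<^sup>2" "1 - \<rho>\<^sup>2 \<le> 2 * c / k"
proof -
  have "\<rho>\<^sup>2 < 1" using \<rho>_bounds by (simp add: abs_square_less_1)
  then show "0 < 1 - \<rho>\<^sup>2" by simp
  have "1 - \<rho>\<^sup>2 = (1 - \<rho>) * (1 + \<rho>)" by (simp add: algebra_simps power2_eq_square)
  also have "\<dots> \<le> (c / k) * 2" using \<rho>_bounds by (intro mult_mono) (auto simp: \<rho>_def)
  finally show "1 - \<rho>\<^sup>2 \<le> 2 * c / k" by (simp add: mult.commute)
qed

lemma sq_integrable_innov2: "t \<ge> 1 \<Longrightarrow> sq_integrable (\<lambda>\<omega>. (\<epsilon> t \<omega>)\<^sup>2)"
  using innov_fourth[of t] by (simp add: sq_integrable_def flip: power_mult)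

lemma sq_integrable_innov: "t \<ge> 1 \<Longrightarrow> sq_integrable (\<epsilon> t)"
  using sq_integrable_integrable[OF sq_integrable_innov2] by (simp add: sq_integrable_def)

lemma \<kappa>_nonneg: "\<kappa> \<ge> 0"
  using innov_kurtosis[of 1] by (auto intro!: Bochner_Integration.integral_nonneg simp flip: innov_kurtosis[of 1, simplified])

text \<open>Chosen so that the bound \<open>C * B * k^2\<close> reproduces itself under one step of
  the fourth-moment recursion, which needs \<open>c * k / 2 * C\<close> to be at least
  \<open>32 * k / c + 3 * \<kappa>\<close>. The summand 1 covers the initial value.\<close>

definition C :: real where "C = 1 + 64 / c\<^sup>2 + 6 * \<kappa> / c"

lemma C_ge: "C \<ge> 1"
  using c_pos \<kappa>_nonneg by (simp add: C_def)

text \<open>A weight \<open>G\<close> determined by the volatility path is carried along because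
  \<open>Y\<close> depends on that path; such a weight still factorises from the innovations. The
  step contracts by \<open>\<rho> ^ 4 \<le> 1 - c / k\<close>. Half of the gap \<open>c / k\<close>
  absorbs the mixed term, and the other half turns a forcing of order \<open>k\<close> into the
  order \<open>k^2\<close>. The uses are \<open>G = 1\<close> and a fourth power of a
  volatility.\<close>

lemma weighted_fourth_moment:
  assumes G: "G \<in> borel_measurable (past (- 1))" "\<And>\<omega>. G \<omega> \<ge> 0" "integrable M G" "expectation G \<le> B"
    and Gvol: "\<And>t. integrable M (\<lambda>\<omega>. G \<omega> * vol t \<omega> ^ 4)" "\<And>t. expectation (\<lambda>\<omega>. G \<omega> * vol t \<omega> ^ 4) \<le> B"
  shows "integrable M (\<lambda>\<omega>. G \<omega> * Y t \<omega> ^ 4) \<and> expectation (\<lambda>\<omega>. G \<omega> * Y t \<omega> ^ 4) \<le> C * B * k\<^sup>2"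
proof (induction t)
  case 0
  have g: "(\<lambda>x::real. x ^ 4) \<in> borel_measurable borel" by measurable
  have B: "0 \<le> B" using G by (intro order_trans[OF Bochner_Integration.integral_nonneg G(4)]) auto
  have "expectation (\<lambda>\<omega>. G \<omega> * Z 0 \<omega> ^ 4) \<le> B * k\<^sup>2"
    unfolding expectation_past_mult[OF G(1,3) g init_fourth, simplified]
    using G init_moment B by (intro mult_mono) (auto intro!: Bochner_Integration.integral_nonneg)
  also have "\<dots> \<le> C * (B * k\<^sup>2)" using mult_right_mono[OF C_ge, of "B * k\<^sup>2"] B by simp
  finally show ?case
    using integrable_past_mult[OF G(1,3) g init_fourth, simplified] by (simp add: mult.assoc)
next
  case (Suc t)
  define s e y where "s = vol (Suc t)" and "e = \<epsilon> (Suc t)" and "y = Y t"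
  have B: "0 \<le> B" using G by (intro order_trans[OF Bochner_Integration.integral_nonneg G(4)]) auto
  have meas: "G \<in> borel_measurable (past (int t))" "s \<in> borel_measurable (past (int t))" "y \<in> borel_measurable (past (int t))"
    unfolding s_def y_def by (auto intro!: past_measurable_mono[OF G(1)] vol_past Y_past)
  note measM = meas[THEN past_measurable, measurable]
  have iy: "integrable M (\<lambda>\<omega>. G \<omega> * y \<omega> ^ 4)" and ey: "expectation (\<lambda>\<omega>. G \<omega> * y \<omega> ^ 4) \<le> C * B * k\<^sup>2"
    using Suc by (auto simp: y_def)
  have ivol: "integrable M (\<lambda>\<omega>. G \<omega> * s \<omega> ^ 4)" and es: "expectation (\<lambda>\<omega>. G \<omega> * s \<omega> ^ 4) \<le> B"
    using Gvol by (auto simp: s_def)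
  have max4: "\<bar>a ^ i * b ^ j\<bar> \<le> a ^ 4 + b ^ 4" if "i + j = 4" for i j :: nat and a b :: real
  proof -
    define m where "m = max \<bar>a\<bar> \<bar>b\<bar>"
    have "\<bar>a ^ i * b ^ j\<bar> \<le> m ^ i * m ^ j"
      unfolding abs_mult power_abs by (intro mult_mono power_mono) (auto simp: m_def)
    also have "\<dots> = m ^ 4" using that by (simp flip: power_add)
    also have "\<dots> \<le> a ^ 4 + b ^ 4" by (auto simp: m_def max_def)
    finally show ?thesis .
  qed
  have mixed: "integrable M (\<lambda>\<omega>. G \<omega> * (y \<omega> ^ i * s \<omega> ^ j))" if "i + j = 4" for i j
  proof (rule Bochner_Integration.integrable_bound[OF Bochner_Integration.integrable_add[OF iy ivol]])
    show "AE \<omega> in M. norm (G \<omega> * (y \<omega> ^ i * s \<omega> ^ j)) \<le> norm (G \<omega> * y \<omega> ^ 4 + G \<omega> * s \<omega> ^ 4)"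
    proof (rule AE_I2)
      fix \<omega>
      have "G \<omega> * \<bar>y \<omega> ^ i * s \<omega> ^ j\<bar> \<le> G \<omega> * (y \<omega> ^ 4 + s \<omega> ^ 4)"
        using max4[OF that, of "y \<omega>" "s \<omega>"] G(2) by (intro mult_left_mono) auto
      then show "norm (G \<omega> * (y \<omega> ^ i * s \<omega> ^ j)) \<le> norm (G \<omega> * y \<omega> ^ 4 + G \<omega> * s \<omega> ^ 4)"
        using G(2)[of \<omega>] by (simp add: abs_mult distrib_left)
    qed
  qed measurable
  have e_int: "integrable M e" "integrable M (\<lambda>\<omega>. (e \<omega>)\<^sup>2)" "integrable M (\<lambda>\<omega>. e \<omega> ^ 4)"
    unfolding e_def using sq_integrable_integrable[OF sq_integrable_innov, of "Suc t"]
      sq_integrable_square[OF sq_integrable_innov, of "Suc t"] innov_fourth[of "Suc t"] by auto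
  have lt: "int t < int (Suc t)" by simp
  have m31: "(\<lambda>\<omega>. G \<omega> * (y \<omega> ^ 3 * s \<omega> ^ 1)) \<in> borel_measurable (past (int t))"
    and m22: "(\<lambda>\<omega>. G \<omega> * (y \<omega> ^ 2 * s \<omega> ^ 2)) \<in> borel_measurable (past (int t))"
    and m04: "(\<lambda>\<omega>. G \<omega> * s \<omega> ^ 4) \<in> borel_measurable (past (int t))"
    using meas by measurable
  have g: "(\<lambda>x::real. x) \<in> borel_measurable borel" "(\<lambda>x::real. x\<^sup>2) \<in> borel_measurable borel"
    "(\<lambda>x::real. x ^ 4) \<in> borel_measurable borel" by measurable
  note E1 = integrable_past_mult[OF m31 mixed g(1) e_int(1)[unfolded e_def] lt, folded e_def, simplified]
    expectation_past_mult[OF m31 mixed g(1) e_int(1)[unfolded e_def] lt, folded e_def, simplified]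
  note E2 = integrable_past_mult[OF m22 mixed g(2) e_int(2)[unfolded e_def] lt, folded e_def, simplified]
    expectation_past_mult[OF m22 mixed g(2) e_int(2)[unfolded e_def] lt, folded e_def, simplified]
  note E4 = integrable_past_mult[OF m04 ivol g(3) e_int(3)[unfolded e_def] lt, folded e_def]
    expectation_past_mult[OF m04 ivol g(3) e_int(3)[unfolded e_def] lt, folded e_def]
  have mom: "expectation e = 0" "expectation (\<lambda>\<omega>. (e \<omega>)\<^sup>2) = 1" "expectation (\<lambda>\<omega>. e \<omega> ^ 4) = \<kappa>"
    unfolding e_def using innov_mean[of "Suc t"] innov_square[of "Suc t"] innov_kurtosis[of "Suc t"] by simp_all
  have Y: "Y (Suc t) \<omega> = \<rho> * y \<omega> + s \<omega> * e \<omega>" for \<omega> by (simp add: y_def s_def e_def)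
  \<comment> \<open>The odd term \<open>4 * \<rho> * w * u^3\<close> would bring in the third moment
    of the innovation. It is absorbed pointwise by \<open>2 * w^2 * u^2 + 2 * u^4\<close>, whence
    the coefficients 8 and 3 in place of 6 and 1.\<close>
  have pw: "Y (Suc t) \<omega> ^ 4 \<le> \<rho> ^ 4 * y \<omega> ^ 4 + 4 * \<rho> ^ 3 * (y \<omega> ^ 3 * s \<omega> * e \<omega>)
      + 8 * ((y \<omega>)\<^sup>2 * (s \<omega>)\<^sup>2 * (e \<omega>)\<^sup>2) + 3 * (s \<omega> ^ 4 * e \<omega> ^ 4)" for \<omega>
  proof -
    define w u where "w = y \<omega>" and "u = s \<omega> * e \<omega>"
    have r2: "\<rho>\<^sup>2 \<le> 1" using one_minus_\<rho>_sq by simp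
    have "0 \<le> (w - \<rho> * u)\<^sup>2 + (1 - \<rho>\<^sup>2) * u\<^sup>2" using r2 by simp
    also have "\<dots> = w\<^sup>2 - 2 * \<rho> * w * u + u\<^sup>2" by (simp add: power2_eq_square algebra_simps)
    finally have "0 \<le> 2 * u\<^sup>2 * (w\<^sup>2 - 2 * \<rho> * w * u + u\<^sup>2)" by simp
    moreover have "0 \<le> 6 * (1 - \<rho>\<^sup>2) * (w\<^sup>2 * u\<^sup>2)" using r2 by simp
    moreover have "\<rho> ^ 4 * w ^ 4 + 4 * \<rho> ^ 3 * (w ^ 3 * u) + 8 * (w\<^sup>2 * u\<^sup>2) + 3 * u ^ 4 - (\<rho> * w + u) ^ 4
       = 2 * u\<^sup>2 * (w\<^sup>2 - 2 * \<rho> * w * u + u\<^sup>2) + 6 * (1 - \<rho>\<^sup>2) * (w\<^sup>2 * u\<^sup>2)"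
      by (simp add: power4_eq_xxxx power3_eq_cube power2_eq_square algebra_simps)
    ultimately have "(\<rho> * w + u) ^ 4 \<le> \<rho> ^ 4 * w ^ 4 + 4 * \<rho> ^ 3 * (w ^ 3 * u) + 8 * (w\<^sup>2 * u\<^sup>2) + 3 * u ^ 4"
      by linarith
    then show ?thesis unfolding Y by (simp add: w_def u_def power_mult_distrib mult.assoc)
  qed
  let ?b = "\<lambda>\<omega>. \<rho> ^ 4 * (G \<omega> * y \<omega> ^ 4) + 4 * \<rho> ^ 3 * (G \<omega> * (y \<omega> ^ 3 * s \<omega>) * e \<omega>)
      + 8 * (G \<omega> * ((y \<omega>)\<^sup>2 * (s \<omega>)\<^sup>2) * (e \<omega>)\<^sup>2) + 3 * (G \<omega> * s \<omega> ^ 4 * e \<omega> ^ 4)"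
  have pwG: "G \<omega> * Y (Suc t) \<omega> ^ 4 \<le> ?b \<omega>" for \<omega>
    using mult_left_mono[OF pw[of \<omega>] G(2)[of \<omega>]] by (simp add: algebra_simps)
  have ib: "integrable M ?b" using iy E1(1) E2(1) E4(1) by simp
  have int: "integrable M (\<lambda>\<omega>. G \<omega> * Y (Suc t) \<omega> ^ 4)"
  proof (rule Bochner_Integration.integrable_bound[OF ib])
    show "(\<lambda>\<omega>. G \<omega> * Y (Suc t) \<omega> ^ 4) \<in> borel_measurable M"
      unfolding Y e_def by measurable
    show "AE \<omega> in M. norm (G \<omega> * Y (Suc t) \<omega> ^ 4) \<le> norm (?b \<omega>)"
    proof (rule AE_I2)
      fix \<omega>
      have "0 \<le> G \<omega> * Y (Suc t) \<omega> ^ 4" using G(2) by simp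
      then show "norm (G \<omega> * Y (Suc t) \<omega> ^ 4) \<le> norm (?b \<omega>)"
        using pwG[of \<omega>] by (simp only: real_norm_def)
    qed
  qed
  \<comment> \<open>The weight \<open>c / (2 * k)\<close> is half of the contraction gap;
    \<open>32 * k / c\<close> is then what completes the square.\<close>
  have young: "8 * expectation (\<lambda>\<omega>. G \<omega> * ((y \<omega>)\<^sup>2 * (s \<omega>)\<^sup>2))
     \<le> c / (2 * k) * expectation (\<lambda>\<omega>. G \<omega> * y \<omega> ^ 4) + 32 * k / c * expectation (\<lambda>\<omega>. G \<omega> * s \<omega> ^ 4)"
  proof -
    have "8 * expectation (\<lambda>\<omega>. G \<omega> * ((y \<omega>)\<^sup>2 * (s \<omega>)\<^sup>2)) = expectation (\<lambda>\<omega>. 8 * (G \<omega> * ((y \<omega>)\<^sup>2 * (s \<omega>)\<^sup>2)))"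
      by simp
    also have "\<dots> \<le> expectation (\<lambda>\<omega>. c / (2 * k) * (G \<omega> * y \<omega> ^ 4) + 32 * k / c * (G \<omega> * s \<omega> ^ 4))"
    proof (rule integral_mono)
      fix \<omega>
      define a p q where "a = c / (2 * k)" and "p = (y \<omega>)\<^sup>2" and "q = (s \<omega>)\<^sup>2"
      have a: "a > 0" "32 * k / c = 16 / a" using c_pos k_ge by (auto simp: a_def)
      have "0 \<le> (a * p - 4 * q)\<^sup>2 / a" using a by simp
      also have "\<dots> = a * p\<^sup>2 + 16 / a * q\<^sup>2 - 8 * (p * q)" using a by (simp add: field_simps power2_eq_square)
      finally have "G \<omega> * (8 * (p * q)) \<le> G \<omega> * (a * p\<^sup>2 + 16 / a * q\<^sup>2)"
        using G(2) by (intro mult_left_mono) auto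
      moreover have "p\<^sup>2 = y \<omega> ^ 4" "q\<^sup>2 = s \<omega> ^ 4" by (auto simp: p_def q_def)
      ultimately show "8 * (G \<omega> * ((y \<omega>)\<^sup>2 * (s \<omega>)\<^sup>2)) \<le> c / (2 * k) * (G \<omega> * y \<omega> ^ 4) + 32 * k / c * (G \<omega> * s \<omega> ^ 4)"
        unfolding a(2) a_def[symmetric] p_def q_def by (simp add: algebra_simps)
    qed (use iy ivol mixed[of 2 2] in auto)
    also have "\<dots> = c / (2 * k) * expectation (\<lambda>\<omega>. G \<omega> * y \<omega> ^ 4) + 32 * k / c * expectation (\<lambda>\<omega>. G \<omega> * s \<omega> ^ 4)"
      using iy ivol by simp
    finally show ?thesis .
  qed
  define m where "m = expectation (\<lambda>\<omega>. G \<omega> * y \<omega> ^ 4)"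
  have "expectation (\<lambda>\<omega>. G \<omega> * Y (Suc t) \<omega> ^ 4) \<le> expectation ?b"
    by (rule integral_mono[OF int ib pwG])
  also have "\<dots> = \<rho> ^ 4 * m + 8 * expectation (\<lambda>\<omega>. G \<omega> * ((y \<omega>)\<^sup>2 * (s \<omega>)\<^sup>2)) + 3 * (expectation (\<lambda>\<omega>. G \<omega> * s \<omega> ^ 4) * \<kappa>)"
    using iy E1 E2 E4 mom by (simp add: m_def)
  also have "\<dots> \<le> \<rho> * m + (c / (2 * k) * m + 32 * k / c * B) + 3 * (B * \<kappa>)"
  proof (intro add_mono mult_left_mono mult_right_mono)
    show "\<rho> ^ 4 \<le> \<rho>" using power_decreasing[of 1 4 \<rho>] \<rho>_bounds by simp
    have "32 * k / c * expectation (\<lambda>\<omega>. G \<omega> * s \<omega> ^ 4) \<le> 32 * k / c * B"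
      using es c_pos k_ge by (intro mult_left_mono) auto
    with young show "8 * expectation (\<lambda>\<omega>. G \<omega> * ((y \<omega>)\<^sup>2 * (s \<omega>)\<^sup>2)) \<le> c / (2 * k) * m + 32 * k / c * B"
      unfolding m_def by linarith
    show "0 \<le> m" unfolding m_def using G(2) by (intro Bochner_Integration.integral_nonneg) auto
  qed (use es \<kappa>_nonneg in auto)
  also have "\<dots> = (1 - c / (2 * k)) * m + (32 * k / c + 3 * \<kappa>) * B"
    using k_ge by (simp add: \<rho>_def field_simps)
  also have "\<dots> \<le> (1 - c / (2 * k)) * (C * B * k\<^sup>2) + (c * k / 2 * C) * B"
  proof (intro add_mono mult_left_mono mult_right_mono B)
    show "m \<le> C * B * k\<^sup>2" using ey by (simp add: m_def)
    show "0 \<le> 1 - c / (2 * k)" using c_pos k_ge by (simp add: field_simps)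
    have "c * k / 2 * C = c * k / 2 + 32 * k / c + 3 * \<kappa> * k"
      using c_pos by (simp add: C_def field_simps power2_eq_square)
    moreover have "3 * \<kappa> * 1 \<le> 3 * \<kappa> * k" using \<kappa>_nonneg k_ge by (intro mult_left_mono) auto
    moreover have "0 \<le> c * k / 2" using c_pos k_ge by simp
    ultimately show "32 * k / c + 3 * \<kappa> \<le> c * k / 2 * C" by linarith
  qed
  also have "\<dots> = C * B * k\<^sup>2" using k_ge by (simp add: field_simps power2_eq_square)
  finally show ?case using int by simp
qed

text \<open>Its square bounds fourth moments, so it bounds second moments itself, both of
  \<open>Y\<close> and of \<open>Y\<close> times a volatility. The factor \<open>k\<close> is the
  order of the stationary variance for a fixed volatility law.\<close>

definition K2 :: real where "K2 = sqrt C * R ^ 4 * k"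

lemma K2_sq: "K2\<^sup>2 = C * R ^ 8 * k\<^sup>2"
  using C_ge by (simp add: K2_def power_mult_distrib flip: power_mult)

lemma K2_pos: "K2 > 0"
  using C_ge R_ge k_ge by (simp add: K2_def)

lemma
  shows integrable_Y4: "integrable M (\<lambda>\<omega>. Y t \<omega> ^ 4)"
    and expectation_Y4: "expectation (\<lambda>\<omega>. Y t \<omega> ^ 4) \<le> K2\<^sup>2"
proof -
  have "R\<^sup>2 \<le> R ^ 8" using R_ge by (intro power_increasing) auto
  then have 1: "expectation (\<lambda>\<omega>. 1 * vol t \<omega> ^ 4) \<le> R ^ 8" for t using expectation_vol4_le[of t] by simp
  have 2: "integrable M (\<lambda>\<omega>. 1 * vol t \<omega> ^ 4)" for t using integrable_vol_power[of t 4] by simp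
  have "integrable M (\<lambda>\<omega>. 1 * Y t \<omega> ^ 4) \<and> expectation (\<lambda>\<omega>. 1 * Y t \<omega> ^ 4) \<le> C * R ^ 8 * k\<^sup>2"
    by (rule weighted_fourth_moment[OF _ _ _ _ 2 1]) (use R_ge in \<open>auto simp: prob_space\<close>)
  then show "integrable M (\<lambda>\<omega>. Y t \<omega> ^ 4)" "expectation (\<lambda>\<omega>. Y t \<omega> ^ 4) \<le> K2\<^sup>2"
    by (auto simp: K2_sq)
qed

lemma
  shows integrable_Y4_vol4: "integrable M (\<lambda>\<omega>. Y t \<omega> ^ 4 * vol s \<omega> ^ 4)"
    and expectation_Y4_vol4: "expectation (\<lambda>\<omega>. Y t \<omega> ^ 4 * vol s \<omega> ^ 4) \<le> K2\<^sup>2"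
proof -
  have "R\<^sup>2 \<le> R ^ 8" using R_ge by (intro power_increasing) auto
  then have 1: "expectation (\<lambda>\<omega>. vol s \<omega> ^ 4) \<le> R ^ 8" using expectation_vol4_le[of s] by linarith
  have 2: "(\<lambda>\<omega>. vol s \<omega> ^ 4) \<in> borel_measurable (past (- 1))"
    using vol_past[of "- 1" s] by measurable
  have "integrable M (\<lambda>\<omega>. vol s \<omega> ^ 4 * Y t \<omega> ^ 4) \<and> expectation (\<lambda>\<omega>. vol s \<omega> ^ 4 * Y t \<omega> ^ 4) \<le> C * R ^ 8 * k\<^sup>2"
    by (rule weighted_fourth_moment[OF 2 _ integrable_vol_power 1 integrable_vol44 expectation_vol44_le]) simp
  then show "integrable M (\<lambda>\<omega>. Y t \<omega> ^ 4 * vol s \<omega> ^ 4)" "expectation (\<lambda>\<omega>. Y t \<omega> ^ 4 * vol s \<omega> ^ 4) \<le> K2\<^sup>2"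
    by (auto simp: K2_sq mult.commute)
qed

lemma sq_integrable_Y2: "sq_integrable (\<lambda>\<omega>. (Y t \<omega>)\<^sup>2)"
  using integrable_Y4[of t] by (simp add: sq_integrable_def flip: power_mult)

lemma sq_integrable_Y: "sq_integrable (Y t)"
  using sq_integrable_integrable[OF sq_integrable_Y2] by (simp add: sq_integrable_def)

lemma expectation_Y2: "expectation (\<lambda>\<omega>. (Y t \<omega>)\<^sup>2) \<le> K2"
proof -
  have "expectation (\<lambda>\<omega>. (Y t \<omega>)\<^sup>2) \<le> sqrt (expectation (\<lambda>\<omega>. Y t \<omega> ^ 4))"
    using expectation_square_le[OF sq_integrable_Y2[of t]] by (simp flip: power_mult)
  also have "\<dots> \<le> sqrt (K2\<^sup>2)" by (intro real_sqrt_le_mono expectation_Y4)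
  finally show ?thesis using K2_pos by simp
qed

lemma sq_integrable_Y2_vol2: "sq_integrable (\<lambda>\<omega>. (Y t \<omega> * vol s \<omega>)\<^sup>2)"
  using integrable_Y4_vol4[of t s] by (simp add: sq_integrable_def power_mult_distrib flip: power_mult)

lemma sq_integrable_Y_vol: "sq_integrable (\<lambda>\<omega>. Y t \<omega> * vol s \<omega>)"
  using sq_integrable_integrable[OF sq_integrable_Y2_vol2] by (simp add: sq_integrable_def)

lemma expectation_Y2_vol2: "expectation (\<lambda>\<omega>. (Y t \<omega> * vol s \<omega>)\<^sup>2) \<le> K2"
proof -
  have "expectation (\<lambda>\<omega>. (Y t \<omega> * vol s \<omega>)\<^sup>2) \<le> sqrt (expectation (\<lambda>\<omega>. Y t \<omega> ^ 4 * vol s \<omega> ^ 4))"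
    using expectation_square_le[OF sq_integrable_Y2_vol2[of t s]] by (simp add: power_mult_distrib flip: power_mult)
  also have "\<dots> \<le> sqrt (K2\<^sup>2)" by (intro real_sqrt_le_mono expectation_Y4_vol4)
  finally show ?thesis using K2_pos by simp
qed

section \<open>Martingale errors and the denominator of the estimator\<close>

lemma innov2_centered:
  assumes "t \<ge> 1"
  shows "sq_integrable (\<lambda>\<omega>. (\<epsilon> t \<omega>)\<^sup>2 - 1)" "expectation (\<lambda>\<omega>. (\<epsilon> t \<omega>)\<^sup>2 - 1) = 0"
    "expectation (\<lambda>\<omega>. ((\<epsilon> t \<omega>)\<^sup>2 - 1)\<^sup>2) = \<kappa> - 1"
proof -
  note sq = sq_integrable_innov2[OF assms]
  have int: "integrable M (\<lambda>\<omega>. (\<epsilon> t \<omega>)\<^sup>2)" by (rule sq_integrable_integrable[OF sq])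
  show "sq_integrable (\<lambda>\<omega>. (\<epsilon> t \<omega>)\<^sup>2 - 1)"
    by (rule sq_integrable_diff[OF sq sq_integrable_const])
  show "expectation (\<lambda>\<omega>. (\<epsilon> t \<omega>)\<^sup>2 - 1) = 0"
    using int innov_square[OF assms] by (simp add: prob_space)
  have "expectation (\<lambda>\<omega>. ((\<epsilon> t \<omega>)\<^sup>2 - 1)\<^sup>2) = expectation (\<lambda>\<omega>. \<epsilon> t \<omega> ^ 4 - 2 * (\<epsilon> t \<omega>)\<^sup>2 + 1)"
    by (simp add: power2_diff algebra_simps flip: power_mult)
  then show "expectation (\<lambda>\<omega>. ((\<epsilon> t \<omega>)\<^sup>2 - 1)\<^sup>2) = \<kappa> - 1"
    using int innov_fourth[OF assms] innov_square[OF assms] innov_kurtosis[OF assms] by (simp add: prob_space)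
qed

text \<open>The estimation error is \<open>N n / D n\<close>. Summation starts at 0, so that in
  summand \<open>t\<close> the factor in front of \<open>\<epsilon> (Suc t)\<close> is known at time
  \<open>t\<close>.\<close>

definition N :: "nat \<Rightarrow> 'a \<Rightarrow> real" where
  "N n \<omega> = (\<Sum>t<n. Y t \<omega> * vol (Suc t) \<omega> * \<epsilon> (Suc t) \<omega>)"

definition D :: "nat \<Rightarrow> 'a \<Rightarrow> real" where
  "D n \<omega> = (\<Sum>t<n. (Y t \<omega>)\<^sup>2)"

lemma Y_vol_past: "(\<lambda>\<omega>. Y t \<omega> * vol s \<omega>) \<in> borel_measurable (past (int t))"
  using Y_past[of t "int t"] vol_past[of "int t" s] by measurable

lemma sq_integrable_N: "sq_integrable (N n)"
  and expectation_N_sq: "expectation (\<lambda>\<omega>. (N n \<omega>)\<^sup>2) \<le> n * K2"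
proof -
  note * = martingale_transform_L2[of n "\<lambda>t \<omega>. Y t \<omega> * vol (Suc t) \<omega>" "\<lambda>x. x" 1, OF Y_vol_past sq_integrable_Y_vol _ sq_integrable_innov innov_mean innov_square]
  show "sq_integrable (N n)" using *(1) by (simp add: N_def[abs_def])
  have "expectation (\<lambda>\<omega>. (N n \<omega>)\<^sup>2) = (\<Sum>t<n. expectation (\<lambda>\<omega>. (Y t \<omega> * vol (Suc t) \<omega>)\<^sup>2))"
    using *(2) by (simp add: N_def[abs_def])
  also have "\<dots> \<le> (\<Sum>t<n. K2)" by (intro sum_mono expectation_Y2_vol2)
  finally show "expectation (\<lambda>\<omega>. (N n \<omega>)\<^sup>2) \<le> n * K2" by simp
qed

lemma expectation_abs_N: "expectation (\<lambda>\<omega>. \<bar>N n \<omega>\<bar>) \<le> sqrt (n * K2)"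
  by (rule order_trans[OF expectation_square_le[OF sq_integrable_N] real_sqrt_le_mono[OF expectation_N_sq]])

text \<open>The error of replacing squared innovations by their mean 1 in the sum of squared
  disturbances; \<open>quad_err\<close> is the counterpart for the quadratic variation. Both are
  martingale transforms, hence of square-root size in \<open>n\<close>.\<close>

definition squares_err :: "nat \<Rightarrow> 'a \<Rightarrow> real" where
  "squares_err n \<omega> = (\<Sum>t<n. (vol (Suc t) \<omega>)\<^sup>2 * ((\<epsilon> (Suc t) \<omega>)\<^sup>2 - 1))"

definition quad_err :: "nat \<Rightarrow> 'a \<Rightarrow> real" where
  "quad_err n \<omega> = (\<Sum>t<n. (Y t \<omega> * vol (Suc t) \<omega>)\<^sup>2 * ((\<epsilon> (Suc t) \<omega>)\<^sup>2 - 1))"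

lemma sq_integrable_squares_err: "sq_integrable (squares_err n)"
  and expectation_squares_err: "expectation (\<lambda>\<omega>. \<bar>squares_err n \<omega>\<bar>) \<le> sqrt (\<kappa> * (n * R\<^sup>2))"
proof -
  have past: "(\<lambda>\<omega>. (vol (Suc t) \<omega>)\<^sup>2) \<in> borel_measurable (past (int t))" for t
    using vol_past[of "int t" "Suc t"] by measurable
  have g: "(\<lambda>x::real. x\<^sup>2 - 1) \<in> borel_measurable borel" by measurable
  note * = martingale_transform_L2[of n "\<lambda>t \<omega>. (vol (Suc t) \<omega>)\<^sup>2" "\<lambda>x. x\<^sup>2 - 1" "\<kappa> - 1", OF past sq_integrable_vol2 g innov2_centered]
  show 1: "sq_integrable (squares_err n)" using *(1) by (simp add: squares_err_def[abs_def])
  have "expectation (\<lambda>\<omega>. (squares_err n \<omega>)\<^sup>2) = (\<kappa> - 1) * (\<Sum>t<n. expectation (\<lambda>\<omega>. vol (Suc t) \<omega> ^ 4))"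
    using *(2) by (simp add: squares_err_def[abs_def] flip: power_mult)
  also have "\<dots> \<le> \<kappa> * (\<Sum>t<n. R\<^sup>2)"
    using \<kappa>_nonneg by (intro mult_mono sum_mono expectation_vol4_le sum_nonneg Bochner_Integration.integral_nonneg) auto
  finally have "expectation (\<lambda>\<omega>. (squares_err n \<omega>)\<^sup>2) \<le> \<kappa> * (n * R\<^sup>2)" by simp
  then show "expectation (\<lambda>\<omega>. \<bar>squares_err n \<omega>\<bar>) \<le> sqrt (\<kappa> * (n * R\<^sup>2))"
    by (intro order_trans[OF expectation_square_le[OF 1]] real_sqrt_le_mono)
qed

lemma sq_integrable_quad_err: "sq_integrable (quad_err n)"
  and expectation_quad_err: "expectation (\<lambda>\<omega>. \<bar>quad_err n \<omega>\<bar>) \<le> sqrt (\<kappa> * (n * K2\<^sup>2))"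
proof -
  have past: "(\<lambda>\<omega>. (Y t \<omega> * vol (Suc t) \<omega>)\<^sup>2) \<in> borel_measurable (past (int t))" for t
    using Y_vol_past[of t "Suc t"] by measurable
  have g: "(\<lambda>x::real. x\<^sup>2 - 1) \<in> borel_measurable borel" by measurable
  note * = martingale_transform_L2[of n "\<lambda>t \<omega>. (Y t \<omega> * vol (Suc t) \<omega>)\<^sup>2" "\<lambda>x. x\<^sup>2 - 1" "\<kappa> - 1", OF past sq_integrable_Y2_vol2 g innov2_centered]
  show 1: "sq_integrable (quad_err n)" using *(1) by (simp add: quad_err_def[abs_def])
  have "expectation (\<lambda>\<omega>. (quad_err n \<omega>)\<^sup>2) = (\<kappa> - 1) * (\<Sum>t<n. expectation (\<lambda>\<omega>. Y t \<omega> ^ 4 * vol (Suc t) \<omega> ^ 4))"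
    using *(2) by (simp add: quad_err_def[abs_def] power_mult_distrib flip: power_mult)
  also have "\<dots> \<le> \<kappa> * (\<Sum>t<n. K2\<^sup>2)"
    using \<kappa>_nonneg by (intro mult_mono sum_mono expectation_Y4_vol4 sum_nonneg Bochner_Integration.integral_nonneg) auto
  finally have "expectation (\<lambda>\<omega>. (quad_err n \<omega>)\<^sup>2) \<le> \<kappa> * (n * K2\<^sup>2)" by simp
  then show "expectation (\<lambda>\<omega>. \<bar>quad_err n \<omega>\<bar>) \<le> sqrt (\<kappa> * (n * K2\<^sup>2))"
    by (intro order_trans[OF expectation_square_le[OF 1]] real_sqrt_le_mono)
qed

lemma D_identity:
  "(1 - \<rho>\<^sup>2) * D n \<omega> - n * T
   = squares_err n \<omega> + (\<Sum>t\<in>{1..n}. dev t \<omega>) + 2 * \<rho> * N n \<omega> + (Y 0 \<omega>)\<^sup>2 - (Y n \<omega>)\<^sup>2"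
proof (induction n)
  case (Suc n)
  have sq: "(Y (Suc n) \<omega>)\<^sup>2 = \<rho>\<^sup>2 * (Y n \<omega>)\<^sup>2 + 2 * \<rho> * (Y n \<omega> * vol (Suc n) \<omega> * \<epsilon> (Suc n) \<omega>)
      + (vol (Suc n) \<omega>)\<^sup>2 * (\<epsilon> (Suc n) \<omega>)\<^sup>2"
    by (simp add: power2_eq_square algebra_simps)
  have steps: "N (Suc n) \<omega> = N n \<omega> + Y n \<omega> * vol (Suc n) \<omega> * \<epsilon> (Suc n) \<omega>"
    "squares_err (Suc n) \<omega> = squares_err n \<omega> + (vol (Suc n) \<omega>)\<^sup>2 * ((\<epsilon> (Suc n) \<omega>)\<^sup>2 - 1)"
    "(\<Sum>t\<in>{1..Suc n}. dev t \<omega>) = (\<Sum>t\<in>{1..n}. dev t \<omega>) + ((vol (Suc n) \<omega>)\<^sup>2 - T)"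
    by (simp_all add: N_def squares_err_def dev_def)
  have "(1 - \<rho>\<^sup>2) * D (Suc n) \<omega> - Suc n * T = ((1 - \<rho>\<^sup>2) * D n \<omega> - n * T) + (1 - \<rho>\<^sup>2) * (Y n \<omega>)\<^sup>2 - T"
    by (simp add: D_def algebra_simps)
  also note Suc.IH
  finally show ?case
    unfolding steps sq by (simp add: algebra_simps)
qed (simp add: D_def N_def squares_err_def)

text \<open>The summands bound, in order, \<open>squares_err\<close>, the sum of \<open>dev\<close>,
  twice \<open>N\<close>, and the two boundary squares of \<open>D_identity\<close>.\<close>

definition D_bound :: "nat \<Rightarrow> real" where
  "D_bound n = sqrt (\<kappa> * (n * R\<^sup>2)) + sqrt (n * (8 * R ^ 5 / \<alpha>\<^sup>2)) + 2 * sqrt (n * K2) + 2 * K2"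

lemma integrable_D: "integrable M (D n)"
  unfolding D_def[abs_def] using sq_integrable_Y by (auto simp: sq_integrable_def)

lemma expectation_D: "expectation (\<lambda>\<omega>. \<bar>(1 - \<rho>\<^sup>2) * D n \<omega> - n * T\<bar>) \<le> D_bound n"
proof -
  let ?S = "\<lambda>\<omega>. \<Sum>t\<in>{1..n}. dev t \<omega>"
  have S: "sq_integrable ?S" by (rule sq_integrable_sum) (rule sq_integrable_dev)
  have ES: "expectation (\<lambda>\<omega>. \<bar>?S \<omega>\<bar>) \<le> sqrt (n * (8 * R ^ 5 / \<alpha>\<^sup>2))"
    using sum_dev_sq_le[of "{1..n}"]
    by (intro order_trans[OF expectation_square_le[OF S]] real_sqrt_le_mono) simp
  have ints: "integrable M (squares_err n)" "integrable M ?S" "integrable M (N n)"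
    "integrable M (\<lambda>\<omega>. (Y 0 \<omega>)\<^sup>2)" "integrable M (\<lambda>\<omega>. (Y n \<omega>)\<^sup>2)"
    by (rule sq_integrable_integrable[OF sq_integrable_squares_err] sq_integrable_integrable[OF S]
        sq_integrable_integrable[OF sq_integrable_N] sq_integrable_integrable[OF sq_integrable_Y2])+
  have "expectation (\<lambda>\<omega>. \<bar>(1 - \<rho>\<^sup>2) * D n \<omega> - n * T\<bar>)
     \<le> expectation (\<lambda>\<omega>. \<bar>squares_err n \<omega>\<bar> + \<bar>?S \<omega>\<bar> + 2 * \<bar>N n \<omega>\<bar> + (Y 0 \<omega>)\<^sup>2 + (Y n \<omega>)\<^sup>2)"
  proof (rule integral_mono)
    fix \<omega>
    have "\<bar>2 * \<rho> * N n \<omega>\<bar> \<le> 2 * \<bar>N n \<omega>\<bar>"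
      using \<rho>_bounds mult_right_mono[of \<rho> 1 "\<bar>N n \<omega>\<bar>"] by (simp add: abs_mult)
    moreover have "0 \<le> (Y 0 \<omega>)\<^sup>2" "0 \<le> (Y n \<omega>)\<^sup>2" by auto
    ultimately show "\<bar>(1 - \<rho>\<^sup>2) * D n \<omega> - n * T\<bar>
       \<le> \<bar>squares_err n \<omega>\<bar> + \<bar>?S \<omega>\<bar> + 2 * \<bar>N n \<omega>\<bar> + (Y 0 \<omega>)\<^sup>2 + (Y n \<omega>)\<^sup>2"
      unfolding D_identity by linarith
  qed (use ints integrable_D in \<open>auto simp del: Y.simps\<close>)
  also have "\<dots> = expectation (\<lambda>\<omega>. \<bar>squares_err n \<omega>\<bar>) + expectation (\<lambda>\<omega>. \<bar>?S \<omega>\<bar>) + 2 * expectation (\<lambda>\<omega>. \<bar>N n \<omega>\<bar>)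
     + expectation (\<lambda>\<omega>. (Y 0 \<omega>)\<^sup>2) + expectation (\<lambda>\<omega>. (Y n \<omega>)\<^sup>2)"
    using ints by (simp del: Y.simps)
  also have "\<dots> \<le> D_bound n"
    unfolding D_bound_def
    using ES expectation_squares_err[of n] expectation_abs_N[of n] expectation_Y2[of 0] expectation_Y2[of n] by linarith
  finally show ?thesis .
qed

text \<open>Up to powers of \<open>R\<close> this is of order \<open>k\<close>, whereas the bound
  for the second moment of \<open>Y^2\<close> itself is of order \<open>k^2\<close>: a single step
  changes \<open>Y^2\<close> comparatively little, which makes freezing possible. The factor 3 comes
  from squaring a sum of three terms.\<close>

definition K5 :: real where "K5 = 3 * ((2 * c / k)\<^sup>2 * K2\<^sup>2 + 4 * K2 + \<kappa> * R\<^sup>2)"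

lemma sq_integrable_Y2_increment: "sq_integrable (\<lambda>\<omega>. (Y (Suc t) \<omega>)\<^sup>2 - (Y t \<omega>)\<^sup>2)"
  by (rule sq_integrable_diff[OF sq_integrable_Y2 sq_integrable_Y2])

lemma expectation_Y2_increment: "expectation (\<lambda>\<omega>. ((Y (Suc t) \<omega>)\<^sup>2 - (Y t \<omega>)\<^sup>2)\<^sup>2) \<le> K5"
proof -
  let ?s = "vol (Suc t)" and ?e = "\<epsilon> (Suc t)"
  have lt: "int t < int (Suc t)" by simp
  have g: "(\<lambda>x::real. x) \<in> borel_measurable borel" "(\<lambda>x::real. x\<^sup>2) \<in> borel_measurable borel" by measurable
  have vp: "(\<lambda>\<omega>. (?s \<omega>)\<^sup>2) \<in> borel_measurable (past (int t))"
    using vol_past[of "int t" "Suc t"] by measurable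
  note A = sq_integrable_past_mult[OF Y_vol_past sq_integrable_Y_vol g(1) sq_integrable_innov lt, of "Suc t", simplified]
  note B = sq_integrable_past_mult[OF vp sq_integrable_vol2 g(2) sq_integrable_innov2 lt, simplified]
  have iA: "integrable M (\<lambda>\<omega>. (Y t \<omega> * ?s \<omega> * ?e \<omega>)\<^sup>2)" and iB: "integrable M (\<lambda>\<omega>. ((?s \<omega>)\<^sup>2 * (?e \<omega>)\<^sup>2)\<^sup>2)"
    using A(1) B(1) by (auto simp: sq_integrable_def)
  have EA: "expectation (\<lambda>\<omega>. (Y t \<omega> * ?s \<omega> * ?e \<omega>)\<^sup>2) \<le> K2"
    using A(2) innov_square[of "Suc t"] expectation_Y2_vol2[of t "Suc t"] by simp
  have EB: "expectation (\<lambda>\<omega>. ((?s \<omega>)\<^sup>2 * (?e \<omega>)\<^sup>2)\<^sup>2) \<le> R\<^sup>2 * \<kappa>"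
    using B(2) innov_kurtosis[of "Suc t"] expectation_vol4_le[of "Suc t"] \<kappa>_nonneg
    by (simp add: mult_right_mono flip: power_mult)
  have r: "(1 - \<rho>\<^sup>2)\<^sup>2 \<le> (2 * c / k)\<^sup>2" using one_minus_\<rho>_sq by (intro power_mono) auto
  have "expectation (\<lambda>\<omega>. ((Y (Suc t) \<omega>)\<^sup>2 - (Y t \<omega>)\<^sup>2)\<^sup>2)
     \<le> expectation (\<lambda>\<omega>. 3 * ((2 * c / k)\<^sup>2 * Y t \<omega> ^ 4 + 4 * (Y t \<omega> * ?s \<omega> * ?e \<omega>)\<^sup>2 + ((?s \<omega>)\<^sup>2 * (?e \<omega>)\<^sup>2)\<^sup>2))"
  proof (rule integral_mono)
    fix \<omega>
    define p q w where "p = (1 - \<rho>\<^sup>2) * (Y t \<omega>)\<^sup>2" and "q = 2 * \<rho> * (Y t \<omega> * ?s \<omega> * ?e \<omega>)" and "w = (?s \<omega>)\<^sup>2 * (?e \<omega>)\<^sup>2"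
    have incr: "(Y (Suc t) \<omega>)\<^sup>2 - (Y t \<omega>)\<^sup>2 = q + w - p"
      by (simp add: p_def q_def w_def power2_eq_square algebra_simps)
    have "(q + w - p)\<^sup>2 \<le> 3 * (p\<^sup>2 + q\<^sup>2 + w\<^sup>2)"
    proof -
      have "0 \<le> (q - w)\<^sup>2 + (q + p)\<^sup>2 + (w + p)\<^sup>2" by simp
      then show ?thesis by (simp add: power2_eq_square algebra_simps)
    qed
    moreover have "p\<^sup>2 \<le> (2 * c / k)\<^sup>2 * Y t \<omega> ^ 4"
      unfolding p_def power_mult_distrib using mult_right_mono[OF r, of "Y t \<omega> ^ 4"] by (simp flip: power_mult)
    moreover have "q\<^sup>2 \<le> 4 * (Y t \<omega> * ?s \<omega> * ?e \<omega>)\<^sup>2"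
    proof -
      have "\<rho>\<^sup>2 \<le> 1" using one_minus_\<rho>_sq by simp
      then have "\<rho>\<^sup>2 * (Y t \<omega> * ?s \<omega> * ?e \<omega>)\<^sup>2 \<le> 1 * (Y t \<omega> * ?s \<omega> * ?e \<omega>)\<^sup>2"
        by (intro mult_right_mono) auto
      then show ?thesis by (simp add: q_def power_mult_distrib)
    qed
    ultimately show "((Y (Suc t) \<omega>)\<^sup>2 - (Y t \<omega>)\<^sup>2)\<^sup>2
      \<le> 3 * ((2 * c / k)\<^sup>2 * Y t \<omega> ^ 4 + 4 * (Y t \<omega> * ?s \<omega> * ?e \<omega>)\<^sup>2 + ((?s \<omega>)\<^sup>2 * (?e \<omega>)\<^sup>2)\<^sup>2)"
      unfolding incr w_def[symmetric] by (elim order_trans) (intro mult_left_mono add_mono; simp)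
  qed (use sq_integrable_square[OF sq_integrable_Y2_increment] iA iB integrable_Y4 in \<open>auto simp del: Y.simps\<close>)
  also have "\<dots> = 3 * ((2 * c / k)\<^sup>2 * expectation (\<lambda>\<omega>. Y t \<omega> ^ 4) + 4 * expectation (\<lambda>\<omega>. (Y t \<omega> * ?s \<omega> * ?e \<omega>)\<^sup>2)
      + expectation (\<lambda>\<omega>. ((?s \<omega>)\<^sup>2 * (?e \<omega>)\<^sup>2)\<^sup>2))"
    using iA iB integrable_Y4[of t] by simp
  also have "\<dots> \<le> K5"
    unfolding K5_def using EA EB mult_left_mono[OF expectation_Y4[of t], of "(2 * c / k)\<^sup>2"]
    by (simp add: mult.commute)
  finally show ?thesis .
qed

subsection \<open>Law of large numbers for the conditional variance\<close>

text \<open>The second error in the quadratic variation: squared innovations have been replaced by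
  1, and the squared volatility is to be replaced by \<open>T\<close>.\<close>

definition quad_dev :: "nat \<Rightarrow> 'a \<Rightarrow> real" where
  "quad_dev n \<omega> = (\<Sum>t<n. (Y t \<omega>)\<^sup>2 * dev (Suc t) \<omega>)"

text \<open>Since \<open>Y s\<close> and the deviations share the volatility path, they are
  separated by Cauchy-Schwarz and not by independence. A sum of at most \<open>b\<close> deviations
  has size \<open>sqrt b\<close>, not \<open>b\<close>, and this is the whole gain.\<close>

lemma expectation_Y2_dev_sum:
  fixes b :: nat
  assumes J: "finite J" "card J \<le> b"
  shows "integrable M (\<lambda>\<omega>. (Y s \<omega>)\<^sup>2 * (\<Sum>t\<in>J. dev t \<omega>))"
    and "expectation (\<lambda>\<omega>. \<bar>(Y s \<omega>)\<^sup>2 * (\<Sum>t\<in>J. dev t \<omega>)\<bar>) \<le> sqrt (K2\<^sup>2 * (b * (8 * R ^ 5 / \<alpha>\<^sup>2)))"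
proof -
  have S: "sq_integrable (\<lambda>\<omega>. \<Sum>t\<in>J. dev t \<omega>)" by (rule sq_integrable_sum) (rule sq_integrable_dev)
  show "integrable M (\<lambda>\<omega>. (Y s \<omega>)\<^sup>2 * (\<Sum>t\<in>J. dev t \<omega>))"
    by (rule sq_integrable_mult[OF sq_integrable_Y2 S])
  have Y4: "expectation (\<lambda>\<omega>. ((Y s \<omega>)\<^sup>2)\<^sup>2) \<le> K2\<^sup>2"
    using expectation_Y4[of s] by (simp flip: power_mult)
  have "real (card J) * (8 * R ^ 5 / \<alpha>\<^sup>2) \<le> b * (8 * R ^ 5 / \<alpha>\<^sup>2)"
    using J R_ge by (intro mult_right_mono) auto
  then have dev: "expectation (\<lambda>\<omega>. (\<Sum>t\<in>J. dev t \<omega>)\<^sup>2) \<le> b * (8 * R ^ 5 / \<alpha>\<^sup>2)"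
    using sum_dev_sq_le[OF J(1)] by linarith
  show "expectation (\<lambda>\<omega>. \<bar>(Y s \<omega>)\<^sup>2 * (\<Sum>t\<in>J. dev t \<omega>)\<bar>) \<le> sqrt (K2\<^sup>2 * (b * (8 * R ^ 5 / \<alpha>\<^sup>2)))"
    by (intro order_trans[OF Cauchy_Schwarz[OF sq_integrable_Y2 S]] real_sqrt_le_mono mult_mono Y4 dev
        Bochner_Integration.integral_nonneg) auto
qed

lemma expectation_increment_dev:
  shows "integrable M (\<lambda>\<omega>. ((Y (Suc j) \<omega>)\<^sup>2 - (Y j \<omega>)\<^sup>2) * dev t \<omega>)"
    and "expectation (\<lambda>\<omega>. \<bar>((Y (Suc j) \<omega>)\<^sup>2 - (Y j \<omega>)\<^sup>2) * dev t \<omega>\<bar>) \<le> sqrt (K5 * (2 * R ^ 4))"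
proof -
  show "integrable M (\<lambda>\<omega>. ((Y (Suc j) \<omega>)\<^sup>2 - (Y j \<omega>)\<^sup>2) * dev t \<omega>)"
    by (rule sq_integrable_mult[OF sq_integrable_Y2_increment sq_integrable_dev])
  have "expectation (\<lambda>\<omega>. (dev t \<omega>)\<^sup>2) \<le> 2 * R ^ 4"
    using cov_dev_le[of t t] by (simp add: power2_eq_square)
  then show "expectation (\<lambda>\<omega>. \<bar>((Y (Suc j) \<omega>)\<^sup>2 - (Y j \<omega>)\<^sup>2) * dev t \<omega>\<bar>) \<le> sqrt (K5 * (2 * R ^ 4))"
    using expectation_Y2_increment[of j]
    by (intro order_trans[OF Cauchy_Schwarz[OF sq_integrable_Y2_increment sq_integrable_dev]]
        real_sqrt_le_mono mult_mono order_trans[OF Bochner_Integration.integral_nonneg expectation_Y2_increment]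
        Bochner_Integration.integral_nonneg) auto
qed

text \<open>Within blocks of length \<open>b\<close>, long compared with the mixing time of the volatility but short
  compared with \<open>k\<close>, the square of \<open>Y\<close> is frozen at the start of the block while the deviations
  \<open>dev\<close> average out.\<close>

lemma expectation_quad_dev:
  fixes b n :: nat
  assumes b: "b \<ge> 1"
  shows "integrable M (quad_dev n)"
    and "expectation (\<lambda>\<omega>. \<bar>quad_dev n \<omega>\<bar>)
      \<le> (real n / b + 1) * sqrt (K2\<^sup>2 * (b * (8 * R ^ 5 / \<alpha>\<^sup>2))) + n * (b * sqrt (K5 * (2 * R ^ 4)))"
proof -
  \<comment> \<open>Shifted by \<open>Suc\<close> because \<open>Y t\<close> meets the deviation at
    time \<open>t + 1\<close>.\<close>
  define J where "J i = Suc ` {t \<in> {..<n}. t div b = i}" for i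
  define base where "base t = b * (t div b)" for t
  define A where "A \<omega> = (\<Sum>i\<le>n div b. (Y (b * i) \<omega>)\<^sup>2 * (\<Sum>t\<in>J i. dev t \<omega>))" for \<omega>
  define B where "B \<omega> = (\<Sum>t<n. \<Sum>j=base t..<t. ((Y (Suc j) \<omega>)\<^sup>2 - (Y j \<omega>)\<^sup>2) * dev (Suc t) \<omega>)" for \<omega>
  have fin: "finite (J i)" for i by (simp add: J_def)
  have card: "card (J i) \<le> b" for i
  proof -
    have "{t \<in> {..<n}. t div b = i} \<subseteq> {b * i..<b * i + b}"
      using b dividend_less_times_div[of b] by (auto simp: add.commute)
    then have "card {t \<in> {..<n}. t div b = i} \<le> b"
      using card_mono[of "{b * i..<b * i + b}"] by fastforce
    then show ?thesis unfolding J_def by (intro order_trans[OF card_image_le]) auto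
  qed
  have A_eq: "A \<omega> = (\<Sum>t<n. (Y (base t) \<omega>)\<^sup>2 * dev (Suc t) \<omega>)" for \<omega>
  proof -
    have "(\<Sum>t<n. (Y (base t) \<omega>)\<^sup>2 * dev (Suc t) \<omega>)
       = (\<Sum>i\<le>n div b. \<Sum>t\<in>{t \<in> {..<n}. t div b = i}. (Y (base t) \<omega>)\<^sup>2 * dev (Suc t) \<omega>)"
      by (rule sum.group[symmetric]) (auto intro: div_le_mono)
    also have "\<dots> = A \<omega>"
      unfolding A_def J_def
      by (intro sum.cong refl) (simp add: sum.reindex sum_distrib_left base_def)
    finally show ?thesis by simp
  qed
  have split: "quad_dev n \<omega> = A \<omega> + B \<omega>" for \<omega>
  proof -
    \<comment> \<open>The change of \<open>Y^2\<close> since the start of the block is split into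
      single steps, fewer than \<open>b\<close> of them, to each of which the bound
      \<open>K5\<close> applies.\<close>
    have tele: "(Y t \<omega>)\<^sup>2 = (Y (base t) \<omega>)\<^sup>2 + (\<Sum>j=base t..<t. (Y (Suc j) \<omega>)\<^sup>2 - (Y j \<omega>)\<^sup>2)" for t
      using sum_Suc_diff'[of "base t" t "\<lambda>j. (Y j \<omega>)\<^sup>2"] by (simp add: base_def del: Y.simps)
    have "(Y t \<omega>)\<^sup>2 * dev (Suc t) \<omega> = (Y (base t) \<omega>)\<^sup>2 * dev (Suc t) \<omega>
        + (\<Sum>j=base t..<t. ((Y (Suc j) \<omega>)\<^sup>2 - (Y j \<omega>)\<^sup>2) * dev (Suc t) \<omega>)" for t
      unfolding tele[of t] distrib_right sum_distrib_right ..
    then show ?thesis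
      unfolding A_eq B_def quad_dev_def by (simp add: sum.distrib del: Y.simps)
  qed
  have intA: "integrable M (\<lambda>\<omega>. (Y (b * i) \<omega>)\<^sup>2 * (\<Sum>t\<in>J i. dev t \<omega>))" for i
    by (rule expectation_Y2_dev_sum(1)[OF fin card])
  have intA': "integrable M A" unfolding A_def by (intro Bochner_Integration.integrable_sum intA)
  have intB': "integrable M B"
    unfolding B_def by (intro Bochner_Integration.integrable_sum expectation_increment_dev(1))
  show "integrable M (quad_dev n)"
    unfolding split[abs_def] by (rule Bochner_Integration.integrable_add[OF intA' intB'])
  have EA: "expectation (\<lambda>\<omega>. \<bar>A \<omega>\<bar>) \<le> (real n / b + 1) * sqrt (K2\<^sup>2 * (b * (8 * R ^ 5 / \<alpha>\<^sup>2)))"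
  proof -
    have "expectation (\<lambda>\<omega>. \<bar>A \<omega>\<bar>) \<le> expectation (\<lambda>\<omega>. \<Sum>i\<le>n div b. \<bar>(Y (b * i) \<omega>)\<^sup>2 * (\<Sum>t\<in>J i. dev t \<omega>)\<bar>)"
      using intA intA'
      by (intro integral_mono integrable_abs Bochner_Integration.integrable_sum) (auto simp: A_def intro: sum_abs)
    also have "\<dots> = (\<Sum>i\<le>n div b. expectation (\<lambda>\<omega>. \<bar>(Y (b * i) \<omega>)\<^sup>2 * (\<Sum>t\<in>J i. dev t \<omega>)\<bar>))"
      by (intro Bochner_Integration.integral_sum integrable_abs intA)
    also have "\<dots> \<le> (\<Sum>i\<le>n div b. sqrt (K2\<^sup>2 * (b * (8 * R ^ 5 / \<alpha>\<^sup>2))))"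
      by (intro sum_mono expectation_Y2_dev_sum(2) fin card)
    \<comment> \<open>The last of these blocks may be incomplete or empty.\<close>
    also have "\<dots> = real (n div b + 1) * sqrt (K2\<^sup>2 * (b * (8 * R ^ 5 / \<alpha>\<^sup>2)))" by simp
    also have "\<dots> \<le> (real n / b + 1) * sqrt (K2\<^sup>2 * (b * (8 * R ^ 5 / \<alpha>\<^sup>2)))"
      using R_ge of_nat_div_le_of_nat[of n b, where 'a=real] by (intro mult_right_mono) auto
    finally show ?thesis .
  qed
  have EB: "expectation (\<lambda>\<omega>. \<bar>B \<omega>\<bar>) \<le> n * (b * sqrt (K5 * (2 * R ^ 4)))"
  proof -
    let ?f = "\<lambda>j t \<omega>. \<bar>((Y (Suc j) \<omega>)\<^sup>2 - (Y j \<omega>)\<^sup>2) * dev (Suc t) \<omega>\<bar>"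
    have "expectation (\<lambda>\<omega>. \<bar>B \<omega>\<bar>) \<le> expectation (\<lambda>\<omega>. \<Sum>t<n. \<Sum>j=base t..<t. ?f j t \<omega>)"
    proof (rule integral_mono)
      show "\<bar>B \<omega>\<bar> \<le> (\<Sum>t<n. \<Sum>j=base t..<t. ?f j t \<omega>)" for \<omega>
        unfolding B_def by (intro order_trans[OF sum_abs] sum_mono sum_abs)
    qed (use intB' in \<open>auto intro!: Bochner_Integration.integrable_sum expectation_increment_dev(1)[THEN integrable_abs] simp del: Y.simps\<close>)
    also have "\<dots> = (\<Sum>t<n. \<Sum>j=base t..<t. expectation (?f j t))"
      by (subst Bochner_Integration.integral_sum sum.cong[OF refl Bochner_Integration.integral_sum];
          (intro Bochner_Integration.integrable_sum integrable_abs expectation_increment_dev(1) refl)?)+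
    also have "\<dots> \<le> (\<Sum>t<n. \<Sum>j=base t..<t. sqrt (K5 * (2 * R ^ 4)))"
      by (intro sum_mono expectation_increment_dev(2))
    also have "\<dots> = (\<Sum>t<n. real (t - base t) * sqrt (K5 * (2 * R ^ 4)))" by simp
    also have "\<dots> \<le> (\<Sum>t<n. b * sqrt (K5 * (2 * R ^ 4)))"
    proof (intro sum_mono mult_right_mono)
      fix t
      have "t - base t = t mod b" by (simp add: base_def minus_mult_div_eq_mod)
      also have "\<dots> \<le> b" using b by (intro less_imp_le mod_less_divisor) simp
      finally show "real (t - base t) \<le> real b" by simp
    next
      have "K5 \<ge> 0" unfolding K5_def using K2_pos \<kappa>_nonneg by simp
      then show "0 \<le> sqrt (K5 * (2 * R ^ 4))" by simp
    qed
    finally show ?thesis by simp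
  qed
  have "expectation (\<lambda>\<omega>. \<bar>quad_dev n \<omega>\<bar>) \<le> expectation (\<lambda>\<omega>. \<bar>A \<omega>\<bar> + \<bar>B \<omega>\<bar>)"
    unfolding split using intA' intB' by (intro integral_mono) auto
  also have "\<dots> = expectation (\<lambda>\<omega>. \<bar>A \<omega>\<bar>) + expectation (\<lambda>\<omega>. \<bar>B \<omega>\<bar>)" using intA' intB' by simp
  finally show "expectation (\<lambda>\<omega>. \<bar>quad_dev n \<omega>\<bar>)
      \<le> (real n / b + 1) * sqrt (K2\<^sup>2 * (b * (8 * R ^ 5 / \<alpha>\<^sup>2))) + n * (b * sqrt (K5 * (2 * R ^ 4)))"
    using EA EB by linarith
qed

text \<open>The heuristic standard deviation of \<open>N n\<close>: each summand contributes about
  \<open>T / (1 - \<rho>^2)\<close> from the square of \<open>Y\<close>, times \<open>T\<close> from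
  the squared volatility.\<close>

definition scale :: "nat \<Rightarrow> real" where "scale n = sqrt (n * T\<^sup>2 / (1 - \<rho>\<^sup>2))"

definition X :: "nat \<Rightarrow> nat \<Rightarrow> 'a \<Rightarrow> real" where
  "X n t \<omega> = Y t \<omega> * vol (Suc t) \<omega> / scale n * \<epsilon> (Suc t) \<omega>"

lemma scale_sq: "(scale n)\<^sup>2 = n * T\<^sup>2 / (1 - \<rho>\<^sup>2)"
  using one_minus_\<rho>_sq by (simp add: scale_def)

lemma inverse_scale_sq_le:
  assumes "n > 0"
  shows "1 / (scale n)\<^sup>2 \<le> 2 * c / (k * n)"
proof -
  have "1 / (scale n)\<^sup>2 = (1 - \<rho>\<^sup>2) * (1 / (n * T\<^sup>2))" by (simp add: scale_sq)
  also have "\<dots> \<le> (2 * c / k) * (1 / (n * 1))"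
    using assms one_minus_\<rho>_sq T_ge c_pos k_ge
    by (intro mult_mono divide_left_mono mult_left_mono) auto
  finally show ?thesis by simp
qed

lemma sum_X: "(\<Sum>t<n. X n t \<omega>) = N n \<omega> / scale n"
  by (simp add: X_def N_def sum_divide_distrib)

definition Q_bound :: "nat \<Rightarrow> nat \<Rightarrow> real" where
  "Q_bound n b = 2 * c / (k * n) * (sqrt (\<kappa> * (n * K2\<^sup>2))
     + ((real n / b + 1) * sqrt (K2\<^sup>2 * (b * (8 * R ^ 5 / \<alpha>\<^sup>2))) + n * (b * sqrt (K5 * (2 * R ^ 4))))) + D_bound n / n"

text \<open>Writing the squared innovation as 1 plus a centred term and the squared volatility as
  \<open>T + dev\<close> turns the sum into \<open>quad_err + quad_dev + T * D n\<close>, over the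
  squared scale. Its last part is the normalised denominator, already known to be near 1.\<close>

lemma expectation_sum_X_sq:
  assumes n: "n > 0" and b: "b \<ge> 1"
  shows "expectation (\<lambda>\<omega>. \<bar>(\<Sum>t<n. (X n t \<omega>)\<^sup>2) - 1\<bar>) \<le> Q_bound n b"
proof -
  have eq: "(\<Sum>t<n. (X n t \<omega>)\<^sup>2) - 1 = (quad_err n \<omega> + quad_dev n \<omega>) / (scale n)\<^sup>2 + ((1 - \<rho>\<^sup>2) * D n \<omega> - n * T) / (n * T)" for \<omega>
  proof -
    have "(\<Sum>t<n. (X n t \<omega>)\<^sup>2) = (\<Sum>t<n. (Y t \<omega> * vol (Suc t) \<omega>)\<^sup>2 * (\<epsilon> (Suc t) \<omega>)\<^sup>2) / (scale n)\<^sup>2"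
      by (simp add: X_def sum_divide_distrib power_mult_distrib power_divide)
    also have "(\<Sum>t<n. (Y t \<omega> * vol (Suc t) \<omega>)\<^sup>2 * (\<epsilon> (Suc t) \<omega>)\<^sup>2) = quad_err n \<omega> + quad_dev n \<omega> + T * D n \<omega>"
      by (simp add: quad_err_def quad_dev_def D_def dev_def sum_distrib_left power_mult_distrib algebra_simps flip: sum.distrib)
    also have "(quad_err n \<omega> + quad_dev n \<omega> + T * D n \<omega>) / (scale n)\<^sup>2
       = (quad_err n \<omega> + quad_dev n \<omega>) / (scale n)\<^sup>2 + (1 - \<rho>\<^sup>2) * D n \<omega> / (n * T)"
    proof -
      have "T * D n \<omega> / (scale n)\<^sup>2 = (1 - \<rho>\<^sup>2) * D n \<omega> / (n * T)"
        unfolding scale_sq using T_ge by (simp add: power2_eq_square[of T])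
      then show ?thesis by (simp add: add_divide_distrib)
    qed
    also have "\<dots> - 1 = (quad_err n \<omega> + quad_dev n \<omega>) / (scale n)\<^sup>2 + ((1 - \<rho>\<^sup>2) * D n \<omega> - n * T) / (n * T)"
      using T_ge n by (simp add: diff_divide_distrib)
    finally show ?thesis .
  qed
  note ints = sq_integrable_integrable[OF sq_integrable_quad_err[of n]] expectation_quad_dev(1)[OF b, of n] integrable_D[of n]
  define a where "a = 1 / (scale n)\<^sup>2"
  have a: "0 \<le> a" "a \<le> 2 * c / (k * n)" using inverse_scale_sq_le[OF n] by (auto simp: a_def)
  have nT: "1 / (n * T) \<le> 1 / n" "0 \<le> 1 / (n * T)"
    using n T_ge by (auto intro!: divide_left_mono)
  have "expectation (\<lambda>\<omega>. \<bar>(\<Sum>t<n. (X n t \<omega>)\<^sup>2) - 1\<bar>)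
     \<le> expectation (\<lambda>\<omega>. a * (\<bar>quad_err n \<omega>\<bar> + \<bar>quad_dev n \<omega>\<bar>) + 1 / (n * T) * \<bar>(1 - \<rho>\<^sup>2) * D n \<omega> - n * T\<bar>)"
  proof (rule integral_mono)
    fix \<omega>
    define p q r where "p = quad_err n \<omega>" and "q = quad_dev n \<omega>" and "r = (1 - \<rho>\<^sup>2) * D n \<omega> - n * T"
    have e: "(\<Sum>t<n. (X n t \<omega>)\<^sup>2) - 1 = a * p + a * q + 1 / (n * T) * r"
      unfolding eq a_def p_def q_def r_def by (simp add: add_divide_distrib)
    have "\<bar>a * p + a * q + 1 / (n * T) * r\<bar> \<le> \<bar>a * p\<bar> + \<bar>a * q\<bar> + \<bar>1 / (n * T) * r\<bar>"
      by (rule order_trans[OF abs_triangle_ineq add_right_mono[OF abs_triangle_ineq]])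
    also have "\<dots> = a * (\<bar>p\<bar> + \<bar>q\<bar>) + 1 / (n * T) * \<bar>r\<bar>"
      using a(1) nT(2) by (simp only: abs_mult abs_of_nonneg distrib_left)
    finally show "\<bar>(\<Sum>t<n. (X n t \<omega>)\<^sup>2) - 1\<bar> \<le> a * (\<bar>quad_err n \<omega>\<bar> + \<bar>quad_dev n \<omega>\<bar>) + 1 / (n * T) * \<bar>(1 - \<rho>\<^sup>2) * D n \<omega> - n * T\<bar>"
      unfolding e p_def q_def r_def .
  qed (use ints in \<open>auto simp: eq\<close>)
  also have "\<dots> = a * (expectation (\<lambda>\<omega>. \<bar>quad_err n \<omega>\<bar>) + expectation (\<lambda>\<omega>. \<bar>quad_dev n \<omega>\<bar>))
      + 1 / (n * T) * expectation (\<lambda>\<omega>. \<bar>(1 - \<rho>\<^sup>2) * D n \<omega> - n * T\<bar>)"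
    using ints by simp
  also have "\<dots> \<le> 2 * c / (k * n) * (sqrt (\<kappa> * (n * K2\<^sup>2))
     + ((real n / b + 1) * sqrt (K2\<^sup>2 * (b * (8 * R ^ 5 / \<alpha>\<^sup>2))) + n * (b * sqrt (K5 * (2 * R ^ 4))))) + 1 / n * D_bound n"
    using a nT by (intro add_mono mult_mono expectation_quad_err expectation_quad_dev(2) expectation_D b
        Bochner_Integration.integral_nonneg add_nonneg_nonneg) auto
  finally show ?thesis by (simp add: Q_bound_def)
qed

text \<open>The Lyapunov condition: summed over \<open>n\<close> terms the bound is of order
  \<open>1 / n\<close>, up to powers of \<open>R\<close>.\<close>

lemma
  shows integrable_X4: "integrable M (\<lambda>\<omega>. X n t \<omega> ^ 4)"
    and expectation_X4: "n > 0 \<Longrightarrow> expectation (\<lambda>\<omega>. X n t \<omega> ^ 4) \<le> \<kappa> * K2\<^sup>2 * (2 * c / (k * n))\<^sup>2"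
proof -
  have p: "(\<lambda>\<omega>. Y t \<omega> ^ 4 * vol (Suc t) \<omega> ^ 4) \<in> borel_measurable (past (int t))"
    using Y_past[of t "int t"] vol_past[of "int t" "Suc t"] by measurable
  have g: "(\<lambda>x::real. x ^ 4) \<in> borel_measurable borel" by measurable
  have s: "Suc t \<ge> 1" and lt: "int t < int (Suc t)" by auto
  have eq: "X n t \<omega> ^ 4 = (1 / (scale n)\<^sup>2)\<^sup>2 * (Y t \<omega> ^ 4 * vol (Suc t) \<omega> ^ 4 * \<epsilon> (Suc t) \<omega> ^ 4)" for \<omega>
    by (simp add: X_def power_mult_distrib power_divide flip: power_mult)
  note E = integrable_past_mult[OF p integrable_Y4_vol4 g innov_fourth[OF s] lt]
    expectation_past_mult[OF p integrable_Y4_vol4 g innov_fourth[OF s] lt]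
  show "integrable M (\<lambda>\<omega>. X n t \<omega> ^ 4)" unfolding eq using E(1) by (rule integrable_mult_right)
  assume n: "n > 0"
  have "expectation (\<lambda>\<omega>. X n t \<omega> ^ 4) = (1 / (scale n)\<^sup>2)\<^sup>2 * (expectation (\<lambda>\<omega>. Y t \<omega> ^ 4 * vol (Suc t) \<omega> ^ 4) * \<kappa>)"
    unfolding eq integral_mult_right_zero E(2) innov_kurtosis[OF s] ..
  also have "\<dots> \<le> (2 * c / (k * n))\<^sup>2 * (K2\<^sup>2 * \<kappa>)"
    using \<kappa>_nonneg inverse_scale_sq_le[OF n]
    by (intro mult_mono power_mono expectation_Y4_vol4 mult_nonneg_nonneg Bochner_Integration.integral_nonneg) auto
  finally show "expectation (\<lambda>\<omega>. X n t \<omega> ^ 4) \<le> \<kappa> * K2\<^sup>2 * (2 * c / (k * n))\<^sup>2" by (simp add: mult.commute mult.left_commute)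
qed

lemma char_N_bound:
  assumes n: "n > 0" and b: "b \<ge> 1" and \<delta>: "0 < \<delta>" "\<delta> \<le> 1"
    and Q: "Q_bound n b \<le> \<delta>\<^sup>2" and L: "n * (\<kappa> * K2\<^sup>2 * (2 * c / (k * n))\<^sup>2) \<le> \<delta>\<^sup>2"
  shows "cmod (expectation (\<lambda>\<omega>. iexp (\<theta> * (N n \<omega> / scale n))) - complex_of_real (exp (- \<theta>\<^sup>2 / 2)))
    \<le> \<delta> * (2 + 2 * \<bar>\<theta>\<bar>^3 * (3 * exp 2 + 1) + exp (2 * \<theta>\<^sup>2) * (1 + 2 * \<theta>\<^sup>2) + \<theta>\<^sup>2 + 1)"
  unfolding sum_X[symmetric]
proof (rule martingale_char_bound[where F="\<lambda>t. past (int t)", OF subalgebra_past past_mono _ integrable_X4 _ \<delta>])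
  fix t assume "t < n"
  have [measurable]: "Y t \<in> borel_measurable (past (int (Suc t)))" "vol (Suc t) \<in> borel_measurable (past (int (Suc t)))"
    "\<epsilon> (Suc t) \<in> borel_measurable (past (int (Suc t)))"
    using Y_past[of t "int (Suc t)"] vol_past[of "int (Suc t)" "Suc t"] Z_past[of "int (Suc t)" "int (Suc t)"] by auto
  show "X n t \<in> borel_measurable (past (int (Suc t)))"
    unfolding X_def by measurable
next
  fix t :: nat and G :: "'a \<Rightarrow> complex"
  assume G: "G \<in> borel_measurable (past (int t))" "integrable M (\<lambda>\<omega>. (cmod (G \<omega>))\<^sup>2)"
  have s: "Suc t \<ge> 1" and lt: "int t < int (Suc t)" by auto
  \<comment> \<open>All of \<open>X n t\<close> except its innovation joins the test function, the
    product being known at time \<open>t\<close>.\<close>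
  let ?f = "\<lambda>\<omega>. G \<omega> * complex_of_real (Y t \<omega> * vol (Suc t) \<omega> / scale n)"
  have p: "?f \<in> borel_measurable (past (int t))"
    using Y_vol_past[of t "Suc t"] G(1) by measurable
  have "sq_integrable (\<lambda>\<omega>. cmod (G \<omega>))"
    using past_measurable[OF G(1)] G(2) by (simp add: sq_integrable_def)
  from sq_integrable_mult[OF this sq_integrable_cmult[OF sq_integrable_Y_vol[of t "Suc t"], of "1 / scale n"]]
  have i: "integrable M ?f"
  proof (rule Bochner_Integration.integrable_bound)
    show "?f \<in> borel_measurable M" by (rule past_measurable[OF p])
  qed (simp add: norm_mult norm_divide abs_mult)
  have g: "complex_of_real \<in> borel_measurable borel" by measurable
  have ig: "integrable M (\<lambda>\<omega>. complex_of_real (\<epsilon> (Suc t) \<omega>))"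
    using sq_integrable_integrable[OF sq_integrable_innov[OF s]] by (simp del: of_nat_Suc)
  have "expectation (\<lambda>\<omega>. ?f \<omega> * complex_of_real (\<epsilon> (Suc t) \<omega>)) = 0"
    unfolding expectation_past_mult[OF p i g ig lt] using innov_mean[OF s] by (simp del: of_nat_Suc)
  then show "expectation (\<lambda>\<omega>. G \<omega> * complex_of_real (X n t \<omega>)) = 0"
    by (simp add: X_def mult.assoc del: of_nat_Suc)
next
  show "expectation (\<lambda>\<omega>. \<bar>(\<Sum>t<n. (X n t \<omega>)\<^sup>2) - 1\<bar>) \<le> \<delta>\<^sup>2"
    using expectation_sum_X_sq[OF n b] Q by linarith
  have "expectation (\<lambda>\<omega>. \<Sum>t<n. X n t \<omega> ^ 4) = (\<Sum>t<n. expectation (\<lambda>\<omega>. X n t \<omega> ^ 4))"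
    by (rule Bochner_Integration.integral_sum) (rule integrable_X4)
  also have "\<dots> \<le> (\<Sum>t<n. \<kappa> * K2\<^sup>2 * (2 * c / (k * n))\<^sup>2)"
    by (intro sum_mono expectation_X4 n)
  finally show "expectation (\<lambda>\<omega>. \<Sum>t<n. X n t \<omega> ^ 4) \<le> \<delta>\<^sup>2" using L by simp
qed simp

section \<open>Reduction of the error bounds to powers of \<open>R\<close>\<close>

definition K7 :: real where "K7 = 3 * (4 * c\<^sup>2 * C + 4 * sqrt C + \<kappa>)"

text \<open>\<open>K7\<close> and \<open>C\<close> involve only \<open>c\<close> and
  \<open>\<kappa>\<close>, so everything that varies with the row is collected in the factors
  \<open>R\<close> and \<open>k\<close>.\<close>

lemma K5_le: "K5 \<le> K7 * (R ^ 8 * k)"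
proof -
  have R8: "R ^ m \<le> R ^ 8" if "m \<le> 8" for m using R_ge that by (intro power_increasing) auto
  have "(2 * c / k)\<^sup>2 * K2\<^sup>2 = 4 * c\<^sup>2 * C * (R ^ 8 * 1)"
    unfolding K2_sq using k_ge by (simp add: power2_eq_square)
  also have "\<dots> \<le> 4 * c\<^sup>2 * C * (R ^ 8 * k)"
    using k_ge C_ge R_ge by (intro mult_left_mono) auto
  finally have 1: "(2 * c / k)\<^sup>2 * K2\<^sup>2 \<le> 4 * c\<^sup>2 * C * (R ^ 8 * k)" .
  have 2: "4 * K2 \<le> 4 * sqrt C * (R ^ 8 * k)"
    unfolding K2_def using R8[of 4] k_ge C_ge by (simp add: mult.assoc mult_left_mono mult_right_mono)
  have "\<kappa> * R\<^sup>2 \<le> \<kappa> * (R ^ 8 * k)"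
    using \<kappa>_nonneg k_ge R_ge R8[of 2] mult_mono[of "R\<^sup>2" "R ^ 8" 1 k] by (intro mult_left_mono) auto
  with 1 2 show ?thesis by (simp add: K5_def K7_def algebra_simps)
qed

text \<open>Powers of \<open>R\<close> are enlarged and \<open>k \<ge> 1\<close> is inserted where
  it is absent, so that all four summands are measured by the single ratio
  \<open>k * R ^ 8 / n\<close>.\<close>

lemma D_bound_le:
  assumes n: "n > 0"
  shows "D_bound n / n \<le> sqrt \<kappa> * sqrt (k * R ^ 8 / n) + sqrt (8 / \<alpha>\<^sup>2) * sqrt (k * R ^ 8 / n)
    + 2 * sqrt (sqrt C) * sqrt (k * R ^ 8 / n) + 2 * sqrt C * (k * R ^ 8 / n)"
proof -
  have R8: "R ^ m \<le> k * R ^ 8" if "m \<le> 8" for m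
  proof -
    have "R ^ m \<le> R ^ 8" using R_ge that by (intro power_increasing) auto
    also have "\<dots> \<le> k * R ^ 8" using k_ge R_ge mult_right_mono[of 1 k "R ^ 8"] by simp
    finally show ?thesis .
  qed
  have R48: "k * R ^ 4 \<le> k * R ^ 8" using R_ge k_ge by (intro mult_left_mono power_increasing) auto
  have div: "sqrt (n * x) / n = sqrt (x / n)" for x :: real
    using n by (simp add: real_sqrt_mult real_sqrt_divide real_div_sqrt field_simps)
  have "sqrt (\<kappa> * (n * R\<^sup>2)) / n = sqrt \<kappa> * sqrt (R\<^sup>2 / n)"
    using div[of "\<kappa> * R\<^sup>2"] by (simp add: mult.left_commute real_sqrt_mult real_sqrt_divide)
  also have "\<dots> \<le> sqrt \<kappa> * sqrt (k * R ^ 8 / n)"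
    using R8[of 2] \<kappa>_nonneg by (intro mult_left_mono real_sqrt_le_mono divide_right_mono) auto
  finally have 1: "sqrt (\<kappa> * (n * R\<^sup>2)) / n \<le> sqrt \<kappa> * sqrt (k * R ^ 8 / n)" .
  have "sqrt (n * (8 * R ^ 5 / \<alpha>\<^sup>2)) / n = sqrt (8 / \<alpha>\<^sup>2) * sqrt (R ^ 5 / n)"
    unfolding div by (simp add: real_sqrt_mult[symmetric])
  also have "\<dots> \<le> sqrt (8 / \<alpha>\<^sup>2) * sqrt (k * R ^ 8 / n)"
    using R8[of 5] by (intro mult_left_mono real_sqrt_le_mono divide_right_mono) auto
  finally have 2: "sqrt (n * (8 * R ^ 5 / \<alpha>\<^sup>2)) / n \<le> sqrt (8 / \<alpha>\<^sup>2) * sqrt (k * R ^ 8 / n)" .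
  have "sqrt (n * K2) / n = sqrt (sqrt C) * sqrt (k * R ^ 4 / n)"
    unfolding div K2_def by (simp add: real_sqrt_mult[symmetric] mult.commute mult.left_commute)
  also have "\<dots> \<le> sqrt (sqrt C) * sqrt (k * R ^ 8 / n)"
    using C_ge by (intro mult_left_mono real_sqrt_le_mono divide_right_mono[OF R48]) auto
  finally have 3: "sqrt (n * K2) / n \<le> sqrt (sqrt C) * sqrt (k * R ^ 8 / n)" .
  have "K2 / n = sqrt C * (k * R ^ 4 / n)" by (simp add: K2_def)
  also have "\<dots> \<le> sqrt C * (k * R ^ 8 / n)"
    using C_ge by (intro mult_left_mono divide_right_mono[OF R48]) auto
  finally have 4: "K2 / n \<le> sqrt C * (k * R ^ 8 / n)" .
  have "D_bound n / n = sqrt (\<kappa> * (n * R\<^sup>2)) / n + sqrt (n * (8 * R ^ 5 / \<alpha>\<^sup>2)) / n + 2 * (sqrt (n * K2) / n) + 2 * (K2 / n)"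
    by (simp add: D_bound_def add_divide_distrib)
  then show ?thesis using 1 2 3 4 by linarith
qed

text \<open>The ratio \<open>R ^ 13 / b\<close> is the averaging error within blocks
  (\<open>R ^ 8\<close> from \<open>K2^2\<close>, \<open>R ^ 5\<close> from the deviations), and
  \<open>b * sqrt (R ^ 12 / k)\<close> is the freezing error (\<open>R ^ 8\<close> from
  \<open>K5\<close>, \<open>R ^ 4\<close> from the second moment of \<open>dev\<close>). They depend
  on \<open>b\<close> in opposite ways, which asks for an intermediate block length.\<close>

lemma Q_bound_le:
  assumes n: "n > 0" and b: "b \<ge> 1" "b \<le> n"
  shows "Q_bound n b \<le> 2 * c * sqrt (\<kappa> * C) * sqrt (k * R ^ 8 / n)
    + 4 * c * sqrt (8 * C / \<alpha>\<^sup>2) * sqrt (R ^ 13 / b) + 2 * c * sqrt (2 * K7) * (b * sqrt (R ^ 12 / k)) + D_bound n / n"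
proof -
  have K2: "K2 = sqrt C * sqrt (R ^ 8) * k"
  proof -
    have "sqrt (R ^ 8) = R ^ 4"
      using R_ge by (intro real_sqrt_unique) (auto simp flip: power_mult)
    then show ?thesis by (simp add: K2_def)
  qed
  have "2 * c / (k * n) * sqrt (\<kappa> * (n * K2\<^sup>2)) = 2 * c * sqrt (\<kappa> * C) * sqrt (R ^ 8 / n)"
    using K2_pos n k_ge unfolding real_sqrt_mult real_sqrt_abs real_sqrt_divide
    by (simp add: K2 real_div_sqrt field_simps)
  also have "\<dots> \<le> 2 * c * sqrt (\<kappa> * C) * sqrt (k * R ^ 8 / n)"
    using c_pos \<kappa>_nonneg C_ge k_ge R_ge mult_right_mono[of 1 k "R ^ 8"]
    by (intro mult_left_mono real_sqrt_le_mono divide_right_mono) auto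
  finally have 1: "2 * c / (k * n) * sqrt (\<kappa> * (n * K2\<^sup>2)) \<le> 2 * c * sqrt (\<kappa> * C) * sqrt (k * R ^ 8 / n)" .
  \<comment> \<open>Since \<open>b \<le> n\<close>, the additional block is absorbed:
    \<open>n / b + 1 \<le> 2 * n / b\<close>.\<close>
  have "2 * c / (k * n) * ((real n / b + 1) * sqrt (K2\<^sup>2 * (b * (8 * R ^ 5 / \<alpha>\<^sup>2))))
     \<le> 2 * c / (k * n) * ((2 * real n / b) * sqrt (K2\<^sup>2 * (b * (8 * R ^ 5 / \<alpha>\<^sup>2))))"
    using c_pos k_ge R_ge b by (intro mult_left_mono mult_right_mono) (auto simp: field_simps)
  also have "\<dots> = 4 * c * (sqrt (8 * C / \<alpha>\<^sup>2) * sqrt (R ^ 13 / b))"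
  proof -
    have "sqrt (K2\<^sup>2 * (b * (8 * R ^ 5 / \<alpha>\<^sup>2))) = k * b * sqrt (C * R ^ 8 * (8 * R ^ 5 / \<alpha>\<^sup>2) / b)"
    proof -
      have "K2\<^sup>2 * (b * (8 * R ^ 5 / \<alpha>\<^sup>2)) = (k * b)\<^sup>2 * (C * R ^ 8 * (8 * R ^ 5 / \<alpha>\<^sup>2) / b)"
        unfolding K2_sq using b by (simp add: field_simps power2_eq_square)
      then show ?thesis
        using k_ge by (simp only: real_sqrt_mult[of "(k * b)\<^sup>2"] real_sqrt_abs) simp
    qed
    also have "C * R ^ 8 * (8 * R ^ 5 / \<alpha>\<^sup>2) / b = (8 * C / \<alpha>\<^sup>2) * (R ^ 13 / b)"
      by (simp add: power_add[of R 8 5, simplified])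
    finally have e: "sqrt (K2\<^sup>2 * (b * (8 * R ^ 5 / \<alpha>\<^sup>2))) = k * b * (sqrt (8 * C / \<alpha>\<^sup>2) * sqrt (R ^ 13 / b))"
      unfolding real_sqrt_mult[of "8 * C / \<alpha>\<^sup>2"] .
    show ?thesis unfolding e using n b k_ge by simp
  qed
  finally have 2: "2 * c / (k * n) * ((real n / b + 1) * sqrt (K2\<^sup>2 * (b * (8 * R ^ 5 / \<alpha>\<^sup>2))))
     \<le> 4 * c * sqrt (8 * C / \<alpha>\<^sup>2) * sqrt (R ^ 13 / b)" by simp
  have "sqrt (K5 * (2 * R ^ 4)) / k \<le> sqrt (2 * K7) * sqrt (R ^ 12 / k)"
  proof -
    have "sqrt (K5 * (2 * R ^ 4)) \<le> sqrt ((K7 * (R ^ 8 * k)) * (2 * R ^ 4))"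
      using R_ge by (intro real_sqrt_le_mono mult_right_mono K5_le) auto
    also have "(K7 * (R ^ 8 * k)) * (2 * R ^ 4) = k\<^sup>2 * ((2 * K7) * (R ^ 12 / k))"
      using k_ge by (simp add: power2_eq_square power_add[of R 8 4, simplified])
    also have "sqrt \<dots> = k * (sqrt (2 * K7) * sqrt (R ^ 12 / k))"
      using k_ge by (simp only: real_sqrt_mult[of "k\<^sup>2"] real_sqrt_mult[of "2 * K7"] real_sqrt_abs)
    finally show ?thesis using k_ge by (simp add: field_simps)
  qed
  then have "2 * c * b * (sqrt (K5 * (2 * R ^ 4)) / k) \<le> 2 * c * b * (sqrt (2 * K7) * sqrt (R ^ 12 / k))"
    using c_pos by (intro mult_left_mono) auto
  also have "\<dots> = 2 * c * sqrt (2 * K7) * (b * sqrt (R ^ 12 / k))"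
    by (simp only: mult_ac)
  finally have 3: "2 * c / (k * n) * (n * (b * sqrt (K5 * (2 * R ^ 4)))) \<le> 2 * c * sqrt (2 * K7) * (b * sqrt (R ^ 12 / k))"
    using n by simp
  show ?thesis unfolding Q_bound_def using 1 2 3 by (simp add: distrib_left)
qed

lemma fourth_moment_sum_le:
  fixes n :: nat
  assumes n: "n > 0"
  shows "n * (\<kappa> * K2\<^sup>2 * (2 * c / (k * n))\<^sup>2) \<le> 4 * c\<^sup>2 * \<kappa> * C * (k * R ^ 8 / n)"
proof -
  have "n * (\<kappa> * K2\<^sup>2 * (2 * c / (k * n))\<^sup>2) = 4 * c\<^sup>2 * \<kappa> * C * (1 * R ^ 8 / n)"
    unfolding K2_sq using n k_ge by (simp add: field_simps power2_eq_square)
  also have "\<dots> \<le> 4 * c\<^sup>2 * \<kappa> * C * (k * R ^ 8 / n)"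
    using \<kappa>_nonneg C_ge R_ge k_ge by (intro mult_left_mono divide_right_mono mult_right_mono) auto
  finally show ?thesis .
qed

text \<open>The first condition concerns the normalised denominator. The factor 4 in the second is
  made for the relative error of one minus the estimate, which is at most
  \<open>|N| * 2 / (n / 2)\<close> once that denominator is at least one half.\<close>

definition good :: "nat \<Rightarrow> real \<Rightarrow> 'a set" where
  "good n h = {\<omega> \<in> space M. \<bar>(1 - \<rho>\<^sup>2) * D n \<omega> / (n * T) - 1\<bar> \<le> h \<and> \<bar>4 * N n \<omega> / n\<bar> \<le> h}"

lemma N_measurable[measurable]: "N n \<in> borel_measurable M" and D_measurable[measurable]: "D n \<in> borel_measurable M"
  unfolding N_def[abs_def] D_def[abs_def] by measurable

lemma good_sets: "good n h \<in> sets M"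
  unfolding good_def by measurable

text \<open>Markov's inequality for each condition. \<open>D_bound\<close> also dominates the mean
  of \<open>|N n|\<close>, whose bound occurs among its summands; the 5 is 1 + 4.\<close>

lemma prob_good:
  assumes n: "n > 0" and h: "h > 0"
  shows "1 - 5 * (D_bound n / n) / h \<le> prob (good n h)"
proof -
  let ?F = "\<lambda>\<omega>. (1 - \<rho>\<^sup>2) * D n \<omega> / (n * T) - 1" and ?G = "\<lambda>\<omega>. 4 * N n \<omega> / n"
  have intF: "integrable M ?F" using integrable_D by simp
  have intG: "integrable M ?G" using sq_integrable_integrable[OF sq_integrable_N] by simp
  have F: "expectation (\<lambda>\<omega>. \<bar>?F \<omega>\<bar>) \<le> D_bound n / n"
  proof -
    have "expectation (\<lambda>\<omega>. \<bar>?F \<omega>\<bar>) = expectation (\<lambda>\<omega>. 1 / (n * T) * \<bar>(1 - \<rho>\<^sup>2) * D n \<omega> - n * T\<bar>)"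
    proof (intro Bochner_Integration.integral_cong refl)
      fix \<omega>
      have pos: "n * T > 0" using n T_ge by simp
      have "?F \<omega> = ((1 - \<rho>\<^sup>2) * D n \<omega> - n * T) / (n * T)" using n T_ge by (simp add: diff_divide_distrib)
      then show "\<bar>?F \<omega>\<bar> = 1 / (n * T) * \<bar>(1 - \<rho>\<^sup>2) * D n \<omega> - n * T\<bar>" using pos by simp
    qed
    also have "\<dots> = 1 / (n * T) * expectation (\<lambda>\<omega>. \<bar>(1 - \<rho>\<^sup>2) * D n \<omega> - n * T\<bar>)" by simp
    also have "\<dots> \<le> 1 / n * D_bound n"
      using n T_ge by (intro mult_mono expectation_D divide_left_mono Bochner_Integration.integral_nonneg) auto
    finally show ?thesis by simp
  qed
  have G: "expectation (\<lambda>\<omega>. \<bar>?G \<omega>\<bar>) \<le> 4 * (D_bound n / n)"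
  proof -
    have "expectation (\<lambda>\<omega>. \<bar>?G \<omega>\<bar>) = 4 / n * expectation (\<lambda>\<omega>. \<bar>N n \<omega>\<bar>)" by (simp add: abs_mult)
    also have "\<dots> \<le> 4 / n * D_bound n"
    proof (intro mult_left_mono)
      have "0 \<le> sqrt (\<kappa> * (n * R\<^sup>2))" "0 \<le> sqrt (n * (8 * R ^ 5 / \<alpha>\<^sup>2))" "0 \<le> sqrt (n * K2)"
        using \<kappa>_nonneg R_ge K2_pos by auto
      then show "expectation (\<lambda>\<omega>. \<bar>N n \<omega>\<bar>) \<le> D_bound n"
        using expectation_abs_N[of n] K2_pos unfolding D_bound_def by linarith
    qed simp
    finally show ?thesis by simp
  qed
  have sets: "{\<omega> \<in> space M. \<bar>?F \<omega>\<bar> > h} \<in> sets M" "{\<omega> \<in> space M. \<bar>?G \<omega>\<bar> > h} \<in> sets M" by measurable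
  have "1 - prob (good n h) = prob (space M - good n h)" using prob_compl[OF good_sets] by simp
  also have "space M - good n h = {\<omega> \<in> space M. \<bar>?F \<omega>\<bar> > h} \<union> {\<omega> \<in> space M. \<bar>?G \<omega>\<bar> > h}"
    by (auto simp: good_def)
  also have "prob \<dots> \<le> prob {\<omega> \<in> space M. \<bar>?F \<omega>\<bar> > h} + prob {\<omega> \<in> space M. \<bar>?G \<omega>\<bar> > h}"
    using sets by (rule measure_Un_le)
  also have "\<dots> \<le> D_bound n / n / h + 4 * (D_bound n / n) / h"
    using h F G by (intro add_mono order_trans[OF markov_abs[OF intF h]] order_trans[OF markov_abs[OF intG h]] divide_right_mono) auto
  also have "\<dots> = 5 * (D_bound n / n) / h" by (simp add: add_divide_distrib[symmetric])
  finally show ?thesis by linarith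
qed

lemma good_coverage:
  fixes n :: nat
  assumes n: "n \<ge> 2" and h: "0 < h" "h \<le> 1 / 16" and kh: "c / (2 * k) \<le> h" and z: "z > 0"
    and \<omega>: "\<omega> \<in> good n h" and \<gamma>: "1 - c / k = 1 - n powr (- \<gamma>)"
  defines "\<rho>' \<equiv> 1 - c / k + N n \<omega> / D n \<omega>"
  defines "g \<equiv> - (ln \<bar>\<rho>' - 1\<bar> / ln n)"
  shows "D n \<omega> \<noteq> 0" "\<rho>' < 1"
    and "\<bar>N n \<omega> / scale n\<bar> \<le> z * (1 - 16 * h) \<Longrightarrow> 1 - c / k \<in> \<rho>' \<plusminus> z * (sqrt 2 / n powr ((1 + g) / 2))"
    and "1 - c / k \<in> \<rho>' \<plusminus> z * (sqrt 2 / n powr ((1 + g) / 2)) \<Longrightarrow> \<bar>N n \<omega> / scale n\<bar> \<le> z * (1 + 16 * h)"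
    and "\<bar>N n \<omega> / scale n\<bar> \<le> z * (1 - 16 * h) \<Longrightarrow> \<gamma> \<in> g \<plusminus> z * (sqrt 2 / (n powr ((1 - g) / 2) * ln n))"
    and "\<gamma> \<in> g \<plusminus> z * (sqrt 2 / (n powr ((1 - g) / 2) * ln n)) \<Longrightarrow> \<bar>N n \<omega> / scale n\<bar> \<le> z * (1 + 16 * h)"
proof -
  define E where "E = (1 - \<rho>\<^sup>2) * D n \<omega> / (n * T)"
  have E: "\<bar>E - 1\<bar> \<le> h" and N: "\<bar>4 * N n \<omega> / n\<bar> \<le> h" using \<omega> by (auto simp: good_def E_def)
  have nT: "real n * T > 0" using n T_ge by simp
  have D_eq: "D n \<omega> = E * (n * T) / (1 - \<rho>\<^sup>2)" using n T_ge one_minus_\<rho>_sq by (simp add: E_def)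
  have E_half: "E \<ge> 1 / 2" using E h by linarith
  have Dpos: "D n \<omega> > 0" unfolding D_eq using E_half nT one_minus_\<rho>_sq by simp
  have \<delta>: "\<bar>N n \<omega> / D n \<omega> * (k / c)\<bar> \<le> h"
  proof -
    have kc: "k / c > 0" using k_ge c_pos by simp
    have "\<bar>N n \<omega> / D n \<omega> * (k / c)\<bar> = \<bar>N n \<omega>\<bar> * ((1 - \<rho>\<^sup>2) * (k / c)) / (E * (n * T))"
      unfolding D_eq using E_half n T_ge k_ge c_pos one_minus_\<rho>_sq by (simp add: abs_mult abs_divide mult_ac)
    also have "\<dots> \<le> \<bar>N n \<omega>\<bar> * 2 / ((1 / 2) * (n * 1))"
    proof (intro frac_le mult_left_mono mult_mono)
      have "(1 - \<rho>\<^sup>2) * (k / c) \<le> 2 * c / k * (k / c)" using kc one_minus_\<rho>_sq by (intro mult_right_mono) auto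
      then show "(1 - \<rho>\<^sup>2) * (k / c) \<le> 2" using k_ge c_pos by simp
    qed (use E_half T_ge n one_minus_\<rho>_sq kc in auto)
    also have "\<dots> = \<bar>4 * N n \<omega> / n\<bar>" by (simp add: abs_mult)
    finally show ?thesis using N by linarith
  qed
  have w: "\<bar>(1 - c / (2 * k)) - 1\<bar> \<le> h" using kh c_pos k_ge by simp
  have E': "\<bar>(1 - (1 - c / k)\<^sup>2) * D n \<omega> / (real n * T) - 1\<bar> \<le> h" using E by (simp add: E_def \<rho>_def)
  have n': "real n \<ge> 2" using n by simp
  have k0: "k > 0" using k_ge by simp
  have T0: "T > 0" using T_ge by simp
  note S = interval_sandwich[OF n' k0 c_pos T0 Dpos z h E' \<delta> w \<gamma>]
  have W: "N n \<omega> / scale n = N n \<omega> / sqrt (real n * T\<^sup>2 / (1 - (1 - c / k)\<^sup>2))"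
    by (simp add: scale_def \<rho>_def)
  show "D n \<omega> \<noteq> 0" using Dpos by simp
  show "\<rho>' < 1" unfolding \<rho>'_def by (rule S(1))
  show "\<bar>N n \<omega> / scale n\<bar> \<le> z * (1 - 16 * h) \<Longrightarrow> 1 - c / k \<in> \<rho>' \<plusminus> z * (sqrt 2 / n powr ((1 + g) / 2))"
    unfolding W g_def \<rho>'_def by (rule S(2))
  show "1 - c / k \<in> \<rho>' \<plusminus> z * (sqrt 2 / n powr ((1 + g) / 2)) \<Longrightarrow> \<bar>N n \<omega> / scale n\<bar> \<le> z * (1 + 16 * h)"
    unfolding W g_def \<rho>'_def by (rule S(3))
  show "\<bar>N n \<omega> / scale n\<bar> \<le> z * (1 - 16 * h) \<Longrightarrow> \<gamma> \<in> g \<plusminus> z * (sqrt 2 / (n powr ((1 - g) / 2) * ln n))"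
    unfolding W g_def \<rho>'_def by (rule S(4))
  show "\<gamma> \<in> g \<plusminus> z * (sqrt 2 / (n powr ((1 - g) / 2) * ln n)) \<Longrightarrow> \<bar>N n \<omega> / scale n\<bar> \<le> z * (1 + 16 * h)"
    unfolding W g_def \<rho>'_def by (rule S(5))
qed

end

section \<open>The triangular array\<close>

lemma sum_atLeast1_shift: "(\<Sum>t=1..n. f t) = (\<Sum>t<n. f (Suc t))" for f :: "nat \<Rightarrow> real"
  by (induction n) auto

context sv_ar_model begin

section \<open>One independent sequence out of the three sources of randomness\<close>

definition Z :: "nat \<Rightarrow> int \<Rightarrow> 'a \<Rightarrow> real" where
  "Z n i = (if i = 0 then y n 0 else if i > 0 then \<epsilon> n (nat i) else \<eta> n (nat (- i)))"

lemma Z_simps: "Z n 0 = y n 0" "t \<ge> 1 \<Longrightarrow> Z n (int t) = \<epsilon> n t" "t \<ge> 1 \<Longrightarrow> Z n (- int t) = \<eta> n t"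
  by (auto simp: Z_def)

lemma \<epsilon>_measurable: "t \<ge> 1 \<Longrightarrow> \<epsilon> n t \<in> borel_measurable (M n)"
  using \<epsilon>_indep[of n] prob_space_M[of n] by (simp add: prob_space.indep_vars_def)

lemma \<eta>_measurable: "t \<ge> 1 \<Longrightarrow> \<eta> n t \<in> borel_measurable (M n)"
  using \<eta>_indep[of n] prob_space_M[of n] by (simp add: prob_space.indep_vars_def)

lemma Z_measurable: "Z n i \<in> borel_measurable (M n)"
  using y0_measurable[of n] \<epsilon>_measurable[of "nat i" n] \<eta>_measurable[of "nat (- i)" n]
  by (auto simp: Z_def)

text \<open>Independence is given in layers: the initial value against the sequence of pairs, one
  innovation sequence against the other, and within each sequence. A symmetric range of indices
  allows the layers to be peeled off separately.\<close>

lemma prob_Z_cylinder: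
  fixes B :: "int \<Rightarrow> real set"
  assumes B: "\<And>i. B i \<in> sets borel" and K: "K \<ge> (1::nat)"
  shows "measure (M n) (\<Inter>i\<in>{- int K..int K}. Z n i -` B i \<inter> space (M n))
    = (\<Prod>i\<in>{- int K..int K}. measure (M n) (Z n i -` B i \<inter> space (M n)))"
proof -
  interpret prob_space "M n" by (rule prob_space_M)
  let ?E = "\<lambda>i. Z n i -` B i \<inter> space (M n)"
  let ?Pe = "PiM {1::nat..} (\<lambda>_. borel :: real measure)"
  let ?pos = "\<Inter>t\<in>{1..K}. ?E (int t)" and ?neg = "\<Inter>t\<in>{1..K}. ?E (- int t)"
  have I_eq: "{- int K..int K} = insert 0 (int ` {1..K} \<union> (\<lambda>t. - int t) ` {1..K})"
  proof (intro equalityI subsetI)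
    fix i assume i: "i \<in> {- int K..int K}"
    consider "i = 0" | "i > 0" | "i < 0" by linarith
    then show "i \<in> insert 0 (int ` {1..K} \<union> (\<lambda>t. - int t) ` {1..K})"
    proof cases
      case 2
      then have "i = int (nat i)" "nat i \<in> {1..K}" using i by auto
      then show ?thesis by blast
    next
      case 3
      then have "i = - int (nat (- i))" "nat (- i) \<in> {1..K}" using i by auto
      then show ?thesis by blast
    qed simp
  qed (use K in auto)
  have inter: "(\<Inter>i\<in>{- int K..int K}. ?E i) = ?E 0 \<inter> (?pos \<inter> ?neg)"
    unfolding I_eq using K by auto
  have prod: "(\<Prod>i\<in>{- int K..int K}. prob (?E i)) = prob (?E 0) * ((\<Prod>t\<in>{1..K}. prob (?E (int t))) * (\<Prod>t\<in>{1..K}. prob (?E (- int t))))"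
  proof -
    have d: "int ` {1..K} \<inter> (\<lambda>t. - int t) ` {1..K} = {}" by auto
    have n0: "0 \<notin> int ` {1..K} \<union> (\<lambda>t. - int t) ` {1..K}" by auto
    have fin: "finite (int ` {1..K} \<union> (\<lambda>t. - int t) ` {1..K})" by simp
    have inj: "inj_on int {1..K}" "inj_on (\<lambda>t. - int t) {1..K}" by (auto simp: inj_on_def)
    show ?thesis
      unfolding I_eq prod.insert[OF fin n0]
      by (subst prod.union_disjoint[OF _ _ d]) (simp_all only: finite_imageI finite_atLeastAtMost prod.reindex[OF inj(1)] prod.reindex[OF inj(2)] o_def)
  qed
  have Z_pos: "Z n (int t) = \<epsilon> n t" "Z n (- int t) = \<eta> n t" if "t \<in> {1..K}" for t
    using that Z_simps by auto
  have pos_eq: "?pos = (\<Inter>t\<in>{1..K}. \<epsilon> n t -` B (int t) \<inter> space (M n))"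
    and neg_eq: "?neg = (\<Inter>t\<in>{1..K}. \<eta> n t -` B (- int t) \<inter> space (M n))"
    by (auto simp: Z_pos)
  have Ppos: "prob ?pos = (\<Prod>t\<in>{1..K}. prob (?E (int t)))"
    unfolding pos_eq by (subst indep_varsD[OF \<epsilon>_indep]) (use K B in \<open>auto simp: Z_pos\<close>)
  have Pneg: "prob ?neg = (\<Prod>t\<in>{1..K}. prob (?E (- int t)))"
    unfolding neg_eq by (subst indep_varsD[OF \<eta>_indep]) (use K B in \<open>auto simp: Z_pos\<close>)
  have cyl: "{x \<in> space ?Pe. \<forall>t\<in>{1..K}. x t \<in> C t} \<in> sets ?Pe" if "\<And>t. C t \<in> sets borel" for C
  proof -
    have "(\<lambda>x. x t) \<in> borel_measurable ?Pe" if "t \<in> {1..K}" for t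
      using that by (intro measurable_component_singleton) auto
    then show ?thesis using that by (intro sets.sets_Collect_finite_All) (auto intro!: measurable_sets_borel simp: vimage_def Int_def[symmetric] measurable_sets_Collect)
  qed
  have Pboth: "prob (?pos \<inter> ?neg) = prob ?pos * prob ?neg"
  proof -
    let ?A = "{x \<in> space ?Pe. \<forall>t\<in>{1..K}. x t \<in> B (int t)}" and ?B = "{x \<in> space ?Pe. \<forall>t\<in>{1..K}. x t \<in> B (- int t)}"
    have "prob ((\<lambda>\<omega>. (\<lambda>t\<in>{1..}. \<epsilon> n t \<omega>, \<lambda>t\<in>{1..}. \<eta> n t \<omega>)) -` (?A \<times> ?B) \<inter> space (M n))
      = prob ((\<lambda>\<omega>. \<lambda>t\<in>{1..}. \<epsilon> n t \<omega>) -` ?A \<inter> space (M n)) * prob ((\<lambda>\<omega>. \<lambda>t\<in>{1..}. \<eta> n t \<omega>) -` ?B \<inter> space (M n))"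
      by (rule indep_varD[OF \<epsilon>_\<eta>_indep]) (intro cyl B)+
    also have "(\<lambda>\<omega>. \<lambda>t\<in>{1..}. \<epsilon> n t \<omega>) -` ?A \<inter> space (M n) = ?pos"
      unfolding pos_eq using K by (auto simp: space_PiM)
    also have "(\<lambda>\<omega>. \<lambda>t\<in>{1..}. \<eta> n t \<omega>) -` ?B \<inter> space (M n) = ?neg"
      unfolding neg_eq using K by (auto simp: space_PiM)
    also have "(\<lambda>\<omega>. (\<lambda>t\<in>{1..}. \<epsilon> n t \<omega>, \<lambda>t\<in>{1..}. \<eta> n t \<omega>)) -` (?A \<times> ?B) \<inter> space (M n) = ?pos \<inter> ?neg"
      unfolding pos_eq neg_eq using K by (auto simp: space_PiM)
    finally show ?thesis .
  qed
  have "prob (?E 0 \<inter> (?pos \<inter> ?neg)) = prob (?E 0) * prob (?pos \<inter> ?neg)"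
  proof (rule indep_setD[OF y0_indep])
    show "?E 0 \<in> sets (vimage_algebra (space (M n)) (y n 0) borel)"
      unfolding Z_simps by (rule in_vimage_algebra[OF B])
    let ?Q = "PiM {1::nat..} (\<lambda>_. borel \<Otimes>\<^sub>M borel :: (real \<times> real) measure)"
    let ?C = "{x \<in> space ?Q. \<forall>t\<in>{1..K}. x t \<in> B (int t) \<times> B (- int t)}"
    have "?C \<in> sets ?Q"
    proof (rule sets.sets_Collect_finite_All)
      fix t assume t: "t \<in> {1..K}"
      have "(\<lambda>x. x t) \<in> measurable ?Q (borel \<Otimes>\<^sub>M borel)"
        using t by (intro measurable_component_singleton) auto
      from measurable_sets[OF this, of "B (int t) \<times> B (- int t)"] B
      show "{x \<in> space ?Q. x t \<in> B (int t) \<times> B (- int t)} \<in> sets ?Q"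
        by (simp add: vimage_def Int_def conj_commute)
    qed simp
    from in_vimage_algebra[OF this, of "\<lambda>\<omega>. \<lambda>t\<in>{1..}. (\<epsilon> n t \<omega>, \<eta> n t \<omega>)" "space (M n)"]
    have "(\<lambda>\<omega>. \<lambda>t\<in>{1..}. (\<epsilon> n t \<omega>, \<eta> n t \<omega>)) -` ?C \<inter> space (M n)
       \<in> sets (vimage_algebra (space (M n)) (\<lambda>\<omega>. \<lambda>t\<in>{1..}. (\<epsilon> n t \<omega>, \<eta> n t \<omega>)) ?Q)" .
    also have "(\<lambda>\<omega>. \<lambda>t\<in>{1..}. (\<epsilon> n t \<omega>, \<eta> n t \<omega>)) -` ?C \<inter> space (M n) = ?pos \<inter> ?neg"
      unfolding pos_eq neg_eq using K by (auto simp: space_PiM space_pair_measure)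
    finally show "?pos \<inter> ?neg \<in> sets (vimage_algebra (space (M n)) (\<lambda>\<omega>. \<lambda>t\<in>{1..}. (\<epsilon> n t \<omega>, \<eta> n t \<omega>)) ?Q)" .
  qed
  then show ?thesis
    unfolding inter prod Pboth Ppos Pneg .
qed

lemma indep_seq_Z: "indep_seq (M n) (Z n)"
proof -
  interpret prob_space "M n" by (rule prob_space_M)
  have "indep_sets (\<lambda>i. {Z n i -` A \<inter> space (M n) | A. A \<in> sets borel}) UNIV"
    unfolding indep_sets_def
  proof (intro conjI ballI allI impI)
    show "{Z n i -` A \<inter> space (M n) | A. A \<in> sets borel} \<subseteq> events" for i
      using Z_measurable by (auto intro: measurable_sets)
  next
    fix J A assume J: "J \<noteq> {}" "finite J" and A: "A \<in> (\<Pi> j\<in>J. {Z n j -` A \<inter> space (M n) | A. A \<in> sets borel})"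
    then have "\<forall>j\<in>J. \<exists>B. A j = Z n j -` B \<inter> space (M n) \<and> B \<in> sets borel" by (auto simp: Pi_iff)
    then obtain B0 where B0: "\<And>j. j \<in> J \<Longrightarrow> A j = Z n j -` B0 j \<inter> space (M n)" "\<And>j. j \<in> J \<Longrightarrow> B0 j \<in> sets borel"
      by metis
    \<comment> \<open>Coordinates outside \<open>J\<close> receive the trivial condition, so that
      \<open>J\<close> can be enlarged to a symmetric range.\<close>
    define B where "B i = (if i \<in> J then B0 i else UNIV)" for i
    define K where "K = nat (Max ((\<lambda>i. \<bar>i\<bar>) ` J)) + 1"
    have JK: "J \<subseteq> {- int K..int K}"
    proof
      fix i assume "i \<in> J"
      then have "\<bar>i\<bar> \<le> Max ((\<lambda>i. \<bar>i\<bar>) ` J)" using J by (intro Max_ge) auto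
      then show "i \<in> {- int K..int K}" by (auto simp: K_def)
    qed
    have sets: "B i \<in> sets borel" for i using B0(2) by (simp add: B_def)
    have "(\<Inter>j\<in>J. A j) = (\<Inter>i\<in>{- int K..int K}. Z n i -` B i \<inter> space (M n))"
      using JK J(1) B0(1) by (auto simp: B_def split: if_splits)
    moreover have "(\<Prod>i\<in>{- int K..int K}. prob (Z n i -` B i \<inter> space (M n))) = (\<Prod>j\<in>J. prob (A j))"
      using JK by (intro prod.mono_neutral_cong_right) (auto simp: B_def B0 prob_space)
    ultimately show "prob (\<Inter>j\<in>J. A j) = (\<Prod>j\<in>J. prob (A j))"
      using prob_Z_cylinder[OF sets, of K n] by (simp add: K_def)
  qed
  then show ?thesis
    by unfold_locales (auto simp: indep_vars_def2 Z_measurable)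
qed

text \<open>Read off at row 0 and time 1. The law of \<open>\<epsilon>\<close> is common to all rows
  and times, so this one number serves everywhere and the constants built from it do not vary with
  \<open>n\<close>.\<close>

definition \<kappa> :: real where "\<kappa> = (\<integral>\<omega>. \<epsilon> 0 1 \<omega> ^ 4 \<partial>M 0)"

lemma innov_kurtosis:
  assumes "t \<ge> 1"
  shows "(\<integral>\<omega>. \<epsilon> n t \<omega> ^ 4 \<partial>M n) = \<kappa>"
proof -
  have "(\<integral>\<omega>. \<epsilon> n t \<omega> ^ 4 \<partial>M n) = (\<integral>x. x ^ 4 \<partial>distr (M n) borel (\<epsilon> n t))"
    using assms by (intro integral_distr[symmetric] \<epsilon>_measurable) auto
  also have "\<dots> = (\<integral>x. x ^ 4 \<partial>distr (M 0) borel (\<epsilon> 0 1))"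
    using \<epsilon>_distr[of t 1 n 0] assms by simp
  also have "\<dots> = \<kappa>"
    unfolding \<kappa>_def by (intro integral_distr \<epsilon>_measurable) auto
  finally show ?thesis .
qed

lemma sv_process_Z:
  assumes "1 \<le> k n" "c \<le> k n" "integrable (M n) (\<lambda>\<omega>. y n 0 \<omega> ^ 4)"
    "prob_space.expectation (M n) (\<lambda>\<omega>. y n 0 \<omega> ^ 4) \<le> (k n)\<^sup>2"
  shows "sv_process (M n) (Z n) c \<alpha> (\<phi> n) \<kappa> (k n)"
proof -
  interpret indep_seq "M n" "Z n" by (rule indep_seq_Z)
  show ?thesis
    by unfold_locales
      (use assms c_pos \<alpha>_pos \<phi>_abs \<eta>_normal \<epsilon>_fourth \<epsilon>_mean \<epsilon>_square innov_kurtosis in \<open>auto simp: Z_simps\<close>)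
qed

text \<open>The recursions hold only up to time \<open>n\<close>, hence \<open>t \<le> n\<close>.
  Positivity of \<open>\<sigma>\<close> settles the sign that the equation for the logarithm of its
  square leaves open.\<close>

lemma path_eq:
  assumes proc: "sv_process (M n) (Z n) c \<alpha> (\<phi> n) \<kappa> (k n)" and \<rho>: "\<rho> n = 1 - c / k n"
    and t: "t \<le> n" and \<omega>: "\<omega> \<in> space (M n)"
  shows "\<sigma> n t \<omega> = sv_process.vol (Z n) (\<phi> n) t \<omega> \<and> y n t \<omega> = sv_process.Y (Z n) c (\<phi> n) (k n) t \<omega>"
proof -
  interpret sv_process "M n" "Z n" c \<alpha> "\<phi> n" \<kappa> "k n" by (rule proc)
  have vol: "\<sigma> n t \<omega> = vol t \<omega>" if "t \<le> n" for t
  proof -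
    have pos: "\<sigma> n t \<omega> > 0" if "t \<le> n" for t
      using \<sigma>_pos[OF \<omega>, of t] \<sigma>_0[OF \<omega>] that by (cases "t = 0") auto
    have "ln ((\<sigma> n t \<omega>)\<^sup>2) = logvol t \<omega>"
      using that
    proof (induction t)
      case 0
      then show ?case by (simp add: \<sigma>_0[OF \<omega>])
    next
      case (Suc t)
      then have "ln ((\<sigma> n (Suc t) \<omega>)\<^sup>2) = \<phi> n * logvol t \<omega> + \<eta> n (Suc t) \<omega>"
        using \<sigma>_rec[OF \<omega>, of "Suc t"] by simp
      then show ?case using Z_simps(3)[of "Suc t" n] by simp
    qed
    moreover have "ln ((\<sigma> n t \<omega>)\<^sup>2) = 2 * ln (\<sigma> n t \<omega>)" using pos[OF that] by (simp add: ln_realpow)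
    ultimately have "ln (\<sigma> n t \<omega>) = logvol t \<omega> / 2" by simp
    then have "exp (ln (\<sigma> n t \<omega>)) = vol t \<omega>" by (simp add: vol_def)
    then show ?thesis using pos[OF that] by simp
  qed
  have "y n t \<omega> = Y t \<omega>" using t
  proof (induction t)
    case 0
    then show ?case by (simp add: Z_simps)
  next
    case (Suc t)
    then have "y n (Suc t) \<omega> = \<rho> n * Y t \<omega> + vol (Suc t) \<omega> * \<epsilon> n (Suc t) \<omega>"
      using y_rec[OF \<omega>, of "Suc t"] u_eq[OF \<omega>, of "Suc t"] vol[of "Suc t"] by simp
    then show ?case using Z_simps(2)[of "Suc t" n] by (simp add: \<rho> \<rho>_def)
  qed
  with vol[OF t] show ?thesis by simp
qed

lemma estimator_eq:
  assumes proc: "sv_process (M n) (Z n) c \<alpha> (\<phi> n) \<kappa> (k n)" and \<rho>: "\<rho> n = 1 - c / k n"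
    and \<omega>: "\<omega> \<in> space (M n)"
  shows "ls_denom n (\<lambda>t. y n t \<omega>) = sv_process.D (Z n) c (\<phi> n) (k n) n \<omega>"
    and "ls_denom n (\<lambda>t. y n t \<omega>) \<noteq> 0 \<Longrightarrow> ls_estimator n (\<lambda>t. y n t \<omega>)
      = 1 - c / k n + sv_process.N (Z n) c (\<phi> n) (k n) n \<omega> / sv_process.D (Z n) c (\<phi> n) (k n) n \<omega>"
proof -
  interpret sv_process "M n" "Z n" c \<alpha> "\<phi> n" \<kappa> "k n" by (rule proc)
  have y: "y n t \<omega> = Y t \<omega>" if "t \<le> n" for t
    using path_eq[OF proc \<rho> that \<omega>] by simp
  show D: "ls_denom n (\<lambda>t. y n t \<omega>) = D n \<omega>"
    unfolding ls_denom_def D_def sum_atLeast1_shift by (intro sum.cong refl) (simp add: y)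
  assume nz: "ls_denom n (\<lambda>t. y n t \<omega>) \<noteq> 0"
  have "(\<Sum>t=1..n. y n (t - 1) \<omega> * y n t \<omega>) = (\<Sum>t<n. Y t \<omega> * Y (Suc t) \<omega>)"
    unfolding sum_atLeast1_shift by (intro sum.cong refl) (simp add: y del: Y.simps)
  also have "\<dots> = local.\<rho> * D n \<omega> + N n \<omega>"
    by (simp add: D_def N_def sum_distrib_left power2_eq_square algebra_simps flip: sum.distrib)
  finally show "ls_estimator n (\<lambda>t. y n t \<omega>) = 1 - c / k n + N n \<omega> / D n \<omega>"
    using nz unfolding ls_estimator_def D by (simp add: add_divide_distrib \<rho>_def)
qed

text \<open>All moment bounds are polynomial in \<open>exp V\<close>, which is at most a power of \<open>r\<close> whether
  \<open>r\<close> diverges (then \<open>\<phi> \<longrightarrow> 1\<close>) or is constant.\<close>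

lemma exp_V_le_powr: "\<exists>q>0. \<forall>\<^sub>F n in sequentially. exp (\<alpha>\<^sup>2 / (1 - (\<phi> n)\<^sup>2)) \<le> r n powr q"
proof -
  have "\<exists>q>0. \<forall>\<^sub>F n in sequentially. \<alpha>\<^sup>2 / (1 - (\<phi> n)\<^sup>2) \<le> q * ln (r n)"
    using r_at_top_or_const
  proof
    assume r: "filterlim r at_top sequentially"
    have "\<forall>\<^sub>F n in sequentially. exp d \<le> r n" using r by (simp add: filterlim_at_top)
    then have "\<forall>\<^sub>F n in sequentially. \<alpha>\<^sup>2 / (1 - (\<phi> n)\<^sup>2) \<le> \<alpha>\<^sup>2 / d * ln (r n)"
    proof eventually_elim
      case (elim n)
      have ln: "ln (r n) > 0" using r_gt_1[of n] by simp
      have "ln (exp d) \<le> ln (r n)" using elim by (intro ln_mono) auto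
      then have "d / ln (r n) \<le> 1" using ln by simp
      then have \<phi>: "\<phi> n \<ge> 0" by (simp add: \<phi>_eq)
      \<comment> \<open>As \<open>\<phi> n \<ge> 0\<close>, the quantity \<open>1 - \<phi>^2\<close>
        is at least \<open>1 - \<phi> = d / ln r\<close>, so the stationary log-variance is at most
        \<open>\<alpha>^2 / d\<close> times \<open>ln r\<close>.\<close>
      have "d / ln (r n) * 1 \<le> (1 - \<phi> n) * (1 + \<phi> n)"
        using \<phi> d_pos ln by (intro mult_mono) (auto simp: \<phi>_eq)
      then have "d / ln (r n) \<le> 1 - (\<phi> n)\<^sup>2" by (simp add: power2_eq_square algebra_simps)
      moreover have pos: "0 < d / ln (r n)" using d_pos ln by simp
      ultimately have "\<alpha>\<^sup>2 / (1 - (\<phi> n)\<^sup>2) \<le> \<alpha>\<^sup>2 / (d / ln (r n))"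
        by (intro divide_left_mono mult_pos_pos) (assumption | linarith | simp)+
      then show ?case by simp
    qed
    then show ?thesis using \<alpha>_pos d_pos by (intro exI[of _ "\<alpha>\<^sup>2 / d"]) auto
  next
    assume "\<exists>r0. \<forall>n. r n = r0"
    then obtain r0 where r0: "\<And>n. r n = r0" by auto
    define V0 where "V0 = \<alpha>\<^sup>2 / (1 - (\<phi> 0)\<^sup>2)"
    have "(\<phi> 0)\<^sup>2 < 1" using \<phi>_abs[of 0] by (simp add: abs_square_less_1)
    then have V0: "V0 > 0" using \<alpha>_pos by (simp add: V0_def)
    have ln: "ln r0 > 0" using r_gt_1[of 0] r0 by simp
    have eq: "\<phi> n = \<phi> 0" for n by (simp add: \<phi>_eq r0)
    have "\<alpha>\<^sup>2 / (1 - (\<phi> n)\<^sup>2) \<le> V0 / ln r0 * ln (r n)" for n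
      unfolding eq[of n] using ln by (simp add: V0_def r0)
    then show ?thesis using V0 ln by (intro exI[of _ "V0 / ln r0"]) auto
  qed
  then obtain q where q: "q > 0" "\<forall>\<^sub>F n in sequentially. \<alpha>\<^sup>2 / (1 - (\<phi> n)\<^sup>2) \<le> q * ln (r n)" by auto
  have "\<forall>\<^sub>F n in sequentially. exp (\<alpha>\<^sup>2 / (1 - (\<phi> n)\<^sup>2)) \<le> r n powr q"
    using q(2)
  proof eventually_elim
    case (elim n)
    have "r n powr q = exp (q * ln (r n))" using r_gt_1[of n] by (simp add: powr_def)
    then show ?case using elim by simp
  qed
  with q(1) show ?thesis by blast
qed

text \<open>A power of \<open>R\<close> is eventually below \<open>r powr (q * p)\<close> with
  \<open>q\<close> fixed, so the rate conditions are invoked at the exponent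
  \<open>q * p\<close>.\<close>

lemma
  assumes rate_r: "\<And>q::real. q > 0 \<Longrightarrow> (\<lambda>n. r n powr q) \<in> o(k)"
    and rate_kr: "\<And>q::real. q > 0 \<Longrightarrow> (\<lambda>n. k n * r n powr q) \<in> o(\<lambda>n. real n)"
    and p: "p \<ge> (1::nat)"
  defines "R \<equiv> \<lambda>n. exp (\<alpha>\<^sup>2 / (1 - (\<phi> n)\<^sup>2))"
  shows R_power_over_k: "(\<lambda>n. R n ^ p / k n) \<longlonglongrightarrow> 0"
    and k_R_power_over_n: "(\<lambda>n. k n * R n ^ p / real n) \<longlonglongrightarrow> 0"
proof -
  obtain q where q: "q > 0" "\<forall>\<^sub>F n in sequentially. R n \<le> r n powr q"
    using exp_V_le_powr unfolding R_def by auto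
  have le: "\<forall>\<^sub>F n in sequentially. R n ^ p \<le> r n powr (q * p)"
    using q(2)
  proof eventually_elim
    case (elim n)
    have "R n ^ p \<le> (r n powr q) ^ p" using elim by (intro power_mono) (auto simp: R_def)
    also have "\<dots> = r n powr (q * p)" using r_gt_1[of n] by (simp add: powr_powr[symmetric] powr_realpow)
    finally show ?case .
  qed
  have qp: "q * real p > 0" using q(1) p by simp
  show "(\<lambda>n. R n ^ p / k n) \<longlonglongrightarrow> 0"
  proof (rule tendsto_sandwich[OF _ _ tendsto_const smalloD_tendsto[OF rate_r[OF qp]]])
    show "\<forall>\<^sub>F n in sequentially. 0 \<le> R n ^ p / k n"
      using k_pos by (auto simp: R_def less_imp_le)
    show "\<forall>\<^sub>F n in sequentially. R n ^ p / k n \<le> r n powr (q * p) / k n"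
      using le by eventually_elim (rule divide_right_mono, assumption, rule less_imp_le[OF k_pos])
  qed
  show "(\<lambda>n. k n * R n ^ p / real n) \<longlonglongrightarrow> 0"
  proof (rule tendsto_sandwich[OF _ _ tendsto_const smalloD_tendsto[OF rate_kr[OF qp]]])
    show "\<forall>\<^sub>F n in sequentially. 0 \<le> k n * R n ^ p / real n"
      using k_pos by (auto simp: R_def less_imp_le)
    show "\<forall>\<^sub>F n in sequentially. k n * R n ^ p / real n \<le> k n * r n powr (q * p) / real n"
      using le by eventually_elim (rule divide_right_mono[OF mult_left_mono], assumption, rule less_imp_le[OF k_pos], simp)
  qed
qed

end

text \<open>Integrability is stated beside the moment condition because the Bochner integral of a
  non-integrable function is 0, so that smallness of the expectation alone would say
  nothing.\<close>

locale sv_ar_rates = sv_ar_model +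
  assumes nearly_stationary: "\<And>n. \<rho> n = 1 - c / k n"
    and rate_r: "\<And>q::real. q > 0 \<Longrightarrow> (\<lambda>n. r n powr q) \<in> o(k)"
    and rate_kr: "\<And>q::real. q > 0 \<Longrightarrow> (\<lambda>n. k n * r n powr q) \<in> o(\<lambda>n. real n)"
    and y0_integrable: "\<forall>\<^sub>F n in sequentially. integrable (M n) (\<lambda>\<omega>. y n 0 \<omega> ^ 4)"
    and y0_moment: "(\<lambda>n. prob_space.expectation (M n) (\<lambda>\<omega>. y n 0 \<omega> ^ 4)) \<in> o(\<lambda>n. (k n)\<^sup>2)"
begin

section \<open>Asymptotics of the error bounds along the array\<close>

lemma eventually_sv_process: "\<forall>\<^sub>F n in sequentially. sv_process (M n) (Z n) c \<alpha> (\<phi> n) \<kappa> (k n)"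
proof -
  have "\<forall>\<^sub>F n in sequentially. max 1 c \<le> k n" using k_at_top unfolding filterlim_at_top by blast
  moreover have "\<forall>\<^sub>F n in sequentially. norm (prob_space.expectation (M n) (\<lambda>\<omega>. y n 0 \<omega> ^ 4)) \<le> 1 * norm ((k n)\<^sup>2)"
    by (rule landau_o.smallD[OF y0_moment]) simp
  ultimately show ?thesis
    using y0_integrable by eventually_elim (auto intro: sv_process_Z)
qed

definition logvar :: "nat \<Rightarrow> real" where "logvar n = \<alpha>\<^sup>2 / (1 - (\<phi> n)\<^sup>2)"
definition rate :: "nat \<Rightarrow> real" where "rate n = k n * exp (logvar n) ^ 8 / n"
definition block :: "nat \<Rightarrow> nat" where "block n = nat \<lfloor>sqrt (sqrt (k n))\<rfloor>"

lemma R_eq: "sv_process.R \<alpha> (\<phi> n) = exp (logvar n)" if "sv_process (M n) (Z n) c \<alpha> (\<phi> n) \<kappa> (k n)"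
  using sv_process.R_def[OF that] sv_process.V_def[OF that] by (simp add: logvar_def)

lemma rate_tendsto: "rate \<longlonglongrightarrow> 0"
  using k_R_power_over_n[OF rate_r rate_kr, of 8] unfolding rate_def logvar_def by simp

lemma eventually_block: "\<forall>\<^sub>F n in sequentially. 1 \<le> block n \<and> block n \<le> n \<and> 1 \<le> k n"
proof -
  have "\<forall>\<^sub>F n in sequentially. 1 \<le> k n" using k_at_top by (simp add: filterlim_at_top)
  moreover have "\<forall>\<^sub>F n in sequentially. norm (k n) \<le> 1 * norm (real n)"
    by (rule landau_o.smallD[OF k_smallo]) simp
  ultimately show ?thesis
  proof eventually_elim
    case (elim n)
    have s: "1 \<le> sqrt (sqrt (k n))" using elim by simp
    have "sqrt x \<le> x" if "1 \<le> x" for x :: real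
      using that by (intro real_le_lsqrt) (auto simp: power2_eq_square)
    then have "sqrt (sqrt (k n)) \<le> k n" using elim by (meson order_trans real_sqrt_ge_one)
    also have "k n \<le> n" using elim by simp
    finally have "sqrt (sqrt (k n)) \<le> n" .
    then have "block n \<le> n" unfolding block_def by linarith
    moreover have "1 \<le> block n" using s unfolding block_def by linarith
    ultimately show ?case using elim by blast
  qed
qed

text \<open>With \<open>block\<close> about the fourth root of \<open>k\<close>, the ratio under the
  first root and the whole second term are bounded by multiples of fourth roots of
  \<open>R ^ p / k\<close>, with \<open>p = 52\<close> and \<open>p = 24\<close>; these vanish for
  every \<open>p\<close>.\<close>

lemma block_terms_tendsto:
  shows "(\<lambda>n. sqrt (exp (logvar n) ^ 13 / block n)) \<longlonglongrightarrow> 0"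
    and "(\<lambda>n. block n * sqrt (exp (logvar n) ^ 12 / k n)) \<longlonglongrightarrow> 0"
proof -
  let ?R = "\<lambda>n. exp (logvar n)"
  have lim: "(\<lambda>n. ?R n ^ p / k n) \<longlonglongrightarrow> 0" if "p \<ge> 1" for p
    using R_power_over_k[OF rate_r rate_kr that] unfolding logvar_def .
  have lim4: "(\<lambda>n. sqrt (sqrt (?R n ^ p / k n))) \<longlonglongrightarrow> 0" if "p \<ge> 1" for p
    using tendsto_real_sqrt[OF tendsto_real_sqrt[OF lim[OF that]]] by simp
  have root4: "sqrt (sqrt (?R n ^ (4 * m))) = ?R n ^ m" for n m
  proof -
    have "sqrt (?R n ^ (4 * m)) = ?R n ^ (2 * m)"
      by (rule real_sqrt_unique) (auto simp flip: power_mult simp: mult.commute)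
    moreover have "sqrt (?R n ^ (2 * m)) = ?R n ^ m"
      by (rule real_sqrt_unique) (auto simp flip: power_mult simp: mult.commute)
    ultimately show ?thesis by simp
  qed
  have "(\<lambda>n. ?R n ^ 13 / block n) \<longlonglongrightarrow> 0"
  proof (rule tendsto_sandwich[OF _ _ tendsto_const])
    show "\<forall>\<^sub>F n in sequentially. 0 \<le> ?R n ^ 13 / block n" by simp
    show "(\<lambda>n. 2 * sqrt (sqrt (?R n ^ (4 * 13) / k n))) \<longlonglongrightarrow> 0"
      using tendsto_mult_left[OF lim4[of "4 * 13"], of 2] by simp
    show "\<forall>\<^sub>F n in sequentially. ?R n ^ 13 / block n \<le> 2 * sqrt (sqrt (?R n ^ (4 * 13) / k n))"
      using eventually_block
    proof eventually_elim
      case (elim n)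
      define x where "x = sqrt (sqrt (k n))"
      have x: "1 \<le> x" using elim by (simp add: x_def)
      \<comment> \<open>For \<open>x \<ge> 1\<close>, rounding down loses at most half.\<close>
      have b: "x / 2 \<le> block n"
      proof -
        have "real (block n) = of_int \<lfloor>x\<rfloor>" using x by (simp add: block_def x_def)
        moreover have "1 \<le> \<lfloor>x\<rfloor>" using x by simp
        moreover have "x < of_int \<lfloor>x\<rfloor> + 1" by linarith
        ultimately show ?thesis by linarith
      qed
      have "?R n ^ 13 / block n \<le> ?R n ^ 13 / (x / 2)"
        using b x by (intro divide_left_mono mult_pos_pos) auto
      also have "\<dots> = 2 * (sqrt (sqrt (?R n ^ (4 * 13))) / x)" unfolding root4 by simp
      finally show ?case by (simp add: x_def real_sqrt_divide)
    qed
  qed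
  from tendsto_real_sqrt[OF this] show "(\<lambda>n. sqrt (exp (logvar n) ^ 13 / block n)) \<longlonglongrightarrow> 0" by simp
  show "(\<lambda>n. block n * sqrt (exp (logvar n) ^ 12 / k n)) \<longlonglongrightarrow> 0"
  proof (rule tendsto_sandwich[OF _ _ tendsto_const])
    show "\<forall>\<^sub>F n in sequentially. 0 \<le> block n * sqrt (exp (logvar n) ^ 12 / k n)"
      by (intro always_eventually allI mult_nonneg_nonneg) (auto intro!: divide_nonneg_pos k_pos)
    show "(\<lambda>n. sqrt (sqrt (?R n ^ (4 * 6) / k n))) \<longlonglongrightarrow> 0" using lim4[of "4 * 6"] by simp
    show "\<forall>\<^sub>F n in sequentially. block n * sqrt (exp (logvar n) ^ 12 / k n) \<le> sqrt (sqrt (?R n ^ (4 * 6) / k n))"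
      using eventually_block
    proof eventually_elim
      case (elim n)
      define x where "x = sqrt (sqrt (k n))"
      have x: "1 \<le> x" using elim by (simp add: x_def)
      have xx: "sqrt (k n) = x * x" using elim by (simp add: x_def)
      have b: "block n \<le> x"
      proof -
        have "real (block n) = of_int \<lfloor>x\<rfloor>" using x by (simp add: block_def x_def)
        then show ?thesis by simp
      qed
      have R6: "sqrt (?R n ^ 12) = ?R n ^ 6"
        by (rule real_sqrt_unique) (auto simp flip: power_mult)
      have "block n * sqrt (exp (logvar n) ^ 12 / k n) \<le> x * (?R n ^ 6 / (x * x))"
        unfolding real_sqrt_divide R6 xx using b x by (intro mult_right_mono) auto
      also have "\<dots> = sqrt (sqrt (?R n ^ (4 * 6))) / x" unfolding root4 using x by simp
      finally show ?case by (simp add: x_def real_sqrt_divide)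
    qed
  qed
qed

abbreviation DB :: "nat \<Rightarrow> real" where "DB n \<equiv> sv_process.D_bound c \<alpha> (\<phi> n) \<kappa> (k n) n / n"
abbreviation QB :: "nat \<Rightarrow> real" where "QB n \<equiv> sv_process.Q_bound c \<alpha> (\<phi> n) \<kappa> (k n) n (block n)"
abbreviation CC :: real where "CC \<equiv> sv_process.C c \<kappa>"

text \<open>The bound for fixed parameters with \<open>rate\<close> inserted. Its coefficients are
  the same in every row, so the limit can be taken term by term; likewise for
  \<open>QU\<close>.\<close>

definition DU :: "nat \<Rightarrow> real" where
  "DU n = sqrt \<kappa> * sqrt (rate n) + sqrt (8 / \<alpha>\<^sup>2) * sqrt (rate n) + 2 * sqrt (sqrt CC) * sqrt (rate n) + 2 * sqrt CC * rate n"

definition QU :: "nat \<Rightarrow> real" where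
  "QU n = 2 * c * sqrt (\<kappa> * CC) * sqrt (rate n) + 4 * c * sqrt (8 * CC / \<alpha>\<^sup>2) * sqrt (exp (logvar n) ^ 13 / block n)
    + 2 * c * sqrt (2 * sv_process.K7 c \<kappa>) * (block n * sqrt (exp (logvar n) ^ 12 / k n)) + DU n"

lemma DU_tendsto: "DU \<longlonglongrightarrow> 0"
proof -
  have "(\<lambda>n. sqrt (rate n)) \<longlonglongrightarrow> 0" using tendsto_real_sqrt[OF rate_tendsto] by simp
  then show ?thesis unfolding DU_def
    by (intro tendsto_add_zero tendsto_mult_right_zero rate_tendsto)
qed

lemma QU_tendsto: "QU \<longlonglongrightarrow> 0"
proof -
  have "(\<lambda>n. sqrt (rate n)) \<longlonglongrightarrow> 0" using tendsto_real_sqrt[OF rate_tendsto] by simp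
  then show ?thesis unfolding QU_def
    by (intro tendsto_add_zero tendsto_mult_right_zero block_terms_tendsto DU_tendsto)
qed

lemma eventually_bounds:
  "\<forall>\<^sub>F n in sequentially. sv_process (M n) (Z n) c \<alpha> (\<phi> n) \<kappa> (k n) \<and> 1 \<le> block n \<and> 2 \<le> n
    \<and> DB n \<le> DU n \<and> QB n \<le> QU n
    \<and> n * (\<kappa> * (sv_process.K2 c \<alpha> (\<phi> n) \<kappa> (k n))\<^sup>2 * (2 * c / (k n * n))\<^sup>2) \<le> 4 * c\<^sup>2 * \<kappa> * CC * rate n"
  using eventually_sv_process eventually_block eventually_ge_at_top[of 2]
proof eventually_elim
  case (elim n)
  interpret sv_process "M n" "Z n" c \<alpha> "\<phi> n" \<kappa> "k n" by (rule elim(1))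
  have n: "n > 0" and b: "1 \<le> block n" "block n \<le> n" using elim by auto
  have rate: "k n * R ^ 8 / n = rate n" by (simp add: rate_def R_eq[OF elim(1)])
  have D: "D_bound n / n \<le> DU n"
    using D_bound_le[OF n] unfolding rate DU_def .
  have "Q_bound n (block n) \<le> QU n"
    using Q_bound_le[OF n b, unfolded rate, unfolded R_eq[OF elim(1)]] D unfolding QU_def by linarith
  with D elim fourth_moment_sum_le[OF n] show ?case unfolding rate by simp
qed

section \<open>Normal limit and coverage\<close>

definition W :: "nat \<Rightarrow> 'a \<Rightarrow> real" where
  "W n \<omega> = sv_process.N (Z n) c (\<phi> n) (k n) n \<omega> / sv_process.scale c \<alpha> (\<phi> n) (k n) n"

lemma W_measurable: "\<forall>\<^sub>F n in sequentially. W n \<in> borel_measurable (M n)"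
  using eventually_sv_process
proof eventually_elim
  case (elim n)
  interpret sv_process "M n" "Z n" c \<alpha> "\<phi> n" \<kappa> "k n" by (rule elim)
  show ?case unfolding W_def by measurable
qed

lemma W_char_tendsto:
  "(\<lambda>n. \<integral>\<omega>. iexp (\<theta> * W n \<omega>) \<partial>M n) \<longlonglongrightarrow> complex_of_real (exp (- \<theta>\<^sup>2 / 2))"
proof (rule tendstoI)
  fix e :: real assume e: "e > 0"
  define K where "K = 2 + 2 * \<bar>\<theta>\<bar>^3 * (3 * exp 2 + 1) + exp (2 * \<theta>\<^sup>2) * (1 + 2 * \<theta>\<^sup>2) + \<theta>\<^sup>2 + 1"
  have K: "K > 0" unfolding K_def by (intro add_pos_nonneg add_nonneg_nonneg mult_nonneg_nonneg) auto
  \<comment> \<open>It depends on \<open>\<theta>\<close> through \<open>K\<close>, which is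
    harmless: the continuity theorem asks only for pointwise convergence of characteristic
    functions.\<close>
  define \<delta> where "\<delta> = min 1 (e / (2 * K))"
  have \<delta>: "0 < \<delta>" "\<delta> \<le> 1" using e K by (auto simp: \<delta>_def)
  have "\<delta> * K \<le> e / (2 * K) * K" using K by (intro mult_right_mono) (auto simp: \<delta>_def)
  then have \<delta>K: "\<delta> * K < e" using K e by simp
  have \<delta>2: "0 < \<delta>\<^sup>2" using \<delta> by simp
  have "\<forall>\<^sub>F n in sequentially. QU n < \<delta>\<^sup>2" using order_tendstoD(2)[OF QU_tendsto \<delta>2] .
  moreover have "\<forall>\<^sub>F n in sequentially. 4 * c\<^sup>2 * \<kappa> * CC * rate n < \<delta>\<^sup>2"
    using order_tendstoD(2)[OF tendsto_mult_right_zero[OF rate_tendsto] \<delta>2] .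
  ultimately show "\<forall>\<^sub>F n in sequentially. dist (\<integral>\<omega>. iexp (\<theta> * W n \<omega>) \<partial>M n) (complex_of_real (exp (- \<theta>\<^sup>2 / 2))) < e"
    using eventually_bounds
  proof eventually_elim
    case (elim n)
    interpret sv_process "M n" "Z n" c \<alpha> "\<phi> n" \<kappa> "k n" using elim(3) by blast
    have "cmod ((\<integral>\<omega>. iexp (\<theta> * (N n \<omega> / scale n)) \<partial>M n) - complex_of_real (exp (- \<theta>\<^sup>2 / 2))) \<le> \<delta> * K"
      unfolding K_def by (rule char_N_bound[of n "block n"]) (use elim \<delta> in auto)
    then show ?case using \<delta>K by (simp add: W_def dist_norm)
  qed
qed

lemma W_abs_le_tendsto:
  "0 < x \<Longrightarrow> (\<lambda>n. measure (M n) {\<omega> \<in> space (M n). \<bar>W n \<omega>\<bar> \<le> x}) \<longlonglongrightarrow> 2 * cdf std_normal_distribution x - 1"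
  by (rule char_conv_imp_abs_le_conv[OF prob_space_M W_measurable W_char_tendsto])

text \<open>The model supplies measurability of the initial value and of the innovations; for later
  times it comes from the identification with \<open>Y\<close>.\<close>

lemma y_measurable:
  "sv_process (M n) (Z n) c \<alpha> (\<phi> n) \<kappa> (k n) \<Longrightarrow> t \<le> n \<Longrightarrow> y n t \<in> borel_measurable (M n)"
  using path_eq[OF _ nearly_stationary] sv_process.Y_measurable
  by (subst measurable_cong[where g="sv_process.Y (Z n) c (\<phi> n) (k n) t"]) blast+

lemma estimator_measurable:
  assumes "sv_process (M n) (Z n) c \<alpha> (\<phi> n) \<kappa> (k n)"
  shows "(\<lambda>\<omega>. ls_denom n (\<lambda>t. y n t \<omega>)) \<in> borel_measurable (M n)"
    and "(\<lambda>\<omega>. ls_estimator n (\<lambda>t. y n t \<omega>)) \<in> borel_measurable (M n)"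
proof -
  have y: "y n t \<in> borel_measurable (M n)" if "t \<le> n" for t by (rule y_measurable[OF assms that])
  show D: "(\<lambda>\<omega>. ls_denom n (\<lambda>t. y n t \<omega>)) \<in> borel_measurable (M n)"
    unfolding ls_denom_def by (intro borel_measurable_sum borel_measurable_power y) auto
  show "(\<lambda>\<omega>. ls_estimator n (\<lambda>t. y n t \<omega>)) \<in> borel_measurable (M n)"
    unfolding ls_estimator_def
    by (intro borel_measurable_divide D borel_measurable_sum borel_measurable_times y) auto
qed

text \<open>Both intervals enter only through the event \<open>A\<close> and the squeeze
  \<open>iff\<close> on \<open>good\<close>, so one argument serves for both. The conditioning event
  contains \<open>good\<close>, hence its probability tends to 1 and it leaves the limit
  unchanged.\<close>

lemma coverage_limit:
  fixes A :: "nat \<Rightarrow> 'a \<Rightarrow> bool" and z :: real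
  assumes z: "0 < z"
    and A: "\<forall>\<^sub>F n in sequentially. {\<omega> \<in> space (M n). A n \<omega>} \<in> sets (M n)"
    and iff: "\<And>n h \<omega>. sv_process (M n) (Z n) c \<alpha> (\<phi> n) \<kappa> (k n) \<Longrightarrow> 2 \<le> n \<Longrightarrow> 0 < h \<Longrightarrow> h \<le> 1 / 16 \<Longrightarrow> c / (2 * k n) \<le> h
        \<Longrightarrow> \<omega> \<in> sv_process.good (M n) (Z n) c \<alpha> (\<phi> n) (k n) n h
        \<Longrightarrow> (\<bar>W n \<omega>\<bar> \<le> z * (1 - 16 * h) \<longrightarrow> A n \<omega>) \<and> (A n \<omega> \<longrightarrow> \<bar>W n \<omega>\<bar> \<le> z * (1 + 16 * h))"
    and \<gamma>: "\<And>n. n \<ge> 2 \<Longrightarrow> \<rho> n = 1 - real n powr (- \<gamma> n)"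
  shows "(\<lambda>n. \<P>(\<omega> in M n. A n \<omega> \<bar> ls_denom n (\<lambda>t. y n t \<omega>) \<noteq> 0 \<and> ls_estimator n (\<lambda>t. y n t \<omega>) < 1))
     \<longlonglongrightarrow> 2 * cdf std_normal_distribution z - 1"
proof (rule conditional_coverage_limit[where W=W and F="\<lambda>z. 2 * cdf std_normal_distribution z - 1",
    OF prob_space_M W_measurable A _ W_abs_le_tendsto z])
  show "\<forall>\<^sub>F n in sequentially. {\<omega> \<in> space (M n). ls_denom n (\<lambda>t. y n t \<omega>) \<noteq> 0 \<and> ls_estimator n (\<lambda>t. y n t \<omega>) < 1} \<in> sets (M n)"
    using eventually_sv_process
  proof eventually_elim
    case (elim n)
    note [measurable] = estimator_measurable[OF elim]
    show ?case by measurable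
  qed
  show "isCont (\<lambda>z. 2 * cdf std_normal_distribution z - 1) z"
    using std_normal_isCont_cdf by (intro continuous_intros)
next
  fix e :: real assume e: "0 < e" "e < 1"
  \<comment> \<open>Matches the relative loss \<open>16 * h\<close> of the deterministic
    comparison.\<close>
  define h where "h = e / 16"
  have h: "0 < h" "h \<le> 1 / 16" "16 * h = e" using e by (auto simp: h_def)
  define G where "G n = sv_process.good (M n) (Z n) c \<alpha> (\<phi> n) (k n) n h" for n
  have 1: "\<forall>\<^sub>F n in sequentially. G n \<in> sets (M n)"
    using eventually_sv_process unfolding G_def by eventually_elim (rule sv_process.good_sets)
  have 2: "(\<lambda>n. measure (M n) (G n)) \<longlonglongrightarrow> 1"
  proof (rule tendsto_sandwich[OF _ _ _ tendsto_const])
    have "(\<lambda>n. 1 - 5 * DU n / h) \<longlonglongrightarrow> 1 - 5 * 0 / h" using h by (intro tendsto_intros DU_tendsto) auto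
    then show "(\<lambda>n. 1 - 5 * DU n / h) \<longlonglongrightarrow> 1" by simp
    show "\<forall>\<^sub>F n in sequentially. measure (M n) (G n) \<le> 1"
      using prob_space.prob_le_1[OF prob_space_M] by auto
    show "\<forall>\<^sub>F n in sequentially. 1 - 5 * DU n / h \<le> measure (M n) (G n)"
      using eventually_bounds
    proof eventually_elim
      case (elim n)
      interpret sv_process "M n" "Z n" c \<alpha> "\<phi> n" \<kappa> "k n" using elim by blast
      have "5 * DB n / h \<le> 5 * DU n / h" using elim h by (intro divide_right_mono) auto
      then show ?case using prob_good[of n h] elim h unfolding G_def by simp
    qed
  qed
  have 3: "\<forall>\<^sub>F n in sequentially. \<forall>\<omega>\<in>G n. (ls_denom n (\<lambda>t. y n t \<omega>) \<noteq> 0 \<and> ls_estimator n (\<lambda>t. y n t \<omega>) < 1)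
      \<and> (\<bar>W n \<omega>\<bar> \<le> z * (1 - e) \<longrightarrow> A n \<omega>) \<and> (A n \<omega> \<longrightarrow> \<bar>W n \<omega>\<bar> \<le> z * (1 + e))"
  proof -
    have "\<forall>\<^sub>F n in sequentially. c / (2 * h) \<le> k n" using k_at_top by (simp add: filterlim_at_top)
    then show ?thesis using eventually_bounds
    proof eventually_elim
      case (elim n)
      interpret sv_process "M n" "Z n" c \<alpha> "\<phi> n" \<kappa> "k n" using elim by blast
      have proc: "sv_process (M n) (Z n) c \<alpha> (\<phi> n) \<kappa> (k n)" and n: "2 \<le> n" using elim by auto
      have kh: "c / (2 * k n) \<le> h" using elim(1) h k_pos[of n] by (simp add: field_simps)
      have \<gamma>': "1 - c / k n = 1 - real n powr (- \<gamma> n)" using \<gamma>[OF n] by (simp add: nearly_stationary)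
      show ?case
      proof
        fix \<omega> assume \<omega>: "\<omega> \<in> G n"
        then have sp: "\<omega> \<in> space (M n)" and gd: "\<omega> \<in> good n h" unfolding G_def good_def by auto
        note cov = good_coverage(1,2)[OF n h(1,2) kh z gd \<gamma>']
        have dn: "ls_denom n (\<lambda>t. y n t \<omega>) \<noteq> 0"
          using estimator_eq(1)[OF proc nearly_stationary sp] cov(1) by simp
        show "(ls_denom n (\<lambda>t. y n t \<omega>) \<noteq> 0 \<and> ls_estimator n (\<lambda>t. y n t \<omega>) < 1)
          \<and> (\<bar>W n \<omega>\<bar> \<le> z * (1 - e) \<longrightarrow> A n \<omega>) \<and> (A n \<omega> \<longrightarrow> \<bar>W n \<omega>\<bar> \<le> z * (1 + e))"
          using dn estimator_eq(2)[OF proc nearly_stationary sp dn] cov(2) iff[OF proc n h(1,2) kh gd] h(3) by simp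
      qed
    qed
  qed
  show "\<exists>G. (\<forall>\<^sub>F n in sequentially. G n \<in> sets (M n)) \<and> (\<lambda>n. measure (M n) (G n)) \<longlonglongrightarrow> 1 \<and>
       (\<forall>\<^sub>F n in sequentially. \<forall>\<omega>\<in>G n. (ls_denom n (\<lambda>t. y n t \<omega>) \<noteq> 0 \<and> ls_estimator n (\<lambda>t. y n t \<omega>) < 1)
      \<and> (\<bar>W n \<omega>\<bar> \<le> z * (1 - e) \<longrightarrow> A n \<omega>) \<and> (A n \<omega> \<longrightarrow> \<bar>W n \<omega>\<bar> \<le> z * (1 + e)))"
    using 1 2 3 by blast
qed

end

theorem theorem3p6:
  fixes c d \<alpha> lev z :: real
    and k r \<phi> \<rho> \<gamma> :: "nat \<Rightarrow> real"
    and M :: "nat \<Rightarrow> 'a measure"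
    and \<epsilon> \<eta> \<sigma> u y :: "nat \<Rightarrow> nat \<Rightarrow> 'a \<Rightarrow> real"
    and \<rho>_hat \<gamma>_hat :: "nat \<Rightarrow> 'a \<Rightarrow> real"
  assumes model: "sv_ar_model c d \<alpha> k r \<phi> \<rho> M \<epsilon> \<eta> \<sigma> u y"
    and nearly_stationary: "\<And>n. \<rho> n = 1 - c / k n"
    and rate_r: "\<And>q::real. q > 0 \<Longrightarrow> (\<lambda>n. r n powr q) \<in> o(k)"
    and rate_kr: "\<And>q::real. q > 0 \<Longrightarrow> (\<lambda>n. k n * r n powr q) \<in> o(\<lambda>n. real n)"
    and y0_integrable: "\<forall>\<^sub>F n in sequentially. integrable (M n) (\<lambda>\<omega>. y n 0 \<omega> ^ 4)"
    and y0_moment: "(\<lambda>n. prob_space.expectation (M n) (\<lambda>\<omega>. y n 0 \<omega> ^ 4)) \<in> o(\<lambda>n. (k n)\<^sup>2)"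
    and \<gamma>: "\<And>n. n \<ge> 2 \<Longrightarrow> \<rho> n = 1 - real n powr (- \<gamma> n)"
    and \<rho>_hat: "\<And>n \<omega>. \<rho>_hat n \<omega> = ls_estimator n (\<lambda>t. y n t \<omega>)"
    and \<gamma>_hat: "\<And>n \<omega>. \<gamma>_hat n \<omega> = - (ln \<bar>\<rho>_hat n \<omega> - 1\<bar> / ln (real n))"
    and level: "0 < lev" "lev < 1"
    and z: "z = std_normal_quantile ((1 + lev) / 2)"
  shows "(\<lambda>n. \<P>(\<omega> in M n.
            \<rho> n \<in> \<rho>_hat n \<omega> \<plusminus> z * (sqrt 2 / real n powr ((1 + \<gamma>_hat n \<omega>) / 2))
            \<bar> ls_denom n (\<lambda>t. y n t \<omega>) \<noteq> 0 \<and> \<rho>_hat n \<omega> < 1)) \<longlonglongrightarrow> lev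
       \<and> (\<lambda>n. \<P>(\<omega> in M n.
            \<gamma> n \<in> \<gamma>_hat n \<omega> \<plusminus> z * (sqrt 2 / (real n powr ((1 - \<gamma>_hat n \<omega>) / 2) * ln (real n)))
            \<bar> ls_denom n (\<lambda>t. y n t \<omega>) \<noteq> 0 \<and> \<rho>_hat n \<omega> < 1)) \<longlonglongrightarrow> lev"
proof -
  interpret sv_ar_rates c d \<alpha> k r \<phi> \<rho> M \<epsilon> \<eta> \<sigma> u y
    using model nearly_stationary rate_r rate_kr y0_integrable y0_moment
    by (intro sv_ar_rates.intro sv_ar_rates_axioms.intro)
  have zpos: "0 < z" unfolding z using level by (intro std_normal_quantile_pos) auto
  \<comment> \<open>The two-sided probability \<open>2 * p - 1\<close> at
    \<open>p = (1 + lev) / 2\<close>.\<close>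
  have lev: "2 * cdf std_normal_distribution z - 1 = lev"
    unfolding z using level by (subst std_normal_quantile_cdf) (auto simp: field_simps)
  have hat_measurable: "\<rho>_hat n \<in> borel_measurable (M n)" "\<gamma>_hat n \<in> borel_measurable (M n)"
    if proc: "sv_process (M n) (Z n) c \<alpha> (\<phi> n) \<kappa> (k n)" for n
  proof -
    show [measurable]: "\<rho>_hat n \<in> borel_measurable (M n)"
      using estimator_measurable(2)[OF proc] by (simp add: \<rho>_hat[abs_def])
    show "\<gamma>_hat n \<in> borel_measurable (M n)"
      unfolding \<gamma>_hat[abs_def] by measurable
  qed
  have cov: "(\<bar>W n \<omega>\<bar> \<le> z * (1 - 16 * h) \<longrightarrow> \<rho> n \<in> \<rho>_hat n \<omega> \<plusminus> z * (sqrt 2 / real n powr ((1 + \<gamma>_hat n \<omega>) / 2)))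
      \<and> (\<rho> n \<in> \<rho>_hat n \<omega> \<plusminus> z * (sqrt 2 / real n powr ((1 + \<gamma>_hat n \<omega>) / 2)) \<longrightarrow> \<bar>W n \<omega>\<bar> \<le> z * (1 + 16 * h))"
    "(\<bar>W n \<omega>\<bar> \<le> z * (1 - 16 * h) \<longrightarrow> \<gamma> n \<in> \<gamma>_hat n \<omega> \<plusminus> z * (sqrt 2 / (real n powr ((1 - \<gamma>_hat n \<omega>) / 2) * ln (real n))))
      \<and> (\<gamma> n \<in> \<gamma>_hat n \<omega> \<plusminus> z * (sqrt 2 / (real n powr ((1 - \<gamma>_hat n \<omega>) / 2) * ln (real n))) \<longrightarrow> \<bar>W n \<omega>\<bar> \<le> z * (1 + 16 * h))"
    if proc: "sv_process (M n) (Z n) c \<alpha> (\<phi> n) \<kappa> (k n)" and n: "2 \<le> n" and h: "0 < h" "h \<le> 1 / 16"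
      and kh: "c / (2 * k n) \<le> h" and gd: "\<omega> \<in> sv_process.good (M n) (Z n) c \<alpha> (\<phi> n) (k n) n h" for n h \<omega>
  proof -
    interpret P: sv_process "M n" "Z n" c \<alpha> "\<phi> n" \<kappa> "k n" by (rule proc)
    have \<gamma>': "1 - c / k n = 1 - real n powr (- \<gamma> n)" using \<gamma>[OF n] by (simp add: nearly_stationary)
    have sp: "\<omega> \<in> space (M n)" using gd by (simp add: P.good_def)
    note G = P.good_coverage[OF n h kh zpos gd \<gamma>']
    \<comment> \<open>On \<open>good\<close> the denominator is nonzero, so the default value of the
      quotient is never met.\<close>
    have \<rho>h: "\<rho>_hat n \<omega> = 1 - c / k n + P.N n \<omega> / P.D n \<omega>" 
      using estimator_eq[OF proc nearly_stationary sp] G(1) unfolding \<rho>_hat by simp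
    have \<gamma>h: "\<gamma>_hat n \<omega> = - (ln \<bar>1 - c / k n + P.N n \<omega> / P.D n \<omega> - 1\<bar> / ln (real n))"
      unfolding \<gamma>_hat \<rho>h ..
    show "(\<bar>W n \<omega>\<bar> \<le> z * (1 - 16 * h) \<longrightarrow> \<rho> n \<in> \<rho>_hat n \<omega> \<plusminus> z * (sqrt 2 / real n powr ((1 + \<gamma>_hat n \<omega>) / 2)))
      \<and> (\<rho> n \<in> \<rho>_hat n \<omega> \<plusminus> z * (sqrt 2 / real n powr ((1 + \<gamma>_hat n \<omega>) / 2)) \<longrightarrow> \<bar>W n \<omega>\<bar> \<le> z * (1 + 16 * h))"
      unfolding W_def nearly_stationary \<rho>h \<gamma>h using G(3,4) by blast
    show "(\<bar>W n \<omega>\<bar> \<le> z * (1 - 16 * h) \<longrightarrow> \<gamma> n \<in> \<gamma>_hat n \<omega> \<plusminus> z * (sqrt 2 / (real n powr ((1 - \<gamma>_hat n \<omega>) / 2) * ln (real n))))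
      \<and> (\<gamma> n \<in> \<gamma>_hat n \<omega> \<plusminus> z * (sqrt 2 / (real n powr ((1 - \<gamma>_hat n \<omega>) / 2) * ln (real n))) \<longrightarrow> \<bar>W n \<omega>\<bar> \<le> z * (1 + 16 * h))"
      unfolding W_def \<rho>h \<gamma>h using G(5,6) by blast
  qed
  have meas1: "\<forall>\<^sub>F n in sequentially. {\<omega> \<in> space (M n). \<rho> n \<in> \<rho>_hat n \<omega> \<plusminus> z * (sqrt 2 / real n powr ((1 + \<gamma>_hat n \<omega>) / 2))} \<in> sets (M n)"
    using eventually_sv_process
  proof eventually_elim
    case (elim n)
    note [measurable] = hat_measurable[OF elim]
    show ?case unfolding plus_minus_def atLeastAtMost_iff by measurable
  qed
  have meas2: "\<forall>\<^sub>F n in sequentially. {\<omega> \<in> space (M n). \<gamma> n \<in> \<gamma>_hat n \<omega> \<plusminus> z * (sqrt 2 / (real n powr ((1 - \<gamma>_hat n \<omega>) / 2) * ln (real n)))} \<in> sets (M n)"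
    using eventually_sv_process
  proof eventually_elim
    case (elim n)
    note [measurable] = hat_measurable[OF elim]
    show ?case unfolding plus_minus_def atLeastAtMost_iff by measurable
  qed
  show ?thesis
    using coverage_limit[OF zpos meas1 cov(1) \<gamma>] coverage_limit[OF zpos meas2 cov(2) \<gamma>]
    unfolding lev \<rho>_hat[symmetric] by blast
qed

end
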